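(* Let $p\geq 1$, $q\geq 0$ be integers, and for $(u,v)\neq(0,0)$ let $$e_S(u,v)=\sqrt{1+\frac{\|v\|^2-\|u\|^2}{\|u\|^2+\|v\|^2}}.$$ The spacelike geodesics in $\mathcal H^{p,q}$ are exactly the curves of one of the following types, where $(u,v,w)$ is a vector tangent to the geodesic at any point and, in types (2)--(4), the conic lies in a vertical 2-plane $V_\ell$ over an affine line $\ell$ directed by $(u,v)$: (1) a vertical straight line (the half-line $\{(x_0,y_0)\}\times(0,\infty)$); (2) a half-ellipse (the part in $\{z>0\}$) with foci on $\partial\mathcal H^{p,q}$, of eccentricity $e_S(u,v)$, for $\|u\|>\|v\|$; (3) (the part in $\{z>0\}$ of) a parabola with vertex and focus on $\partial\mathcal H^{p,q}$, for $\|u\|=\|v\|$; (4) half of a branch of hyperbola (the part in $\{z>0\}$ of one branch) with foci on $\partial\mathcal H^{p,q}$, meeting $\partial\mathcal H^{p,q}$, of eccentricity $e_S(u,v)$, for $\|u\|<\|v\|$. The first three types are complete, while the fourth type is incomplete at the end where it escapes from compact sets of $\mathcal H^{p,q}\cup\partial\mathcal H^{p,q}$.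
   Context: The half-space model is $\mathcal H^{p,q}=\{(x,y,z)\in\mathbb R^{p-1}\oplus\mathbb R^q\oplus\mathbb R : z>0\}$ with the pseudo-Riemannian metric $g_{p,q}=\frac{dx_1^2+\dots+dx_{p-1}^2-dy_1^2-\dots-dy_q^2+dz^2}{z^2}$; $\partial\mathcal H^{p,q}=\{z=0\}$. $\|\cdot\|$ denotes the Euclidean norm on $\mathbb R^{p-1}$ and on $\mathbb R^q$. For an affine line $\ell\subset\mathbb R^{p-1}\oplus\mathbb R^q$, $V_\ell=\{(x,y,z):(x,y)\in\ell,\ z>0\}$ is the vertical 2-plane over $\ell$; conics are understood in the corresponding affine 2-plane of $\mathbb R^{p+q}$, and foci, vertices and eccentricity are computed with respect to the Euclidean metric of $\mathbb R^{p+q}$ (circles are ellipses of eccentricity $0$ with both foci at the center). Geodesics are maximal, and "geodesic" refers to the image of the parametrized curve. A geodesic is spacelike if its tangent vectors are positive for $g_{p,q}$. A geodesic is complete if its affine parameterization is defined on all of $\mathbb R$; it is incomplete at an end if no affine parameterization going towards that end is defined on a half-open interval $[a,+\infty)$. *)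

theory Defs
  imports "HOL-Analysis.Analysis"
begin

section \<open>Geodesics of a pseudo-Riemannian metric on a subset of a coordinate space\<close>

text \<open>A metric assigns to every point a bilinear form on tangent vectors.\<close>

type_synonym 'n metric = "real^'n \<Rightarrow> real^'n \<Rightarrow> real^'n \<Rightarrow> real"

definition metric_matrix :: "'n::finite metric \<Rightarrow> real^'n \<Rightarrow> real^'n^'n" where
  "metric_matrix g x = (\<chi> i j. g x (axis i 1) (axis j 1))"

definition partial_deriv :: "'n::finite \<Rightarrow> (real^'n \<Rightarrow> real) \<Rightarrow> real^'n \<Rightarrow> real" where
  "partial_deriv i f x = deriv (\<lambda>t. f (x + t *\<^sub>R axis i 1)) 0"

text \<open>Christoffel symbols of the Levi-Civita connection; \<open>m\<close> is the upper index.\<close>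

definition christoffel :: "'n::finite metric \<Rightarrow> real^'n \<Rightarrow> 'n \<Rightarrow> 'n \<Rightarrow> 'n \<Rightarrow> real" where
  "christoffel g x m i j =
     (\<Sum>l\<in>UNIV. matrix_inv (metric_matrix g x) $ m $ l *
        (partial_deriv i (\<lambda>y. metric_matrix g y $ j $ l) x
         + partial_deriv j (\<lambda>y. metric_matrix g y $ i $ l) x
         - partial_deriv l (\<lambda>y. metric_matrix g y $ i $ j) x)) / 2"

text \<open>Affinely parametrized geodesics of \<open>(U, g)\<close> on an open interval \<open>J\<close>;
  the values of \<open>c\<close> outside \<open>J\<close> are irrelevant.\<close>

definition geodesic_on :: "'n::finite metric \<Rightarrow> (real^'n) set \<Rightarrow> (real \<Rightarrow> real^'n) \<Rightarrow> real set \<Rightarrow> bool"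
  where
  "geodesic_on g U c J \<longleftrightarrow>
     open J \<and> is_interval J \<and> J \<noteq> {} \<and> c ` J \<subseteq> U \<and>
     (\<exists>v a. \<forall>t\<in>J.
        (c has_vector_derivative v t) (at t) \<and>
        (v has_vector_derivative a t) (at t) \<and>
        (\<forall>m. a t $ m
           + (\<Sum>i\<in>UNIV. \<Sum>j\<in>UNIV. christoffel g (c t) m i j * v t $ i * v t $ j) = 0))"

definition maximal_geodesic ::
    "'n::finite metric \<Rightarrow> (real^'n) set \<Rightarrow> (real \<Rightarrow> real^'n) \<Rightarrow> real set \<Rightarrow> bool" where
  "maximal_geodesic g U c J \<longleftrightarrow>
     geodesic_on g U c J \<and>
     (\<forall>c' J'. geodesic_on g U c' J' \<and> J \<subseteq> J' \<and> (\<forall>t\<in>J. c' t = c t) \<longrightarrow> J' = J)"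

text \<open>Geodesics as images of maximal affinely parametrized geodesics.\<close>

definition affine_parametrization ::
    "'n::finite metric \<Rightarrow> (real^'n) set \<Rightarrow> (real^'n) set \<Rightarrow> (real \<Rightarrow> real^'n) \<Rightarrow> real set \<Rightarrow> bool"
  where
  "affine_parametrization g U \<gamma> c J \<longleftrightarrow> maximal_geodesic g U c J \<and> c ` J = \<gamma>"

definition spacelike_geodesic :: "'n::finite metric \<Rightarrow> (real^'n) set \<Rightarrow> (real^'n) set \<Rightarrow> bool" where
  "spacelike_geodesic g U \<gamma> \<longleftrightarrow>
     (\<exists>c J. affine_parametrization g U \<gamma> c J \<and>
        (\<forall>t\<in>J. 0 < g (c t) (vector_derivative c (at t)) (vector_derivative c (at t))))"

definition complete_geodesic :: "'n::finite metric \<Rightarrow> (real^'n) set \<Rightarrow> (real^'n) set \<Rightarrow> bool" where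
  "complete_geodesic g U \<gamma> \<longleftrightarrow>
     (\<exists>c J. affine_parametrization g U \<gamma> c J) \<and>
     (\<forall>c J. affine_parametrization g U \<gamma> c J \<longrightarrow> J = UNIV)"

text \<open>An end of a geodesic is encoded as the filter generated by the tails
  \<open>c ` {t \<in> J. s \<le> t}\<close> of an affine parametrization; both ends arise,
  since parametrizations may be reversed.\<close>

definition end_filter :: "(real \<Rightarrow> 'a) \<Rightarrow> real set \<Rightarrow> 'a filter" where
  "end_filter c J = (INF s\<in>J. principal (c ` (J \<inter> {s..})))"

definition geodesic_ends ::
    "'n::finite metric \<Rightarrow> (real^'n) set \<Rightarrow> (real^'n) set \<Rightarrow> (real^'n) filter set" where
  "geodesic_ends g U \<gamma> = {end_filter c J | c J. affine_parametrization g U \<gamma> c J}"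

definition incomplete_at_end ::
    "'n::finite metric \<Rightarrow> (real^'n) set \<Rightarrow> (real^'n) set \<Rightarrow> (real^'n) filter \<Rightarrow> bool" where
  "incomplete_at_end g U \<gamma> E \<longleftrightarrow>
     \<not> (\<exists>c J s. geodesic_on g U c J \<and> {s..} \<subseteq> J \<and> c ` J \<subseteq> \<gamma> \<and> filterlim c E at_top)"

definition escapes_compacts :: "'a::topological_space set \<Rightarrow> 'a filter \<Rightarrow> bool" where
  "escapes_compacts X E \<longleftrightarrow> (\<forall>K. compact K \<and> K \<subseteq> X \<longrightarrow> eventually (\<lambda>x. x \<notin> K) E)"

text \<open>Nonzero vectors tangent to a curve (as a set) at some point of it.\<close>

definition tangent_vector :: "'a::real_normed_vector set \<Rightarrow> 'a \<Rightarrow> bool" where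
  "tangent_vector \<gamma> w \<longleftrightarrow>
     w \<noteq> 0 \<and>
     (\<exists>c e. e > 0 \<and> (\<forall>t. \<bar>t\<bar> < e \<longrightarrow> c t \<in> \<gamma>) \<and> (c has_vector_derivative w) (at (0::real)))"

section \<open>Conics in an affine plane \<open>P\<close> of a Euclidean space\<close>

text \<open>Circles are the case \<open>F1 = F2\<close>, \<open>e = 0\<close>; \<open>a\<close> is the semi-major axis.\<close>

definition is_ellipse :: "'a::euclidean_space set \<Rightarrow> 'a \<Rightarrow> 'a \<Rightarrow> real \<Rightarrow> 'a set \<Rightarrow> bool" where
  "is_ellipse P F1 F2 e C \<longleftrightarrow>
     F1 \<in> P \<and> F2 \<in> P \<and>
     (\<exists>a. dist F1 F2 < 2 * a \<and> e = dist F1 F2 / (2 * a) \<and>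
          C = {x \<in> P. dist x F1 + dist x F2 = 2 * a})"

text \<open>The branch enclosing \<open>F2\<close>; the other branch is obtained by exchanging the foci.\<close>

definition is_hyperbola_branch :: "'a::euclidean_space set \<Rightarrow> 'a \<Rightarrow> 'a \<Rightarrow> real \<Rightarrow> 'a set \<Rightarrow> bool" where
  "is_hyperbola_branch P F1 F2 e B \<longleftrightarrow>
     F1 \<in> P \<and> F2 \<in> P \<and>
     (\<exists>a. 0 < 2 * a \<and> 2 * a < dist F1 F2 \<and> e = dist F1 F2 / (2 * a) \<and>
          B = {x \<in> P. dist x F1 - dist x F2 = 2 * a})"

text \<open>Parabola with focus \<open>F\<close> and vertex \<open>V\<close>; \<open>D\<close> is the directrix. The vertex is the
  midpoint of the focus and its orthogonal projection to the directrix.\<close>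

definition is_parabola :: "'a::euclidean_space set \<Rightarrow> 'a \<Rightarrow> 'a \<Rightarrow> 'a set \<Rightarrow> bool" where
  "is_parabola P F V C \<longleftrightarrow>
     F \<in> P \<and>
     (\<exists>D. affine D \<and> aff_dim D = 1 \<and> D \<subseteq> P \<and> F \<notin> D \<and>
          V = midpoint F (closest_point D F) \<and>
          C = {x \<in> P. dist x F = infdist x D})"

section \<open>The half-space model\<close>

text \<open>The space \<open>\<real>^(p-1) \<oplus> \<real>^q \<oplus> \<real>\<close> is \<open>real^'n\<close> with \<open>CARD('n) = p + q\<close>: the
  \<open>z\<close>-coordinate has index \<open>k\<close>, the \<open>y\<close>-coordinates are indexed by \<open>Y\<close> (with
  \<open>k \<notin> Y\<close> and \<open>card Y = q\<close>), the \<open>x\<close>-coordinates by the remaining \<open>p - 1\<close> indices.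
  Index types are nonempty, so using separate types for the three summands would
  exclude \<open>p = 1\<close> and \<open>q = 0\<close>.\<close>

definition half_space :: "'n::finite \<Rightarrow> (real^'n) set" where
  "half_space k = {x. 0 < x $ k}"

definition half_space_boundary :: "'n::finite \<Rightarrow> (real^'n) set" where
  "half_space_boundary k = {x. x $ k = 0}"

definition half_space_metric :: "'n::finite set \<Rightarrow> 'n \<Rightarrow> 'n metric" where
  "half_space_metric Y k x v w =
     (\<Sum>i\<in>UNIV. (if i \<in> Y then - 1 else 1) * v $ i * w $ i) / (x $ k)\<^sup>2"

definition norm_x :: "'n::finite set \<Rightarrow> 'n \<Rightarrow> real^'n \<Rightarrow> real" where
  "norm_x Y k w = L2_set (\<lambda>i. w $ i) (- insert k Y)"

definition norm_y :: "'n::finite set \<Rightarrow> real^'n \<Rightarrow> real" where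
  "norm_y Y w = L2_set (\<lambda>i. w $ i) Y"

definition ecc_S :: "'n::finite set \<Rightarrow> 'n \<Rightarrow> real^'n \<Rightarrow> real" where
  "ecc_S Y k w =
     sqrt (1 + ((norm_y Y w)\<^sup>2 - (norm_x Y k w)\<^sup>2) / ((norm_x Y k w)\<^sup>2 + (norm_y Y w)\<^sup>2))"

text \<open>Projection \<open>(x, y, z) \<mapsto> (x, y, 0)\<close>; \<open>\<real>^(p-1) \<oplus> \<real>^q\<close> is identified with
  \<^term>\<open>half_space_boundary k\<close>.\<close>

definition horizontal :: "'n::finite \<Rightarrow> real^'n \<Rightarrow> real^'n" where
  "horizontal k x = (\<chi> i. if i = k then 0 else x $ i)"

definition horizontal_line :: "'n::finite \<Rightarrow> real^'n \<Rightarrow> (real^'n) set \<Rightarrow> bool" where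
  "horizontal_line k d L \<longleftrightarrow>
     d \<in> half_space_boundary k \<and> d \<noteq> 0 \<and>
     (\<exists>a\<in>half_space_boundary k. L = range (\<lambda>t::real. a + t *\<^sub>R d))"

text \<open>The full affine 2-plane over a line, and its part \<open>V_L\<close> in the half-space.\<close>

definition plane_over :: "'n::finite \<Rightarrow> (real^'n) set \<Rightarrow> (real^'n) set" where
  "plane_over k L = {x. horizontal k x \<in> L}"

definition vertical_plane :: "'n::finite \<Rightarrow> (real^'n) set \<Rightarrow> (real^'n) set" where
  "vertical_plane k L = plane_over k L \<inter> half_space k"

section \<open>The four types of curves\<close>

text \<open>The argument \<open>w\<close> stands for a tangent vector of the curve \<open>\<gamma>\<close>; only its horizontal
  part, with components \<open>u \<in> \<real>^(p-1)\<close> and \<open>v \<in> \<real>^q\<close>, matters.\<close>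

definition vertical_half_line :: "'n::finite \<Rightarrow> (real^'n) set \<Rightarrow> bool" where
  "vertical_half_line k \<gamma> \<longleftrightarrow>
     (\<exists>a\<in>half_space_boundary k. \<gamma> = (\<lambda>z. a + z *\<^sub>R axis k 1) ` {0<..})"

definition half_ellipse_type :: "'n::finite set \<Rightarrow> 'n \<Rightarrow> (real^'n) set \<Rightarrow> real^'n \<Rightarrow> bool" where
  "half_ellipse_type Y k \<gamma> w \<longleftrightarrow>
     norm_x Y k w > norm_y Y w \<and>
     (\<exists>L C. horizontal_line k (horizontal k w) L \<and>
        (\<exists>F1\<in>half_space_boundary k. \<exists>F2\<in>half_space_boundary k.
            is_ellipse (plane_over k L) F1 F2 (ecc_S Y k w) C) \<and>
        \<gamma> = C \<inter> vertical_plane k L)"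

definition half_parabola_type :: "'n::finite set \<Rightarrow> 'n \<Rightarrow> (real^'n) set \<Rightarrow> real^'n \<Rightarrow> bool" where
  "half_parabola_type Y k \<gamma> w \<longleftrightarrow>
     norm_x Y k w = norm_y Y w \<and>
     (\<exists>L C. horizontal_line k (horizontal k w) L \<and>
        (\<exists>F\<in>half_space_boundary k. \<exists>V\<in>half_space_boundary k.
            is_parabola (plane_over k L) F V C) \<and>
        \<gamma> = C \<inter> vertical_plane k L)"

definition half_hyperbola_branch_type ::
    "'n::finite set \<Rightarrow> 'n \<Rightarrow> (real^'n) set \<Rightarrow> real^'n \<Rightarrow> bool" where
  "half_hyperbola_branch_type Y k \<gamma> w \<longleftrightarrow>
     norm_x Y k w < norm_y Y w \<and>
     (\<exists>L B. horizontal_line k (horizontal k w) L \<and>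
        (\<exists>F1\<in>half_space_boundary k. \<exists>F2\<in>half_space_boundary k.
            is_hyperbola_branch (plane_over k L) F1 F2 (ecc_S Y k w) B) \<and>
        B \<inter> half_space_boundary k \<noteq> {} \<and>
        \<gamma> = B \<inter> vertical_plane k L)"

definition of_listed_type :: "'n::finite set \<Rightarrow> 'n \<Rightarrow> (real^'n) set \<Rightarrow> real^'n \<Rightarrow> bool" where
  "of_listed_type Y k \<gamma> w \<longleftrightarrow>
     vertical_half_line k \<gamma> \<or> half_ellipse_type Y k \<gamma> w \<or>
     half_parabola_type Y k \<gamma> w \<or> half_hyperbola_branch_type Y k \<gamma> w"

end

theory Submission
  imports Defs
begin

text \<open>Let \<open>q\<close> be the flat form (the sum of the signed squares of the coordinates), so that the metric
is \<open>q / z\<^sup>2\<close>. A curve with velocity \<open>v\<close> is a geodesic iff its acceleration is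
\<open>(2 z' v - q(v) e) / z\<close>, where \<open>e\<close> is the vertical unit vector. Two kinds of first integrals solve this
system. The horizontal components of \<open>v / z\<^sup>2\<close> are constant, and so is \<open>E = q(v) / z\<^sup>2\<close>; as a
consequence the reciprocal height \<open>s = 1 / z\<close> satisfies the linear equation \<open>s'' = E s\<close>.

For a spacelike geodesic \<open>E > 0\<close>. An affine change of the parameter achieves \<open>E = 1\<close> and
\<open>s = exp t + B exp (- t)\<close>; integrating the horizontal velocity then gives
\<open>x\<^sub>0 + (exp (- t) / s) \<eta> + (1 / s) e\<close> with \<open>x\<^sub>0\<close> and \<open>\<eta>\<close> horizontal and \<open>B = q(\<eta>)\<close>. With
\<open>X = exp (- t) / s\<close> the image is the half conic of all \<open>x\<^sub>0 + X \<eta> + z e\<close> with \<open>X, z > 0\<close> and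
\<open>z\<^sup>2 = X - q(\<eta>) X\<^sup>2\<close>. So the spacelike geodesics are exactly these half conics
(\<open>spacelike_geodesic_iff_geod_curve\<close>), with vertical half-lines for \<open>\<eta> = 0\<close>.

Everything else is read off from the sign of \<open>q(\<eta>)\<close>.

\<^item> Completing the square identifies the half conic as an ellipse, a parabola or one branch of a
  hyperbola, for \<open>q(\<eta>)\<close> positive, zero or negative, with its foci on \<open>z = 0\<close>. For an ellipse or
  a hyperbola the quotient of the squared semi-axes is \<open>q(\<eta>) / \<parallel>\<eta>\<parallel>\<^sup>2\<close> up to sign, and this number is
  \<open>1 - e\<^sub>S\<^sup>2\<close>. Conversely each of the listed
  curves is of this form (\<open>half_ellipse_type_iff\<close>, \<open>half_hyperbola_branch_type_iff\<close>,
  \<open>half_parabola_type_iff\<close>).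

\<^item> The parameter runs through all \<open>t\<close> with \<open>exp (2 t) + B > 0\<close>. This is the whole line iff \<open>B \<ge> 0\<close>. For
  \<open>B < 0\<close> the height tends to infinity as \<open>t\<close> decreases to the finite bound of the domain, while the
  other end converges to the boundary point \<open>x\<^sub>0\<close>.

Completeness and incompleteness speak of all affine parametrizations of a given curve. These are
controlled by a rigidity statement: a geodesic inside one of the half conics is tangent to it, hence
by uniqueness it is an affine reparametrization of the normal form
(\<open>geodesic_inside_geod_curve\<close>).\<close>

section \<open>The geodesic equation of the half-space model\<close>

text \<open>The form of signature \<open>(p, q)\<close> to which the metric of the half-space is conformal, with
factor \<open>1 / z\<^sup>2\<close>.\<close>

definition flat_form :: "'n::finite set \<Rightarrow> real^'n \<Rightarrow> real^'n \<Rightarrow> real" where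
  "flat_form Y v w = (\<Sum>i\<in>UNIV. (if i \<in> Y then - 1 else 1) * v $ i * w $ i)"

lemma half_space_metric_flat_form:
  "half_space_metric Y k x v w = flat_form Y v w / (x $ k)\<^sup>2"
  by (simp add: half_space_metric_def flat_form_def)

lemma flat_form_axis_axis:
  "flat_form Y (axis i 1) (axis j 1) = (if i = j then if i \<in> Y then - 1 else 1 else 0)"
proof -
  have "flat_form Y (axis i 1) (axis j 1)
      = (\<Sum>l\<in>UNIV. if l = i then (if i = j then if i \<in> Y then - 1 else 1 else 0) else 0)"
    unfolding flat_form_def by (rule sum.cong) (auto simp: axis_def)
  then show ?thesis by simp
qed

lemma flat_form_eq_sum_sum:
  "flat_form Y v w
     = (\<Sum>i\<in>UNIV. \<Sum>j\<in>UNIV. flat_form Y (axis i 1) (axis j 1) * v $ i * w $ j)"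
proof -
  have "flat_form Y (axis i 1) (axis j 1) * v $ i * w $ j
      = (if j = i then (if i \<in> Y then - 1 else 1) * v $ i * w $ i else 0)" for i j
    by (simp add: flat_form_axis_axis)
  then show ?thesis by (simp add: flat_form_def)
qed

lemma metric_matrix_half_space:
  "metric_matrix (half_space_metric Y k) x $ i $ j = flat_form Y (axis i 1) (axis j 1) / (x $ k)\<^sup>2"
  by (simp add: metric_matrix_def half_space_metric_flat_form)

lemma matrix_inv_metric_matrix_half_space:
  assumes "x $ k \<noteq> 0"
  shows "matrix_inv (metric_matrix (half_space_metric Y k) x) $ i $ j
    = (x $ k)\<^sup>2 * flat_form Y (axis i 1) (axis j 1)"
proof -
  let ?A = "metric_matrix (half_space_metric Y k) x"
  let ?B = "(\<chi> i j. (x $ k)\<^sup>2 * flat_form Y (axis i 1) (axis j 1)) :: real^'a^'a"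
  have "(\<Sum>l\<in>UNIV. ?A $ i $ l * ?B $ l $ j) = (\<Sum>l\<in>UNIV. if l = i then mat 1 $ i $ j else 0)"
    and "(\<Sum>l\<in>UNIV. ?B $ i $ l * ?A $ l $ j) = (\<Sum>l\<in>UNIV. if l = i then mat 1 $ i $ j else 0)" for i j
    using assms
    by (intro sum.cong refl; simp add: metric_matrix_half_space mat_def flat_form_axis_axis)+
  then have "?A ** ?B = mat 1" "?B ** ?A = mat 1"
    by (simp_all add: vec_eq_iff matrix_matrix_mult_def)
  then have "?A ** ?B = mat 1 \<and> ?B ** ?A = mat 1" by (rule conjI)
  then have "?A ** matrix_inv ?A = mat 1 \<and> matrix_inv ?A ** ?A = mat 1"
    unfolding matrix_inv_def by (rule someI)
  then have "?A ** matrix_inv ?A = mat 1" by (rule conjunct1)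
  then have "?B ** ?A ** matrix_inv ?A = ?B"
    by (simp only: matrix_mul_assoc[symmetric] matrix_mul_rid)
  then have "matrix_inv ?A = ?B"
    by (simp only: \<open>?B ** ?A = mat 1\<close> matrix_mul_lid)
  then show ?thesis by simp
qed

lemma partial_deriv_metric_matrix_half_space:
  assumes "x $ k \<noteq> 0"
  shows "partial_deriv i (\<lambda>y. metric_matrix (half_space_metric Y k) y $ j $ l) x
    = (if i = k then - 2 * flat_form Y (axis j 1) (axis l 1) / (x $ k) ^ 3 else 0)"
proof (cases "i = k")
  case True
  have "((\<lambda>t. flat_form Y (axis j 1) (axis l 1) / (x $ k + t)\<^sup>2) has_real_derivative
      - 2 * flat_form Y (axis j 1) (axis l 1) / (x $ k) ^ 3) (at 0)"
    using assms by (auto intro!: derivative_eq_intros simp: power2_eq_square power3_eq_cube field_simps)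
  then show ?thesis
    using True by (simp add: partial_deriv_def metric_matrix_half_space axis_def DERIV_imp_deriv)
next
  case False
  then show ?thesis
    by (simp add: partial_deriv_def metric_matrix_half_space axis_def)
qed

text \<open>The metric matrix is diagonal with entries \<open>\<plusminus> 1 / z\<^sup>2\<close>. So the sum over the lowered index has
one term, and only derivatives in the direction of \<open>z\<close> survive.\<close>

lemma christoffel_half_space:
  assumes "k \<notin> Y" and "x $ k \<noteq> 0"
  shows "christoffel (half_space_metric Y k) x m i j
    = - ((if i = k \<and> j = m then 1 else 0) + (if j = k \<and> i = m then 1 else 0)
         - (if m = k then flat_form Y (axis i 1) (axis j 1) else 0)) / x $ k"
proof -
  have "christoffel (half_space_metric Y k) x m i j
    = (x $ k)\<^sup>2 * flat_form Y (axis m 1) (axis m 1) *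
        (partial_deriv i (\<lambda>y. metric_matrix (half_space_metric Y k) y $ j $ m) x
         + partial_deriv j (\<lambda>y. metric_matrix (half_space_metric Y k) y $ i $ m) x
         - partial_deriv m (\<lambda>y. metric_matrix (half_space_metric Y k) y $ i $ j) x) / 2"
    unfolding christoffel_def matrix_inv_metric_matrix_half_space[of x k, OF assms(2)]
    by (subst sum.remove[where x=m]) (auto intro!: sum.neutral simp: flat_form_axis_axis)
  also have "\<dots> = - ((if i = k then flat_form Y (axis m 1) (axis m 1) * flat_form Y (axis j 1) (axis m 1) else 0)
      + (if j = k then flat_form Y (axis m 1) (axis m 1) * flat_form Y (axis i 1) (axis m 1) else 0)
      - (if m = k then flat_form Y (axis m 1) (axis m 1) * flat_form Y (axis i 1) (axis j 1) else 0)) / x $ k"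
  proof -
    have "X\<^sup>2 * s * ((if i = k then - 2 * a / X ^ 3 else 0) + (if j = k then - 2 * b / X ^ 3 else 0)
        - (if m = k then - 2 * c / X ^ 3 else 0)) / 2
      = - ((if i = k then s * a else 0) + (if j = k then s * b else 0) - (if m = k then s * c else 0)) / X"
      if "X \<noteq> 0" for X s a b c :: real
      using that by (simp add: power2_eq_square power3_eq_cube field_simps)
    from this[OF assms(2)] show ?thesis
      unfolding partial_deriv_metric_matrix_half_space[of x k, OF assms(2)] .
  qed
  also have "\<dots> = - ((if i = k \<and> j = m then 1 else 0) + (if j = k \<and> i = m then 1 else 0)
         - (if m = k then flat_form Y (axis i 1) (axis j 1) else 0)) / x $ k"
  proof -
    have "(if l = k then flat_form Y (axis m 1) (axis m 1) * flat_form Y (axis l' 1) (axis m 1) else 0)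
        = (if l = k \<and> l' = m then 1 else 0)" for l l'
      by (simp add: flat_form_axis_axis)
    moreover have "(if m = k then flat_form Y (axis m 1) (axis m 1) * g else 0) = (if m = k then g else 0)" for g
      using assms(1) by (simp add: flat_form_axis_axis)
    ultimately show ?thesis by (simp only:)
  qed
  finally show ?thesis .
qed

lemma sum_christoffel_half_space:
  assumes "k \<notin> Y" and "x $ k \<noteq> 0"
  shows "(\<Sum>i\<in>UNIV. \<Sum>j\<in>UNIV. christoffel (half_space_metric Y k) x m i j * v $ i * v $ j)
    = ((if m = k then flat_form Y v v else 0) - 2 * v $ k * v $ m) / x $ k"
proof -
  have *: "christoffel (half_space_metric Y k) x m i j * v $ i * v $ j
      = ((if m = k then flat_form Y (axis i 1) (axis j 1) * v $ i * v $ j else 0)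
         - (if j = m then if i = k then v $ k * v $ m else 0 else 0)
         - (if j = k then if i = m then v $ k * v $ m else 0 else 0)) / x $ k" for i j
  proof -
    have "- (a + b - c) / X * y * z = (c * y * z - a * y * z - b * y * z) / X" for a b c X y z :: real
      by (simp add: divide_inverse algebra_simps)
    moreover have "(if i = k \<and> j = m then 1 else 0) * v $ i * v $ j
        = (if j = m then if i = k then v $ k * v $ m else 0 else 0)"
      and "(if j = k \<and> i = m then 1 else 0) * v $ i * v $ j
        = (if j = k then if i = m then v $ k * v $ m else 0 else 0)"
      and "(if m = k then g else 0) * v $ i * v $ j = (if m = k then g * v $ i * v $ j else 0)" for g
      by auto
    ultimately show ?thesis
      unfolding christoffel_half_space[OF assms] by (simp only:)
  qed
  have **: "(\<Sum>i\<in>UNIV. \<Sum>j\<in>UNIV. if m = k then flat_form Y (axis i 1) (axis j 1) * v $ i * v $ j else 0)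
      = (if m = k then flat_form Y v v else 0)"
    by (simp add: flat_form_eq_sum_sum[of Y v v])
  show ?thesis
    unfolding * sum_divide_distrib[symmetric] sum_subtractf ** by simp
qed

text \<open>The contracted Christoffel symbols are \<open>(q(v) e - 2 v\<^sub>z v) / z\<close>, which leaves a system without any
reference to the connection.\<close>

lemma geodesic_on_half_space_iff:
  assumes "k \<notin> Y"
  shows "geodesic_on (half_space_metric Y k) (half_space k) c J \<longleftrightarrow>
     open J \<and> is_interval J \<and> J \<noteq> {} \<and> (\<forall>t\<in>J. 0 < c t $ k) \<and>
     (\<exists>v a. \<forall>t\<in>J.
        (c has_vector_derivative v t) (at t) \<and>
        (v has_vector_derivative a t) (at t) \<and>
        (\<forall>m. a t $ m = (2 * v t $ k * v t $ m - (if m = k then flat_form Y (v t) (v t) else 0)) / c t $ k))"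
proof (cases "\<forall>t\<in>J. 0 < c t $ k")
  case True
  then have nz: "t \<in> J \<Longrightarrow> c t $ k \<noteq> 0" for t by force
  have solve: "a + (F - w) / z = 0 \<longleftrightarrow> a = (w - F) / z" for a F w z :: real
  proof -
    have "(F - w) / z = - ((w - F) / z)" by (metis minus_diff_eq minus_divide_left)
    then show ?thesis by linarith
  qed
  have equation: "(a $ m + (\<Sum>i\<in>UNIV. \<Sum>j\<in>UNIV. christoffel (half_space_metric Y k) (c t) m i j * v $ i * v $ j) = 0)
     \<longleftrightarrow> (a $ m = (2 * v $ k * v $ m - (if m = k then flat_form Y v v else 0)) / c t $ k)"
    if "t \<in> J" for t a v m
    unfolding sum_christoffel_half_space[OF assms nz[OF that]] by (rule solve)
  have "c ` J \<subseteq> half_space k" using True by (auto simp: half_space_def)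
  then show ?thesis
    using True unfolding geodesic_on_def by (simp add: equation cong: ball_cong)
next
  case False
  then show ?thesis
    by (auto simp: geodesic_on_def half_space_def image_subset_iff)
qed

lemma flat_form_linear:
  "flat_form Y (v + v') w = flat_form Y v w + flat_form Y v' w"
  "flat_form Y w (v + v') = flat_form Y w v + flat_form Y w v'"
  "flat_form Y w (v - v') = flat_form Y w v - flat_form Y w v'"
  "flat_form Y (a *\<^sub>R v) w = a * flat_form Y v w"
  "flat_form Y w (a *\<^sub>R v) = a * flat_form Y w v"
  by (simp_all add: flat_form_def algebra_simps sum.distrib sum_subtractf sum_distrib_left)

lemma flat_form_scaleR: "flat_form Y (s *\<^sub>R d) (s *\<^sub>R d) = s\<^sup>2 * flat_form Y d d"
  by (simp add: flat_form_linear power2_eq_square)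

lemma flat_form_axis_right:
  assumes "k \<notin> Y"
  shows "flat_form Y v (axis k 1) = v $ k"
proof -
  have "flat_form Y v (axis k 1) = (\<Sum>i\<in>UNIV. if i = k then v $ k else 0)"
    unfolding flat_form_def by (rule sum.cong) (use assms in \<open>auto simp: axis_def\<close>)
  then show ?thesis by simp
qed

lemma flat_form_commute: "flat_form Y v w = flat_form Y w v"
  by (simp add: flat_form_def mult_ac)

lemma flat_form_horizontal_plus_axis:
  assumes "k \<notin> Y" and "h $ k = 0"
  shows "flat_form Y (a *\<^sub>R h + b *\<^sub>R axis k 1) (a *\<^sub>R h + b *\<^sub>R axis k 1) = a\<^sup>2 * flat_form Y h h + b\<^sup>2"
proof -
  have "flat_form Y h (axis k 1) = 0" "flat_form Y (axis k 1) h = 0"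
    using flat_form_axis_right[OF assms(1), of h] assms(2) by (simp_all add: flat_form_commute)
  moreover have "flat_form Y (axis k 1) (axis k 1) = 1"
    using flat_form_axis_right[OF assms(1), of "axis k 1"] by (simp add: axis_def)
  ultimately show ?thesis by (simp add: flat_form_linear power2_eq_square)
qed

section \<open>Calculus on intervals\<close>

lemma has_real_derivative_vec_nth:
  assumes "(c has_vector_derivative v) (at t)"
  shows "((\<lambda>t. c t $ i) has_real_derivative v $ i) (at t)"
  using bounded_linear.has_vector_derivative[OF bounded_linear_vec_nth assms]
  by (simp add: has_real_derivative_iff_has_vector_derivative)

lemma constant_on_interval:
  fixes f :: "real \<Rightarrow> real"
  assumes "is_interval J" and "\<And>t. t \<in> J \<Longrightarrow> (f has_real_derivative 0) (at t)" and "s \<in> J" "t \<in> J"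
  shows "f t = f s"
proof -
  have "\<And>x. x \<in> J \<Longrightarrow> (f has_real_derivative 0) (at x within J)"
    using assms(2) has_field_derivative_at_within by blast
  from has_field_derivative_zero_constant[OF is_interval_convex[OF assms(1)] this]
  show ?thesis using assms(3,4) by auto
qed

text \<open>The two first-order factors of \<open>f'' - \<rho>\<^sup>2 f\<close> are integrated one after the other: first
\<open>(f' + \<rho> f) exp (- \<rho> t)\<close> is constant, then \<open>f exp (\<rho> t)\<close>. In contrast to a comparison with the
general solution this covers \<open>\<rho> = 0\<close> as well.\<close>

lemma linear_ode_zero:
  fixes f f' :: "real \<Rightarrow> real"
  assumes "is_interval J" and "t0 \<in> J"
    and f: "\<And>t. t \<in> J \<Longrightarrow> (f has_real_derivative f' t) (at t)"
    and f': "\<And>t. t \<in> J \<Longrightarrow> (f' has_real_derivative \<rho>\<^sup>2 * f t) (at t)"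
    and "f t0 = 0" and "f' t0 = 0" and "t \<in> J"
  shows "f t = 0"
proof -
  have *: "f' s = - \<rho> * f s" if "s \<in> J" for s
  proof -
    have "((\<lambda>t. (f' t + \<rho> * f t) * exp (- \<rho> * t)) has_real_derivative 0) (at t)" if "t \<in> J" for t
      by (rule derivative_eq_intros f[OF that] f'[OF that] refl | simp add: algebra_simps power2_eq_square)+
    from constant_on_interval[OF assms(1) this \<open>t0 \<in> J\<close> that] show ?thesis
      using assms by simp
  qed
  have "((\<lambda>t. f t * exp (\<rho> * t)) has_real_derivative 0) (at t)" if "t \<in> J" for t
    using *[OF that]
    by (auto intro!: derivative_eq_intros f[OF that] simp: algebra_simps)
  from constant_on_interval[OF assms(1) this \<open>t0 \<in> J\<close> \<open>t \<in> J\<close>] show ?thesis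
    using assms by simp
qed

section \<open>Normal form of spacelike geodesics\<close>

text \<open>The solutions of \<open>s'' = s\<close> in which \<open>exp\<close> has a positive coefficient, up to a translation of time.
The value is the reciprocal of the height \<open>z\<close>; changing the sign of \<open>B\<close> gives the derivative.\<close>

definition recip_height :: "real \<Rightarrow> real \<Rightarrow> real" where
  "recip_height B t = exp t + B * exp (- t)"

text \<open>Only times at which the height is positive belong to the geodesic.\<close>

definition geod_dom :: "real \<Rightarrow> real set" where
  "geod_dom B = {t. 0 < recip_height B t}"

text \<open>The normal form of a spacelike geodesic: affine parametrizations are normalized by
\<open>q(v) = z\<^sup>2\<close> and by the leading coefficient \<open>1\<close> of the reciprocal height. The coefficient \<open>B\<close> is then
forced to be \<open>q(\<eta>)\<close>.\<close>

definition geod :: "'n::finite set \<Rightarrow> 'n \<Rightarrow> real^'n \<Rightarrow> real^'n \<Rightarrow> real \<Rightarrow> real^'n" where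
  "geod Y k x0 \<eta> t =
     x0 + (exp (- t) / recip_height (flat_form Y \<eta> \<eta>) t) *\<^sub>R \<eta>
        + (1 / recip_height (flat_form Y \<eta> \<eta>) t) *\<^sub>R axis k 1"

definition geod_vel :: "'n::finite set \<Rightarrow> 'n \<Rightarrow> real^'n \<Rightarrow> real \<Rightarrow> real^'n" where
  "geod_vel Y k \<eta> t =
     (- 2 / (recip_height (flat_form Y \<eta> \<eta>) t)\<^sup>2) *\<^sub>R \<eta>
     + (- recip_height (- flat_form Y \<eta> \<eta>) t / (recip_height (flat_form Y \<eta> \<eta>) t)\<^sup>2) *\<^sub>R axis k 1"

lemma recip_height_derivative:
  "(recip_height B has_real_derivative recip_height (- B) t) (at t)"
  unfolding recip_height_def by (auto intro!: derivative_eq_intros)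

lemmas recip_height_derivative' = DERIV_chain2[OF recip_height_derivative]

text \<open>The conserved energy of \<open>s'' = s\<close>. It is what makes \<open>q(v) / z\<^sup>2\<close> equal to \<open>1\<close> on the normal
form.\<close>

lemma recip_height_square: "(recip_height (- B) t)\<^sup>2 + 4 * B = (recip_height B t)\<^sup>2"
proof -
  have "exp t * exp (- t) = 1" by (simp add: exp_minus)
  then show ?thesis unfolding recip_height_def by algebra
qed

text \<open>The horizontal velocity has to be a constant multiple of \<open>z\<^sup>2 = 1 / s\<^sup>2\<close>. This primitive of \<open>- 2 / s\<^sup>2\<close>
serves all signs of \<open>B\<close>, whereas \<open>s' / s\<close> would degenerate at \<open>B = 0\<close>.\<close>

lemma exp_div_recip_height_derivative:
  assumes "recip_height B t \<noteq> 0"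
  shows "((\<lambda>t. exp (- t) / recip_height B t) has_real_derivative - 2 / (recip_height B t)\<^sup>2) (at t)"
proof -
  have e: "exp t * exp (- t) = 1" by (simp add: exp_minus)
  have "- exp (- t) * recip_height B t - exp (- t) * recip_height (- B) t = - 2"
    unfolding recip_height_def using e by (simp add: algebra_simps)
  then show ?thesis
    using assms by (auto intro!: derivative_eq_intros recip_height_derivative' simp: power2_eq_square)
qed

lemma recip_derivative:
  assumes "recip_height B t \<noteq> 0"
  shows "((\<lambda>t. 1 / recip_height B t) has_real_derivative - recip_height (- B) t / (recip_height B t)\<^sup>2) (at t)"
  by (rule derivative_eq_intros recip_height_derivative' refl assms | simp add: power2_eq_square)+

lemma geod_has_vector_derivative:
  assumes "t \<in> geod_dom (flat_form Y \<eta> \<eta>)"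
  shows "(geod Y k x0 \<eta> has_vector_derivative geod_vel Y k \<eta> t) (at t)"
proof -
  have "recip_height (flat_form Y \<eta> \<eta>) t \<noteq> 0" using assms by (simp add: geod_dom_def)
  note d = exp_div_recip_height_derivative[OF this] recip_derivative[OF this]
  note curve = has_vector_derivative_add[OF has_vector_derivative_add[OF has_vector_derivative_const
        has_vector_derivative_scaleR[OF d(1) has_vector_derivative_const]]
        has_vector_derivative_scaleR[OF d(2) has_vector_derivative_const]]
  have "geod Y k x0 \<eta> = (\<lambda>t. x0 + (exp (- t) / recip_height (flat_form Y \<eta> \<eta>) t) *\<^sub>R \<eta>
        + (1 / recip_height (flat_form Y \<eta> \<eta>) t) *\<^sub>R axis k 1)"
    by (simp add: geod_def fun_eq_iff)
  then show ?thesis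
    using curve by (simp add: geod_vel_def)
qed

lemma geod_nth_k: "x0 $ k = 0 \<Longrightarrow> \<eta> $ k = 0 \<Longrightarrow> geod Y k x0 \<eta> t $ k = 1 / recip_height (flat_form Y \<eta> \<eta>) t"
  by (simp add: geod_def axis_def)

lemma flat_form_geod_vel:
  assumes "k \<notin> Y" and "\<eta> $ k = 0" and "t \<in> geod_dom (flat_form Y \<eta> \<eta>)"
  shows "flat_form Y (geod_vel Y k \<eta> t) (geod_vel Y k \<eta> t) = 1 / (recip_height (flat_form Y \<eta> \<eta>) t)\<^sup>2"
proof -
  let ?B = "flat_form Y \<eta> \<eta>"
  have "recip_height ?B t \<noteq> 0" using assms by (simp add: geod_dom_def)
  have "flat_form Y (geod_vel Y k \<eta> t) (geod_vel Y k \<eta> t)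
      = (- 2 / (recip_height ?B t)\<^sup>2)\<^sup>2 * ?B + (- recip_height (- ?B) t / (recip_height ?B t)\<^sup>2)\<^sup>2"
    unfolding geod_vel_def by (rule flat_form_horizontal_plus_axis[OF assms(1,2)])
  also have "\<dots> = ((recip_height (- ?B) t)\<^sup>2 + 4 * ?B) / ((recip_height ?B t)\<^sup>2)\<^sup>2"
    by (simp add: power_divide add_divide_distrib)
  also have "\<dots> = (recip_height ?B t)\<^sup>2 / ((recip_height ?B t)\<^sup>2)\<^sup>2"
    by (simp only: recip_height_square)
  also have "\<dots> = 1 / (recip_height ?B t)\<^sup>2"
    using \<open>recip_height ?B t \<noteq> 0\<close> by (simp add: power2_eq_square)
  finally show ?thesis .
qed

section \<open>First integrals and uniqueness\<close>

text \<open>The momentum that belongs to the horizontal translations, which are isometries.\<close>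

lemma geodesic_component_integral:
  assumes "is_interval J" and "k \<noteq> m"
    and c: "\<And>t. t \<in> J \<Longrightarrow> (c has_vector_derivative v t) (at t)"
    and v: "\<And>t. t \<in> J \<Longrightarrow> (v has_vector_derivative a t) (at t)"
    and pos: "\<And>t. t \<in> J \<Longrightarrow> 0 < c t $ k"
    and a: "\<And>t m. t \<in> J \<Longrightarrow> a t $ m
      = (2 * v t $ k * v t $ m - (if m = k then flat_form Y (v t) (v t) else 0)) / c t $ k"
    and "s \<in> J" and "t \<in> J"
  shows "v t $ m / (c t $ k)\<^sup>2 = v s $ m / (c s $ k)\<^sup>2"
proof (rule constant_on_interval[OF assms(1) _ \<open>s \<in> J\<close> \<open>t \<in> J\<close>])
  fix t assume t: "t \<in> J"
  note dc = has_real_derivative_vec_nth[OF c[OF t], of k]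
    and dv = has_real_derivative_vec_nth[OF v[OF t], of m]
  have am: "a t $ m = 2 * v t $ k * v t $ m / c t $ k" using a[OF t, of m] assms(2) by simp
  have "c t $ k \<noteq> 0" using pos[OF t] by simp
  then show "((\<lambda>t. v t $ m / (c t $ k)\<^sup>2) has_real_derivative 0) (at t)"
    by (auto intro!: derivative_eq_intros dc dv simp: am power2_eq_square field_simps)
qed

text \<open>The square of the velocity with respect to the metric: since the acceleration is
\<open>(2 v\<^sub>z v - q(v) e) / z\<close>, the derivative of \<open>q(v)\<close> is \<open>2 v\<^sub>z q(v) / z\<close>.\<close>

lemma geodesic_energy_integral:
  assumes kY: "k \<notin> Y" and "is_interval J"
    and c: "\<And>t. t \<in> J \<Longrightarrow> (c has_vector_derivative v t) (at t)"
    and v: "\<And>t. t \<in> J \<Longrightarrow> (v has_vector_derivative a t) (at t)"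
    and pos: "\<And>t. t \<in> J \<Longrightarrow> 0 < c t $ k"
    and a: "\<And>t m. t \<in> J \<Longrightarrow> a t $ m
      = (2 * v t $ k * v t $ m - (if m = k then flat_form Y (v t) (v t) else 0)) / c t $ k"
    and "s \<in> J" and "t \<in> J"
  shows "flat_form Y (v t) (v t) / (c t $ k)\<^sup>2 = flat_form Y (v s) (v s) / (c s $ k)\<^sup>2"
proof (rule constant_on_interval[OF assms(2) _ \<open>s \<in> J\<close> \<open>t \<in> J\<close>])
  fix t assume t: "t \<in> J"
  let ?Q = "flat_form Y (v t) (v t)"
  note dc = has_real_derivative_vec_nth[OF c[OF t], of k]
  have nz: "c t $ k \<noteq> 0" using pos[OF t] by simp
  have "a t = (2 * v t $ k / c t $ k) *\<^sub>R v t - (?Q / c t $ k) *\<^sub>R axis k 1"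
    unfolding vec_eq_iff
  proof
    fix m
    show "a t $ m = ((2 * v t $ k / c t $ k) *\<^sub>R v t - (?Q / c t $ k) *\<^sub>R axis k 1) $ m"
      unfolding a[OF t, of m] by (simp add: axis_def diff_divide_distrib)
  qed
  then have "flat_form Y (v t) (a t) = (2 * v t $ k / c t $ k) * ?Q - (?Q / c t $ k) * v t $ k"
    by (simp only: flat_form_linear flat_form_axis_right[OF kY])
  then have "flat_form Y (v t) (a t) = v t $ k * ?Q / c t $ k"
    by (simp add: field_simps)
  moreover have "((\<lambda>t. flat_form Y (v t) (v t)) has_real_derivative 2 * flat_form Y (v t) (a t)) (at t)"
  proof -
    have "((\<lambda>t. \<Sum>i\<in>UNIV. (if i \<in> Y then - 1 else 1) * v t $ i * v t $ i) has_real_derivative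
        (\<Sum>i\<in>UNIV. 2 * ((if i \<in> Y then - 1 else 1) * v t $ i * a t $ i))) (at t)"
      by (rule DERIV_sum)
        (auto intro!: derivative_eq_intros has_real_derivative_vec_nth[OF v[OF t]])
    then show ?thesis by (simp add: flat_form_def sum_distrib_left)
  qed
  ultimately have dQ: "((\<lambda>t. flat_form Y (v t) (v t)) has_real_derivative 2 * (v t $ k * ?Q / c t $ k)) (at t)"
    by simp
  show "((\<lambda>t. flat_form Y (v t) (v t) / (c t $ k)\<^sup>2) has_real_derivative 0) (at t)"
    using nz by (auto intro!: derivative_eq_intros dc dQ simp: power2_eq_square field_simps)
qed

text \<open>Uniqueness of geodesics, including a bound on their life time: a geodesic with the position
and, up to the factor \<open>\<rho>\<close>, the velocity of a normal form is an affine reparametrization of it for as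
long as it exists. The energy integral gives \<open>(1 / z)'' = \<rho>\<^sup>2 / z\<close> on all of \<open>J\<close>, which determines
\<open>1 / z\<close>. Its positivity keeps the rescaled time inside the domain of the normal form. The horizontal
coordinates then have the right derivative by the momentum integrals. The case \<open>\<rho> = 0\<close> of constant
curves is included.\<close>

lemma geodesic_eq_geod:
  assumes kY: "k \<notin> Y" and "x0 $ k = 0" and "\<eta> $ k = 0"
    and geodesic: "geodesic_on (half_space_metric Y k) (half_space k) c J"
    and t0: "t0 \<in> J" and \<tau>0: "\<tau>0 \<in> geod_dom (flat_form Y \<eta> \<eta>)"
    and "c t0 = geod Y k x0 \<eta> \<tau>0"
    and vel0: "(c has_vector_derivative \<rho> *\<^sub>R geod_vel Y k \<eta> \<tau>0) (at t0)"
    and t: "t \<in> J"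
  shows "\<tau>0 + \<rho> * (t - t0) \<in> geod_dom (flat_form Y \<eta> \<eta>) \<and> c t = geod Y k x0 \<eta> (\<tau>0 + \<rho> * (t - t0))"
proof -
  let ?B = "flat_form Y \<eta> \<eta>"
  define S where "S = recip_height ?B"
  define S' where "S' = recip_height (- ?B)"
  define \<tau> where "\<tau> t = \<tau>0 + \<rho> * (t - t0)" for t
  from geodesic[unfolded geodesic_on_half_space_iff[OF kY]] obtain v a where
    J: "is_interval J" and pos: "\<And>t. t \<in> J \<Longrightarrow> 0 < c t $ k"
    and c: "\<And>t. t \<in> J \<Longrightarrow> (c has_vector_derivative v t) (at t)"
    and v: "\<And>t. t \<in> J \<Longrightarrow> (v has_vector_derivative a t) (at t)"
    and a: "\<And>t m. t \<in> J \<Longrightarrow> a t $ m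
      = (2 * v t $ k * v t $ m - (if m = k then flat_form Y (v t) (v t) else 0)) / c t $ k"
    by blast
  have S0: "0 < S \<tau>0" using \<tau>0 by (simp add: geod_dom_def S_def)
  have v0: "v t0 = \<rho> *\<^sub>R geod_vel Y k \<eta> \<tau>0"
    using vector_derivative_unique_at[OF c[OF t0] vel0] .
  have z0: "c t0 $ k = 1 / S \<tau>0"
    using assms by (simp add: geod_nth_k S_def)
  have v0k: "v t0 $ k = - \<rho> * S' \<tau>0 / (S \<tau>0)\<^sup>2"
    using assms(3) by (simp add: v0 geod_vel_def S_def S'_def axis_def)
  have v0m: "v t0 $ m = - 2 * \<rho> * \<eta> $ m / (S \<tau>0)\<^sup>2" if "m \<noteq> k" for m
    using that by (simp add: v0 geod_vel_def S_def axis_def)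
  have Q: "flat_form Y (v t) (v t) = \<rho>\<^sup>2 * (c t $ k)\<^sup>2" if "t \<in> J" for t
  proof -
    have "flat_form Y (v t) (v t) / (c t $ k)\<^sup>2 = flat_form Y (v t0) (v t0) / (c t0 $ k)\<^sup>2"
      by (rule geodesic_energy_integral[OF kY J c v pos a t0 that])
    also have "\<dots> = \<rho>\<^sup>2"
      using S0 unfolding v0 z0 by (simp add: flat_form_linear flat_form_geod_vel[OF kY assms(3) \<tau>0]
          S_def[symmetric] power2_eq_square)
    finally show ?thesis using pos[OF that] by (simp add: field_simps)
  qed
  have d\<tau>: "(\<tau> has_real_derivative \<rho>) (at t)" for t
    unfolding \<tau>_def by (auto intro!: derivative_eq_intros)
  have dS: "((\<lambda>t. S (\<tau> t)) has_real_derivative S' (\<tau> t) * \<rho>) (at t)" for t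
    unfolding S_def S'_def by (rule DERIV_chain2[OF recip_height_derivative d\<tau>])
  have dS': "((\<lambda>t. S' (\<tau> t)) has_real_derivative S (\<tau> t) * \<rho>) (at t)" for t
    using DERIV_chain2[OF recip_height_derivative[of "- ?B"] d\<tau>] by (simp add: S_def S'_def)
  have height: "1 / c t $ k = S (\<tau> t)" if "t \<in> J" for t
  proof -
    have "1 / c t $ k - S (\<tau> t) = 0"
    proof (rule linear_ode_zero[OF J t0 _ _ _ _ that,
          where f' = "\<lambda>t. - v t $ k / (c t $ k)\<^sup>2 - S' (\<tau> t) * \<rho>" and \<rho> = \<rho>])
      fix t assume t: "t \<in> J"
      note dc = has_real_derivative_vec_nth[OF c[OF t], of k]
        and dv = has_real_derivative_vec_nth[OF v[OF t], of k]
      have nz: "c t $ k \<noteq> 0" using pos[OF t] by simp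
      show "((\<lambda>t. 1 / c t $ k - S (\<tau> t)) has_real_derivative - v t $ k / (c t $ k)\<^sup>2 - S' (\<tau> t) * \<rho>) (at t)"
        using nz by (auto intro!: derivative_eq_intros dc dS simp: power2_eq_square)
      have ak: "a t $ k = 2 * (v t $ k)\<^sup>2 / c t $ k - \<rho>\<^sup>2 * c t $ k"
        using a[OF t, of k] Q[OF t] nz by (simp add: diff_divide_distrib power2_eq_square)
      have "((\<lambda>t. - v t $ k / (c t $ k)\<^sup>2 - S' (\<tau> t) * \<rho>) has_real_derivative
          (- a t $ k * (c t $ k)\<^sup>2 + v t $ k * (2 * c t $ k * v t $ k)) / ((c t $ k)\<^sup>2 * (c t $ k)\<^sup>2)
           - S (\<tau> t) * \<rho> * \<rho>) (at t)"
        using nz by (auto intro!: derivative_eq_intros dc dv dS' simp: mult_ac diff_divide_distrib)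
      also have "(- a t $ k * (c t $ k)\<^sup>2 + v t $ k * (2 * c t $ k * v t $ k)) / ((c t $ k)\<^sup>2 * (c t $ k)\<^sup>2)
           - S (\<tau> t) * \<rho> * \<rho> = \<rho>\<^sup>2 * (1 / c t $ k - S (\<tau> t))"
        using nz unfolding ak by (simp add: field_simps power2_eq_square)
      finally show "((\<lambda>t. - v t $ k / (c t $ k)\<^sup>2 - S' (\<tau> t) * \<rho>) has_real_derivative
          \<rho>\<^sup>2 * (1 / c t $ k - S (\<tau> t))) (at t)" .
    next
      show "1 / c t0 $ k - S (\<tau> t0) = 0" by (simp add: z0 \<tau>_def)
      show "- v t0 $ k / (c t0 $ k)\<^sup>2 - S' (\<tau> t0) * \<rho> = 0"
        using S0 by (simp add: z0 v0k \<tau>_def power_divide)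
    qed
    then show ?thesis by simp
  qed
  have Spos: "0 < S (\<tau> t)" if "t \<in> J" for t
    using height[OF that] pos[OF that] by (metis zero_less_divide_1_iff)
  have "c t $ m = geod Y k x0 \<eta> (\<tau> t) $ m" for m
  proof (cases "m = k")
    case True
    have "c t $ k = 1 / S (\<tau> t)" by (simp add: height[OF t, symmetric])
    then show ?thesis
      using True assms by (simp add: geod_nth_k S_def)
  next
    case False
    have "c t $ m - exp (- \<tau> t) / S (\<tau> t) * \<eta> $ m = c t0 $ m - exp (- \<tau> t0) / S (\<tau> t0) * \<eta> $ m"
    proof (rule constant_on_interval[OF J _ t0 t])
      fix t assume t: "t \<in> J"
      have "v t $ m / (c t $ k)\<^sup>2 = v t0 $ m / (c t0 $ k)\<^sup>2"
        using False by (intro geodesic_component_integral[OF J _ c v pos a t0 t]) auto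
      also have "\<dots> = - 2 * \<rho> * \<eta> $ m"
        using S0 unfolding v0m[OF False] z0 by (simp add: power_divide)
      finally have "v t $ m = - 2 * \<rho> * \<eta> $ m * (c t $ k)\<^sup>2"
        using pos[OF t] by (simp add: field_simps)
      also have "c t $ k = 1 / S (\<tau> t)" by (simp add: height[OF t, symmetric])
      finally have vm: "v t $ m = - 2 * \<rho> * \<eta> $ m / (S (\<tau> t))\<^sup>2" by (simp add: power_divide)
      have "recip_height ?B (\<tau> t) \<noteq> 0" using Spos[OF t] by (simp add: S_def)
      from DERIV_chain2[OF exp_div_recip_height_derivative[OF this] d\<tau>]
      have dX: "((\<lambda>t. exp (- \<tau> t) / S (\<tau> t)) has_real_derivative - 2 / (S (\<tau> t))\<^sup>2 * \<rho>) (at t)"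
        by (simp add: S_def)
      show "((\<lambda>t. c t $ m - exp (- \<tau> t) / S (\<tau> t) * \<eta> $ m) has_real_derivative 0) (at t)"
        by (rule derivative_eq_intros has_real_derivative_vec_nth[OF c[OF t], of m] dX refl | simp add: vm)+
    qed
    moreover have "c t0 $ m = x0 $ m + exp (- \<tau> t0) / S (\<tau> t0) * \<eta> $ m"
      using False by (simp add: \<open>c t0 = _\<close> geod_def \<tau>_def S_def axis_def)
    ultimately show ?thesis
      using False by (simp add: geod_def S_def axis_def)
  qed
  then have "c t = geod Y k x0 \<eta> (\<tau> t)" by (simp add: vec_eq_iff)
  then show ?thesis using Spos[OF t] by (simp add: geod_dom_def S_def \<tau>_def)
qed

definition geod_acc :: "'n::finite set \<Rightarrow> 'n \<Rightarrow> real^'n \<Rightarrow> real \<Rightarrow> real^'n" where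
  "geod_acc Y k \<eta> t =
     (4 * recip_height (- flat_form Y \<eta> \<eta>) t / (recip_height (flat_form Y \<eta> \<eta>) t) ^ 3) *\<^sub>R \<eta>
     + (2 * (recip_height (- flat_form Y \<eta> \<eta>) t)\<^sup>2 / (recip_height (flat_form Y \<eta> \<eta>) t) ^ 3
        - 1 / recip_height (flat_form Y \<eta> \<eta>) t) *\<^sub>R axis k 1"

lemma geod_vel_derivative:
  assumes "t \<in> geod_dom (flat_form Y \<eta> \<eta>)"
  shows "(geod_vel Y k \<eta> has_vector_derivative geod_acc Y k \<eta> t) (at t)"
proof -
  let ?B = "flat_form Y \<eta> \<eta>"
  have nz: "recip_height ?B t \<noteq> 0" using assms by (simp add: geod_dom_def)
  note d = recip_height_derivative'[where B = ?B, OF DERIV_ident] 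
    recip_height_derivative'[where B = "- ?B", OF DERIV_ident, simplified minus_minus]
  have 1: "((\<lambda>t. - 2 / (recip_height ?B t)\<^sup>2) has_real_derivative
      4 * recip_height (- ?B) t / (recip_height ?B t) ^ 3) (at t)"
    using nz by (auto intro!: derivative_eq_intros d simp: field_simps power2_eq_square power3_eq_cube)
  have 2: "((\<lambda>t. - recip_height (- ?B) t / (recip_height ?B t)\<^sup>2) has_real_derivative
      2 * (recip_height (- ?B) t)\<^sup>2 / (recip_height ?B t) ^ 3 - 1 / recip_height ?B t) (at t)"
    using nz by (auto intro!: derivative_eq_intros d simp: field_simps power2_eq_square power3_eq_cube)
  note curve = has_vector_derivative_add[OF
        has_vector_derivative_scaleR[OF 1 has_vector_derivative_const]
        has_vector_derivative_scaleR[OF 2 has_vector_derivative_const]]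
  have "geod_vel Y k \<eta> = (\<lambda>t. (- 2 / (recip_height ?B t)\<^sup>2) *\<^sub>R \<eta>
     + (- recip_height (- ?B) t / (recip_height ?B t)\<^sup>2) *\<^sub>R axis k 1)"
    by (simp add: geod_vel_def fun_eq_iff)
  then show ?thesis
    using curve by (simp add: geod_acc_def)
qed

text \<open>In this form it is visible that the domain is a half-line or everything.\<close>

lemma mem_geod_dom_iff: "t \<in> geod_dom B \<longleftrightarrow> 0 < exp (2 * t) + B"
proof -
  have "exp t * exp t = exp (2 * t)" "exp t * exp (- t) = 1"
    by (simp_all flip: exp_add)
  then have "exp t * recip_height B t = exp (2 * t) + B"
    by (simp add: recip_height_def algebra_simps)
  then have "0 < exp (2 * t) + B \<longleftrightarrow> 0 < exp t * recip_height B t" by simp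
  also have "\<dots> \<longleftrightarrow> 0 < recip_height B t" by (simp add: zero_less_mult_iff)
  finally show ?thesis by (simp add: geod_dom_def)
qed

lemma geod_dom_upward_closed:
  assumes "s \<in> geod_dom B" and "s \<le> t"
  shows "t \<in> geod_dom B"
proof -
  have "exp (2 * s) \<le> exp (2 * t)" using assms(2) by simp
  then show ?thesis using assms(1) unfolding mem_geod_dom_iff by linarith
qed

lemma geod_dom_nonneg: "0 \<le> B \<Longrightarrow> geod_dom B = UNIV"
  by (auto simp: mem_geod_dom_iff add_pos_nonneg)

lemma geod_dom_nonempty: "\<bar>B\<bar> \<in> geod_dom B"
proof -
  have "1 + 2 * \<bar>B\<bar> \<le> exp (2 * \<bar>B\<bar>)" by (rule exp_ge_add_one_self)
  then show ?thesis unfolding mem_geod_dom_iff by linarith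
qed

section \<open>Maximal geodesics\<close>

lemma geod_geodesic_on:
  assumes kY: "k \<notin> Y" and "x0 $ k = 0" and "\<eta> $ k = 0" and "\<rho> \<noteq> 0"
  shows "geodesic_on (half_space_metric Y k) (half_space k) (\<lambda>t. geod Y k x0 \<eta> (\<rho> * t + b))
    {t. \<rho> * t + b \<in> geod_dom (flat_form Y \<eta> \<eta>)}"
proof -
  let ?B = "flat_form Y \<eta> \<eta>"
  let ?J = "{t. \<rho> * t + b \<in> geod_dom ?B}"
  have op: "open ?J"
    unfolding mem_geod_dom_iff by (intro open_Collect_less continuous_intros)
  have int: "is_interval ?J"
    unfolding is_interval_1
  proof (intro ballI allI impI)
    fix r s t assume "r \<in> ?J" "s \<in> ?J" "r \<le> t \<and> t \<le> s"
    then show "t \<in> ?J"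
      using geod_dom_upward_closed[of "\<rho> * r + b" ?B "\<rho> * t + b"]
        geod_dom_upward_closed[of "\<rho> * s + b" ?B "\<rho> * t + b"]
      by (cases "0 \<le> \<rho>") (auto simp: mult_left_mono mult_left_mono_neg)
  qed
  have ne: "?J \<noteq> {}"
  proof -
    have "(\<bar>?B\<bar> - b) / \<rho> \<in> ?J" using geod_dom_nonempty[of ?B] assms(4) by simp
    then show ?thesis by blast
  qed
  have pos: "\<forall>t\<in>?J. 0 < geod Y k x0 \<eta> (\<rho> * t + b) $ k"
    using assms by (simp add: geod_nth_k geod_dom_def)
  have v: "((\<lambda>t. geod Y k x0 \<eta> (\<rho> * t + b)) has_vector_derivative \<rho> *\<^sub>R geod_vel Y k \<eta> (\<rho> * t + b)) (at t)"
    and a: "((\<lambda>t. \<rho> *\<^sub>R geod_vel Y k \<eta> (\<rho> * t + b)) has_vector_derivative \<rho>\<^sup>2 *\<^sub>R geod_acc Y k \<eta> (\<rho> * t + b)) (at t)"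
    and eq: "(\<rho>\<^sup>2 *\<^sub>R geod_acc Y k \<eta> (\<rho> * t + b)) $ m
        = (2 * (\<rho> *\<^sub>R geod_vel Y k \<eta> (\<rho> * t + b)) $ k * (\<rho> *\<^sub>R geod_vel Y k \<eta> (\<rho> * t + b)) $ m
           - (if m = k then flat_form Y (\<rho> *\<^sub>R geod_vel Y k \<eta> (\<rho> * t + b)) (\<rho> *\<^sub>R geod_vel Y k \<eta> (\<rho> * t + b)) else 0))
          / geod Y k x0 \<eta> (\<rho> * t + b) $ k"
    if "t \<in> ?J" for t m
  proof -
    have dom: "\<rho> * t + b \<in> geod_dom ?B" using that by simp
    have affine: "((\<lambda>t. \<rho> * t + b) has_vector_derivative \<rho>) (at t)"
      by (auto intro!: derivative_eq_intros simp flip: has_real_derivative_iff_has_vector_derivative)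
    show "((\<lambda>t. geod Y k x0 \<eta> (\<rho> * t + b)) has_vector_derivative \<rho> *\<^sub>R geod_vel Y k \<eta> (\<rho> * t + b)) (at t)"
      using vector_diff_chain_at[OF affine geod_has_vector_derivative[OF dom]] by (simp add: o_def)
    show "((\<lambda>t. \<rho> *\<^sub>R geod_vel Y k \<eta> (\<rho> * t + b)) has_vector_derivative \<rho>\<^sup>2 *\<^sub>R geod_acc Y k \<eta> (\<rho> * t + b)) (at t)"
      using bounded_linear.has_vector_derivative[OF bounded_linear_scaleR_right[of \<rho>]
          vector_diff_chain_at[OF affine geod_vel_derivative[OF dom]]]
      by (simp add: o_def power2_eq_square)
    define S where "S = recip_height ?B (\<rho> * t + b)"
    define S' where "S' = recip_height (- ?B) (\<rho> * t + b)"
    have "S \<noteq> 0" using dom by (simp add: geod_dom_def S_def)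
    have Q: "flat_form Y (\<rho> *\<^sub>R geod_vel Y k \<eta> (\<rho> * t + b)) (\<rho> *\<^sub>R geod_vel Y k \<eta> (\<rho> * t + b)) = \<rho>\<^sup>2 / S\<^sup>2"
      by (simp add: flat_form_linear flat_form_geod_vel[OF kY assms(3) dom] S_def power2_eq_square)
    have velk: "geod_vel Y k \<eta> (\<rho> * t + b) $ k = - S' / S\<^sup>2"
      using assms(3) by (simp add: geod_vel_def S_def S'_def axis_def)
    have z: "geod Y k x0 \<eta> (\<rho> * t + b) $ k = 1 / S"
      using assms by (simp add: geod_nth_k S_def)
    show "(\<rho>\<^sup>2 *\<^sub>R geod_acc Y k \<eta> (\<rho> * t + b)) $ m
        = (2 * (\<rho> *\<^sub>R geod_vel Y k \<eta> (\<rho> * t + b)) $ k * (\<rho> *\<^sub>R geod_vel Y k \<eta> (\<rho> * t + b)) $ m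
           - (if m = k then flat_form Y (\<rho> *\<^sub>R geod_vel Y k \<eta> (\<rho> * t + b)) (\<rho> *\<^sub>R geod_vel Y k \<eta> (\<rho> * t + b)) else 0))
          / geod Y k x0 \<eta> (\<rho> * t + b) $ k"
    proof (cases "m = k")
      case True
      have "(\<rho>\<^sup>2 *\<^sub>R geod_acc Y k \<eta> (\<rho> * t + b)) $ k = \<rho>\<^sup>2 * (2 * S'\<^sup>2 / S ^ 3 - 1 / S)"
        using assms(3) by (simp add: geod_acc_def S_def S'_def axis_def)
      moreover have "(2 * (\<rho> * (- S' / S\<^sup>2)) * (\<rho> * (- S' / S\<^sup>2)) - \<rho>\<^sup>2 / S\<^sup>2) / (1 / S)
          = \<rho>\<^sup>2 * (2 * S'\<^sup>2 / S ^ 3 - 1 / S)"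
        using \<open>S \<noteq> 0\<close> by (simp add: field_simps power2_eq_square power3_eq_cube)
      ultimately show ?thesis
        using True unfolding Q z by (simp add: velk)
    next
      case False
      have "(\<rho>\<^sup>2 *\<^sub>R geod_acc Y k \<eta> (\<rho> * t + b)) $ m = \<rho>\<^sup>2 * (4 * S' / S ^ 3 * \<eta> $ m)"
        using False by (simp add: geod_acc_def S_def S'_def axis_def)
      moreover have "geod_vel Y k \<eta> (\<rho> * t + b) $ m = - 2 / S\<^sup>2 * \<eta> $ m"
        using False by (simp add: geod_vel_def S_def axis_def)
      moreover have "(2 * (\<rho> * (- S' / S\<^sup>2)) * (\<rho> * (- 2 / S\<^sup>2 * e)) - 0) / (1 / S)
          = \<rho>\<^sup>2 * (4 * S' / S ^ 3 * e)" for e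
        using \<open>S \<noteq> 0\<close> by (simp add: field_simps power2_eq_square power3_eq_cube)
      ultimately show ?thesis
        using False unfolding z by (simp add: velk)
    qed
  qed
  show ?thesis
    unfolding geodesic_on_half_space_iff[OF kY]
    by (intro conjI op int ne pos exI[where x = "\<lambda>t. \<rho> *\<^sub>R geod_vel Y k \<eta> (\<rho> * t + b)"]
        exI[where x = "\<lambda>t. \<rho>\<^sup>2 *\<^sub>R geod_acc Y k \<eta> (\<rho> * t + b)"] ballI allI v a eq)
qed

text \<open>Otherwise the reparametrized normal form would be a proper extension.\<close>

lemma maximal_geodesic_geod_dom:
  assumes kY: "k \<notin> Y" and "x0 $ k = 0" and "\<eta> $ k = 0" and "\<rho> \<noteq> 0"
    and "maximal_geodesic (half_space_metric Y k) (half_space k) c J"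
    and "\<And>t. t \<in> J \<Longrightarrow> \<rho> * t + b \<in> geod_dom (flat_form Y \<eta> \<eta>) \<and> c t = geod Y k x0 \<eta> (\<rho> * t + b)"
  shows "J = {t. \<rho> * t + b \<in> geod_dom (flat_form Y \<eta> \<eta>)}"
proof -
  let ?J = "{t. \<rho> * t + b \<in> geod_dom (flat_form Y \<eta> \<eta>)}"
  have "J \<subseteq> ?J" "\<forall>t\<in>J. geod Y k x0 \<eta> (\<rho> * t + b) = c t" using assms(6) by auto
  moreover note geod_geodesic_on[OF assms(1-4), of b]
  ultimately have "?J = J"
    using assms(5)[unfolded maximal_geodesic_def, THEN conjunct2, rule_format,
        of "\<lambda>t. geod Y k x0 \<eta> (\<rho> * t + b)" ?J] by blast
  then show ?thesis by simp
qed

text \<open>By uniqueness an extension still is a reparametrized normal form, so that its times lie in the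
domain already.\<close>

lemma geod_maximal_geodesic:
  assumes kY: "k \<notin> Y" and "x0 $ k = 0" and "\<eta> $ k = 0" and "\<rho> \<noteq> 0"
  shows "maximal_geodesic (half_space_metric Y k) (half_space k) (\<lambda>t. geod Y k x0 \<eta> (\<rho> * t + b))
    {t. \<rho> * t + b \<in> geod_dom (flat_form Y \<eta> \<eta>)}"
proof -
  let ?J = "{t. \<rho> * t + b \<in> geod_dom (flat_form Y \<eta> \<eta>)}"
  let ?c = "\<lambda>t. geod Y k x0 \<eta> (\<rho> * t + b)"
  note geodesic = geod_geodesic_on[OF assms, of b]
  have "J' = ?J" if "geodesic_on (half_space_metric Y k) (half_space k) c' J'" "?J \<subseteq> J'" "\<forall>t\<in>?J. c' t = ?c t" for c' J'
  proof -
    from geodesic have "open ?J" "?J \<noteq> {}" by (auto simp: geodesic_on_def)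
    then obtain t0 where t0: "t0 \<in> ?J" by blast
    have affine: "((\<lambda>t. \<rho> * t + b) has_vector_derivative \<rho>) (at t0)"
      by (auto intro!: derivative_eq_intros simp flip: has_real_derivative_iff_has_vector_derivative)
    have "(?c has_vector_derivative \<rho> *\<^sub>R geod_vel Y k \<eta> (\<rho> * t0 + b)) (at t0)"
      using vector_diff_chain_at[OF affine geod_has_vector_derivative] t0 by (simp add: o_def)
    then have "(c' has_vector_derivative \<rho> *\<^sub>R geod_vel Y k \<eta> (\<rho> * t0 + b)) (at t0)"
      by (rule has_vector_derivative_transform_within_open[OF _ \<open>open ?J\<close> t0]) (use that(3) in auto)
    then have "t \<in> ?J" if "t \<in> J'" for t
      using geodesic_eq_geod[OF assms(1-3) \<open>geodesic_on _ _ c' J'\<close>, of t0 "\<rho> * t0 + b" \<rho> t] t0 that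
        \<open>?J \<subseteq> J'\<close> \<open>\<forall>t\<in>?J. c' t = ?c t\<close>
      by (auto simp: algebra_simps)
    then show ?thesis using \<open>?J \<subseteq> J'\<close> by blast
  qed
  with geodesic show ?thesis unfolding maximal_geodesic_def by blast
qed

section \<open>Spacelike geodesics as half conics\<close>

text \<open>For \<open>\<eta> \<noteq> 0\<close> and in the coordinates \<open>(X, z)\<close> of the vertical plane over \<open>x\<^sub>0 + \<real> \<eta>\<close>, this is
the upper half of a conic with a vertical tangent at \<open>x\<^sub>0\<close>. For \<open>\<eta> = 0\<close> the parameter \<open>X = z\<^sup>2\<close> has no effect on
the point, and the curve is a vertical half-line.\<close>

definition geod_curve :: "'n::finite set \<Rightarrow> 'n \<Rightarrow> real^'n \<Rightarrow> real^'n \<Rightarrow> (real^'n) set" where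
  "geod_curve Y k x0 \<eta> =
     {x0 + X *\<^sub>R \<eta> + z *\<^sub>R axis k 1 | X z. 0 < X \<and> 0 < z \<and> z\<^sup>2 = X - flat_form Y \<eta> \<eta> * X\<^sup>2}"

lemma horizontal_nth: "horizontal k v $ k = 0"
  by (simp add: horizontal_def)

lemma horizontal_decomposition: "horizontal k v + v $ k *\<^sub>R axis k 1 = v"
  by (simp add: vec_eq_iff horizontal_def axis_def)

text \<open>On the conic the time is recovered from \<open>exp t = z / X\<close>.\<close>

lemma geod_image: "geod Y k x0 \<eta> ` geod_dom (flat_form Y \<eta> \<eta>) = geod_curve Y k x0 \<eta>"
proof
  let ?B = "flat_form Y \<eta> \<eta>"
  show "geod Y k x0 \<eta> ` geod_dom ?B \<subseteq> geod_curve Y k x0 \<eta>"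
  proof
    fix x assume "x \<in> geod Y k x0 \<eta> ` geod_dom ?B"
    then obtain t where t: "0 < recip_height ?B t" "x = geod Y k x0 \<eta> t" by (auto simp: geod_dom_def)
    define S where "S = recip_height ?B t"
    define E where "E = exp (- t)"
    have "0 < S" "0 < E" using t by (simp_all add: S_def E_def)
    have SE: "S * E = 1 + ?B * E\<^sup>2"
      by (simp add: S_def E_def recip_height_def algebra_simps power2_eq_square flip: exp_add)
    have "E / S - ?B * (E / S)\<^sup>2 = (S * E - ?B * E\<^sup>2) / S\<^sup>2"
      using \<open>0 < S\<close> by (simp add: field_simps power2_eq_square)
    then have "(1 / S)\<^sup>2 = E / S - ?B * (E / S)\<^sup>2" unfolding SE by (simp add: power_divide)
    moreover have "x = x0 + (E / S) *\<^sub>R \<eta> + (1 / S) *\<^sub>R axis k 1"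
      by (simp add: t(2) geod_def S_def E_def)
    ultimately show "x \<in> geod_curve Y k x0 \<eta>"
      unfolding geod_curve_def using \<open>0 < S\<close> \<open>0 < E\<close> by (force intro: divide_pos_pos)
  qed
  show "geod_curve Y k x0 \<eta> \<subseteq> geod Y k x0 \<eta> ` geod_dom ?B"
  proof
    fix x assume "x \<in> geod_curve Y k x0 \<eta>"
    then obtain X z where X: "0 < X" and z: "0 < z" and conic: "z\<^sup>2 = X - ?B * X\<^sup>2"
      and x: "x = x0 + X *\<^sub>R \<eta> + z *\<^sub>R axis k 1"
      by (auto simp: geod_curve_def)
    define t where "t = ln (z / X)"
    have e: "exp t = z / X" "exp (- t) = X / z"
      using X z by (simp_all add: t_def exp_minus)
    have "recip_height ?B t = (z\<^sup>2 + ?B * X\<^sup>2) / (X * z)"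
      using X z unfolding recip_height_def e by (simp add: field_simps power2_eq_square)
    then have S: "recip_height ?B t = 1 / z"
      using X z conic by simp
    then have "t \<in> geod_dom ?B" using z by (simp add: geod_dom_def)
    moreover have "x = geod Y k x0 \<eta> t" using z unfolding geod_def S e x by simp
    ultimately show "x \<in> geod Y k x0 \<eta> ` geod_dom ?B" by blast
  qed
qed

text \<open>The parameter \<open>X\<close> along the curve \<open>c\<close> is a differentiable function of time: it can be read off
from a coordinate in which \<open>\<eta>\<close> does not vanish, and for \<open>\<eta> = 0\<close> one takes \<open>X = z\<^sup>2\<close>. Differentiating
the equation of the conic expresses \<open>z'\<close> by \<open>X'\<close>, so the velocity lies on a fixed line.\<close>

lemma tangent_of_geod_curve:
  assumes x0: "x0 $ k = 0" and \<eta>: "\<eta> $ k = 0" and \<tau>0: "\<tau>0 \<in> geod_dom (flat_form Y \<eta> \<eta>)"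
    and J: "open J" "t0 \<in> J" and sub: "c ` J \<subseteq> geod_curve Y k x0 \<eta>"
    and c0: "c t0 = geod Y k x0 \<eta> \<tau>0" and w: "(c has_vector_derivative w) (at t0)"
  shows "\<exists>\<rho>. w = \<rho> *\<^sub>R geod_vel Y k \<eta> \<tau>0"
proof -
  let ?B = "flat_form Y \<eta> \<eta>"
  define S where "S = recip_height ?B \<tau>0"
  define S' where "S' = recip_height (- ?B) \<tau>0"
  have "0 < S" using \<tau>0 by (simp add: S_def geod_dom_def)
  have param: "\<exists>X. c t = x0 + X *\<^sub>R \<eta> + (c t $ k) *\<^sub>R axis k 1 \<and> (c t $ k)\<^sup>2 = X - ?B * X\<^sup>2" if "t \<in> J" for t
  proof -
    have "c t \<in> geod_curve Y k x0 \<eta>" using sub that by blast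
    then show ?thesis using x0 \<eta> unfolding geod_curve_def by (auto simp: axis_def)
  qed
  have z0: "c t0 $ k = 1 / S" using c0 x0 \<eta> by (simp add: geod_nth_k S_def)
  have "\<exists>X X'. (X has_real_derivative X') (at t0) \<and> X t0 = exp (- \<tau>0) / S \<and>
      (\<forall>t\<in>J. c t = x0 + X t *\<^sub>R \<eta> + (c t $ k) *\<^sub>R axis k 1 \<and> (c t $ k)\<^sup>2 = X t - ?B * (X t)\<^sup>2)"
  proof (cases "\<eta> = 0")
    case True
    then have "?B = 0" by (simp add: flat_form_def)
    have "(1 / S)\<^sup>2 = exp (- \<tau>0) / S"
      unfolding S_def \<open>?B = 0\<close> by (simp add: recip_height_def power2_eq_square exp_minus field_simps)
    moreover have "((\<lambda>t. (c t $ k)\<^sup>2) has_real_derivative 2 * c t0 $ k * w $ k) (at t0)"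
      by (auto intro!: derivative_eq_intros has_real_derivative_vec_nth[OF w])
    ultimately show ?thesis
      using param True \<open>?B = 0\<close> z0 by (intro exI[where x = "\<lambda>t. (c t $ k)\<^sup>2"] exI conjI) auto
  next
    case False
    then obtain m where m: "\<eta> $ m \<noteq> 0" by (auto simp: vec_eq_iff)
    then have "m \<noteq> k" using \<eta> by auto
    let ?X = "\<lambda>t. (c t $ m - x0 $ m) / \<eta> $ m"
    have "(?X has_real_derivative w $ m / \<eta> $ m) (at t0)"
      using m by (auto intro!: derivative_eq_intros has_real_derivative_vec_nth[OF w])
    moreover have "?X t0 = exp (- \<tau>0) / S"
      using m \<open>m \<noteq> k\<close> by (simp add: c0 geod_def S_def axis_def)
    moreover have "c t = x0 + ?X t *\<^sub>R \<eta> + (c t $ k) *\<^sub>R axis k 1 \<and> (c t $ k)\<^sup>2 = ?X t - ?B * (?X t)\<^sup>2"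
      if t: "t \<in> J" for t
    proof -
      from param[OF t] obtain X where X: "c t = x0 + X *\<^sub>R \<eta> + (c t $ k) *\<^sub>R axis k 1"
        "(c t $ k)\<^sup>2 = X - ?B * X\<^sup>2" by blast
      have "c t $ m = x0 $ m + X * \<eta> $ m"
        using arg_cong[OF X(1), of "\<lambda>x. x $ m"] \<open>m \<noteq> k\<close> by (simp add: axis_def)
      then have "?X t = X" using m by simp
      then show ?thesis using X by simp
    qed
    ultimately show ?thesis by blast
  qed
  then obtain X X' where dX: "(X has_real_derivative X') (at t0)" and X0: "X t0 = exp (- \<tau>0) / S"
    and c: "\<And>t. t \<in> J \<Longrightarrow> c t = x0 + X t *\<^sub>R \<eta> + (c t $ k) *\<^sub>R axis k 1"
    and conic: "\<And>t. t \<in> J \<Longrightarrow> (c t $ k)\<^sup>2 = X t - ?B * (X t)\<^sup>2" by blast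
  note dz = has_real_derivative_vec_nth[OF w, of k]
  note curve = has_vector_derivative_add[OF has_vector_derivative_add[OF has_vector_derivative_const
        has_vector_derivative_scaleR[OF dX has_vector_derivative_const]]
        has_vector_derivative_scaleR[OF dz has_vector_derivative_const]]
  have "((\<lambda>t. x0 + X t *\<^sub>R \<eta> + (c t $ k) *\<^sub>R axis k 1) has_vector_derivative w) (at t0)"
    by (rule has_vector_derivative_transform_within_open[OF w J]) (rule c)
  from vector_derivative_unique_at[OF this curve]
  have w_eq: "w = X' *\<^sub>R \<eta> + (w $ k) *\<^sub>R axis k 1" by simp
  have "((\<lambda>t. (c t $ k)\<^sup>2) has_real_derivative 2 * c t0 $ k * w $ k) (at t0)"
    by (auto intro!: derivative_eq_intros dz)
  moreover have "((\<lambda>t. (c t $ k)\<^sup>2) has_real_derivative (1 - 2 * ?B * X t0) * X') (at t0)"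
  proof (rule has_field_derivative_transform_within_open[OF _ J])
    show "((\<lambda>t. X t - ?B * (X t)\<^sup>2) has_real_derivative (1 - 2 * ?B * X t0) * X') (at t0)"
      by (auto intro!: derivative_eq_intros dX simp: algebra_simps)
  qed (simp add: conic)
  ultimately have "2 * c t0 $ k * w $ k = (1 - 2 * ?B * X t0) * X'" by (rule DERIV_unique)
  moreover have "1 - 2 * ?B * X t0 = S' / S"
    using \<open>0 < S\<close> by (simp add: X0 S'_def field_simps) (simp add: S_def recip_height_def)
  ultimately have "2 * (1 / S) * w $ k = S' / S * X'" by (simp only: z0)
  then have wk: "w $ k = X' * (S' / 2)"
    using \<open>0 < S\<close> by (simp add: field_simps)
  have vel: "geod_vel Y k \<eta> \<tau>0 = (- 2 / S\<^sup>2) *\<^sub>R (\<eta> + (S' / 2) *\<^sub>R axis k 1)"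
    by (simp add: geod_vel_def S_def S'_def scaleR_add_right)
  have "w = X' *\<^sub>R (\<eta> + (S' / 2) *\<^sub>R axis k 1)"
    using w_eq unfolding wk by (simp add: scaleR_add_right)
  then have "w = (- X' * S\<^sup>2 / 2) *\<^sub>R geod_vel Y k \<eta> \<tau>0"
    using \<open>0 < S\<close> by (simp add: vel)
  then show ?thesis by blast
qed

text \<open>The initial value problem for the normal form. With \<open>\<rho>\<^sup>2 = q(v) / z\<^sup>2\<close>, the coefficients of
\<open>exp (\<plusminus> \<rho> t)\<close> in the solution \<open>s\<close> of \<open>s'' = \<rho>\<^sup>2 s\<close> add up to \<open>1 / z > 0\<close> at the initial time.
Hence one of them is positive, and the sign of \<open>\<rho>\<close> is chosen such that it belongs to \<open>exp (\<rho> t)\<close>. This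
coefficient is \<open>exp \<tau>\<^sub>0\<close>, and the velocity then determines \<open>\<eta>\<close> and the position \<open>x\<^sub>0\<close>.\<close>

lemma geod_through_spacelike_vector:
  assumes kY: "k \<notin> Y" and P: "0 < P $ k" and v: "0 < flat_form Y v v"
  shows "\<exists>x0 \<eta> \<tau>0 \<rho>. x0 $ k = 0 \<and> \<eta> $ k = 0 \<and> \<rho> \<noteq> 0 \<and> \<tau>0 \<in> geod_dom (flat_form Y \<eta> \<eta>) \<and>
    P = geod Y k x0 \<eta> \<tau>0 \<and> v = \<rho> *\<^sub>R geod_vel Y k \<eta> \<tau>0"
proof -
  define h where "h = horizontal k v"
  define z where "z = P $ k"
  define \<zeta> where "\<zeta> = v $ k"
  have "0 < z" using P by (simp add: z_def)
  have hk: "h $ k = 0" by (simp add: h_def horizontal_nth)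
  have v_eq: "v = h + \<zeta> *\<^sub>R axis k 1"
    by (simp add: h_def \<zeta>_def horizontal_decomposition)
  have Q: "flat_form Y v v = flat_form Y h h + \<zeta>\<^sup>2"
    using flat_form_horizontal_plus_axis[OF kY hk, of 1 \<zeta>] by (simp add: v_eq)
  define r where "r = sqrt (flat_form Y v v) / z"
  have "0 < r" using v \<open>0 < z\<close> by (simp add: r_def)
  have r2: "r\<^sup>2 * z\<^sup>2 = flat_form Y v v" using v \<open>0 < z\<close> by (simp add: r_def power_divide)
  \<comment> \<open>time orientation for which the coefficient of \<open>exp\<close> in \<open>1 / z\<close> is positive\<close>
  obtain \<rho> where \<rho>: "\<rho> = r \<or> \<rho> = - r" and "0 < (1 / z - \<zeta> / (z\<^sup>2 * \<rho>)) / 2"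
  proof (cases "0 < (1 / z - \<zeta> / (z\<^sup>2 * r)) / 2")
    case True
    then show ?thesis using that[of r] by simp
  next
    case False
    have "0 < 1 / z" using \<open>0 < z\<close> by simp
    have "0 < (a + u) / 2" if "\<not> 0 < (a - u) / 2" and "0 < a" for a u :: real
      using that by (simp add: not_less)
    from this[OF False \<open>0 < 1 / z\<close>] have "0 < (1 / z - \<zeta> / (z\<^sup>2 * - r)) / 2" by simp
    then show ?thesis using that[of "- r"] by simp
  qed
  define A where "A = (1 / z - \<zeta> / (z\<^sup>2 * \<rho>)) / 2"
  have "0 < A" using \<open>0 < (1 / z - _) / 2\<close> by (simp add: A_def)
  have "\<rho> \<noteq> 0" using \<rho> \<open>0 < r\<close> by auto
  have \<rho>2: "\<rho>\<^sup>2 * z\<^sup>2 = flat_form Y h h + \<zeta>\<^sup>2" using \<rho> r2 Q by auto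
  define \<eta> where "\<eta> = (- 1 / (2 * \<rho> * z\<^sup>2)) *\<^sub>R h"
  define \<tau>0 where "\<tau>0 = ln A"
  define x0 where "x0 = horizontal k P - (z / A) *\<^sub>R \<eta>"
  have e: "exp \<tau>0 = A" "exp (- \<tau>0) = 1 / A"
    using \<open>0 < A\<close> by (simp_all add: \<tau>0_def exp_minus inverse_eq_divide)
  have "flat_form Y \<eta> \<eta> = (- 1 / (2 * \<rho> * z\<^sup>2)) * ((- 1 / (2 * \<rho> * z\<^sup>2)) * flat_form Y h h)"
    by (simp only: \<eta>_def flat_form_linear)
  then have "flat_form Y \<eta> \<eta> = (1 / (2 * \<rho> * z\<^sup>2))\<^sup>2 * flat_form Y h h"
    by (simp add: power2_eq_square)
  also have "flat_form Y h h = \<rho>\<^sup>2 * z\<^sup>2 - \<zeta>\<^sup>2" using \<rho>2 by simp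
  also have "(1 / (2 * \<rho> * z\<^sup>2))\<^sup>2 * (\<rho>\<^sup>2 * z\<^sup>2 - \<zeta>\<^sup>2) = A * (1 / z - A)"
    using \<open>0 < z\<close> \<open>\<rho> \<noteq> 0\<close> unfolding A_def by (simp add: field_simps power2_eq_square)
  finally have B: "flat_form Y \<eta> \<eta> = A * (1 / z - A)" .
  have S: "recip_height (flat_form Y \<eta> \<eta>) \<tau>0 = 1 / z"
    using \<open>0 < A\<close> unfolding recip_height_def e B by simp
  have S': "recip_height (- flat_form Y \<eta> \<eta>) \<tau>0 = - \<zeta> / (z\<^sup>2 * \<rho>)"
  proof -
    have "recip_height (- flat_form Y \<eta> \<eta>) \<tau>0 = 2 * A - 1 / z"
      using \<open>0 < A\<close> unfolding recip_height_def e B by simp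
    moreover have "2 * A = 1 / z - \<zeta> / (z\<^sup>2 * \<rho>)" by (simp only: A_def mult_2 field_sum_of_halves)
    ultimately show ?thesis by simp
  qed
  have "\<eta> $ k = 0" by (simp add: \<eta>_def hk)
  moreover have "x0 $ k = 0" by (simp add: x0_def calculation horizontal_nth)
  moreover have "\<tau>0 \<in> geod_dom (flat_form Y \<eta> \<eta>)" using \<open>0 < z\<close> by (simp add: geod_dom_def S)
  moreover have "P = geod Y k x0 \<eta> \<tau>0"
    using horizontal_decomposition[of k P] \<open>0 < A\<close> by (simp add: geod_def S e x0_def z_def)
  moreover have "v = \<rho> *\<^sub>R geod_vel Y k \<eta> \<tau>0"
  proof -
    have "h = (- (2 * \<rho> * z\<^sup>2)) *\<^sub>R \<eta>"
      using \<open>0 < z\<close> \<open>\<rho> \<noteq> 0\<close> by (simp add: \<eta>_def)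
    moreover have "\<rho> *\<^sub>R geod_vel Y k \<eta> \<tau>0 = (\<rho> * (- 2 / (1 / z)\<^sup>2)) *\<^sub>R \<eta>
        + (\<rho> * (- (- \<zeta> / (z\<^sup>2 * \<rho>)) / (1 / z)\<^sup>2)) *\<^sub>R axis k 1"
      by (simp only: geod_vel_def S S' scaleR_add_right scaleR_scaleR)
    moreover have "\<rho> * (- 2 / (1 / z)\<^sup>2) = - (2 * \<rho> * z\<^sup>2)"
      and "\<rho> * (- (- \<zeta> / (z\<^sup>2 * \<rho>)) / (1 / z)\<^sup>2) = \<zeta>"
      using \<open>0 < z\<close> \<open>\<rho> \<noteq> 0\<close> by (simp_all add: power_divide)
    ultimately show ?thesis unfolding v_eq by (simp only:)
  qed
  ultimately show ?thesis using \<open>\<rho> \<noteq> 0\<close> by blast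
qed

lemma affine_parametrization_geod:
  assumes "k \<notin> Y" and "x0 $ k = 0" and "\<eta> $ k = 0" and "\<rho> \<noteq> 0"
  shows "affine_parametrization (half_space_metric Y k) (half_space k) (geod_curve Y k x0 \<eta>)
    (\<lambda>t. geod Y k x0 \<eta> (\<rho> * t + b)) {t. \<rho> * t + b \<in> geod_dom (flat_form Y \<eta> \<eta>)}"
proof -
  have "(\<lambda>t. geod Y k x0 \<eta> (\<rho> * t + b)) ` {t. \<rho> * t + b \<in> geod_dom (flat_form Y \<eta> \<eta>)}
      = geod Y k x0 \<eta> ` geod_dom (flat_form Y \<eta> \<eta>)"
  proof (intro equalityI subsetI)
    fix x assume "x \<in> geod Y k x0 \<eta> ` geod_dom (flat_form Y \<eta> \<eta>)"
    then obtain \<tau> where \<tau>: "\<tau> \<in> geod_dom (flat_form Y \<eta> \<eta>)" "x = geod Y k x0 \<eta> \<tau>" by blast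
    moreover have "\<rho> * ((\<tau> - b) / \<rho>) + b = \<tau>" using assms(4) by simp
    ultimately show "x \<in> (\<lambda>t. geod Y k x0 \<eta> (\<rho> * t + b)) ` {t. \<rho> * t + b \<in> geod_dom (flat_form Y \<eta> \<eta>)}"
      by (intro image_eqI[where x = "(\<tau> - b) / \<rho>"]) simp_all
  qed auto
  then show ?thesis
    using geod_maximal_geodesic[OF assms] by (simp add: affine_parametrization_def geod_image)
qed

text \<open>A spacelike initial vector is the initial vector of a normal form, uniqueness makes the geodesic
follow this normal form, and maximality makes it run through all of it.\<close>

lemma spacelike_geodesic_iff_geod_curve:
  assumes kY: "k \<notin> Y"
  shows "spacelike_geodesic (half_space_metric Y k) (half_space k) \<gamma>
    \<longleftrightarrow> (\<exists>x0 \<eta>. x0 $ k = 0 \<and> \<eta> $ k = 0 \<and> \<gamma> = geod_curve Y k x0 \<eta>)"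
proof
  assume "spacelike_geodesic (half_space_metric Y k) (half_space k) \<gamma>"
  then obtain c J where max: "maximal_geodesic (half_space_metric Y k) (half_space k) c J" and \<gamma>: "c ` J = \<gamma>"
    and pos: "\<And>t. t \<in> J \<Longrightarrow> 0 < half_space_metric Y k (c t) (vector_derivative c (at t)) (vector_derivative c (at t))"
    unfolding spacelike_geodesic_def affine_parametrization_def by blast
  from max have geodesic: "geodesic_on (half_space_metric Y k) (half_space k) c J"
    by (simp add: maximal_geodesic_def)
  then obtain t0 v where t0: "t0 \<in> J" and v: "(c has_vector_derivative v) (at t0)" and height: "0 < c t0 $ k"
    unfolding geodesic_on_half_space_iff[OF kY] by blast
  have "0 < flat_form Y v v"
    using pos[OF t0] height by (simp add: vector_derivative_at[OF v] half_space_metric_flat_form zero_less_divide_iff)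
  from geod_through_spacelike_vector[OF kY height this] obtain x0 \<eta> \<tau>0 \<rho> where
    x0: "x0 $ k = 0" and \<eta>: "\<eta> $ k = 0" and "\<rho> \<noteq> 0" and \<tau>0: "\<tau>0 \<in> geod_dom (flat_form Y \<eta> \<eta>)"
    and c0: "c t0 = geod Y k x0 \<eta> \<tau>0" and v_eq: "v = \<rho> *\<^sub>R geod_vel Y k \<eta> \<tau>0" by blast
  define b where "b = \<tau>0 - \<rho> * t0"
  have c: "\<rho> * t + b \<in> geod_dom (flat_form Y \<eta> \<eta>) \<and> c t = geod Y k x0 \<eta> (\<rho> * t + b)" if "t \<in> J" for t
    using geodesic_eq_geod[OF kY x0 \<eta> geodesic t0 \<tau>0 c0 v[unfolded v_eq] that]
    by (simp add: b_def algebra_simps)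
  have J: "J = {t. \<rho> * t + b \<in> geod_dom (flat_form Y \<eta> \<eta>)}"
    by (rule maximal_geodesic_geod_dom[OF kY x0 \<eta> \<open>\<rho> \<noteq> 0\<close> max c])
  have "\<gamma> = (\<lambda>t. geod Y k x0 \<eta> (\<rho> * t + b)) ` J"
    unfolding \<gamma>[symmetric] by (rule image_cong) (simp_all add: c)
  also have "\<dots> = geod_curve Y k x0 \<eta>"
    using affine_parametrization_geod[OF kY x0 \<eta> \<open>\<rho> \<noteq> 0\<close>, of b] by (simp add: J affine_parametrization_def)
  finally show "\<exists>x0 \<eta>. x0 $ k = 0 \<and> \<eta> $ k = 0 \<and> \<gamma> = geod_curve Y k x0 \<eta>"
    using x0 \<eta> by blast
next
  assume "\<exists>x0 \<eta>. x0 $ k = 0 \<and> \<eta> $ k = 0 \<and> \<gamma> = geod_curve Y k x0 \<eta>"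
  then obtain x0 \<eta> where x0: "x0 $ k = 0" and \<eta>: "\<eta> $ k = 0" and \<gamma>: "\<gamma> = geod_curve Y k x0 \<eta>" by blast
  let ?B = "flat_form Y \<eta> \<eta>"
  have "affine_parametrization (half_space_metric Y k) (half_space k) \<gamma> (geod Y k x0 \<eta>) (geod_dom ?B)"
    using affine_parametrization_geod[OF kY x0 \<eta>, of 1 0] by (simp add: \<gamma>)
  moreover have "0 < half_space_metric Y k (geod Y k x0 \<eta> t)
      (vector_derivative (geod Y k x0 \<eta>) (at t)) (vector_derivative (geod Y k x0 \<eta>) (at t))"
    if t: "t \<in> geod_dom ?B" for t
  proof -
    have "0 < recip_height ?B t" using t by (simp add: geod_dom_def)
    then show ?thesis
      using x0 \<eta> by (simp add: vector_derivative_at[OF geod_has_vector_derivative[OF t]]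
          half_space_metric_flat_form flat_form_geod_vel[OF kY \<eta> t] geod_nth_k)
  qed
  ultimately show "spacelike_geodesic (half_space_metric Y k) (half_space k) \<gamma>"
    unfolding spacelike_geodesic_def by blast
qed

text \<open>Rigidity: a geodesic inside the conic is tangent to it at one time, and its initial values are
those of a reparametrized normal form.\<close>

lemma geodesic_inside_geod_curve:
  assumes kY: "k \<notin> Y" and x0: "x0 $ k = 0" and \<eta>: "\<eta> $ k = 0"
    and geodesic: "geodesic_on (half_space_metric Y k) (half_space k) c J"
    and sub: "c ` J \<subseteq> geod_curve Y k x0 \<eta>"
  shows "\<exists>\<rho> b. \<forall>t\<in>J. \<rho> * t + b \<in> geod_dom (flat_form Y \<eta> \<eta>) \<and> c t = geod Y k x0 \<eta> (\<rho> * t + b)"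
proof -
  from geodesic obtain t0 w where J: "open J" and t0: "t0 \<in> J" and w: "(c has_vector_derivative w) (at t0)"
    unfolding geodesic_on_def by blast
  from sub t0 obtain \<tau>0 where \<tau>0: "\<tau>0 \<in> geod_dom (flat_form Y \<eta> \<eta>)" "c t0 = geod Y k x0 \<eta> \<tau>0"
    unfolding geod_image[symmetric] by blast
  from tangent_of_geod_curve[OF x0 \<eta> \<tau>0(1) J t0 sub \<tau>0(2) w]
  obtain \<rho> where "w = \<rho> *\<^sub>R geod_vel Y k \<eta> \<tau>0" ..
  with w have "(c has_vector_derivative \<rho> *\<^sub>R geod_vel Y k \<eta> \<tau>0) (at t0)" by simp
  note eq = geodesic_eq_geod[OF kY x0 \<eta> geodesic t0 \<tau>0 this]
  define b where "b = \<tau>0 - \<rho> * t0"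
  have "\<tau>0 + \<rho> * (t - t0) = \<rho> * t + b" for t by (simp add: b_def algebra_simps)
  with eq show ?thesis by auto
qed

text \<open>A constant geodesic cannot sweep out the curve, because the normal form has nonzero velocity;
so the factor \<open>\<rho>\<close> provided by rigidity does not vanish.\<close>

lemma affine_parametrization_geod_curveE:
  assumes kY: "k \<notin> Y" and x0: "x0 $ k = 0" and \<eta>: "\<eta> $ k = 0"
    and param: "affine_parametrization (half_space_metric Y k) (half_space k) (geod_curve Y k x0 \<eta>) c J"
  obtains \<rho> b where "\<rho> \<noteq> 0" and "J = {t. \<rho> * t + b \<in> geod_dom (flat_form Y \<eta> \<eta>)}"
    and "\<And>t. t \<in> J \<Longrightarrow> c t = geod Y k x0 \<eta> (\<rho> * t + b)"
proof -
  let ?B = "flat_form Y \<eta> \<eta>"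
  from param have max: "maximal_geodesic (half_space_metric Y k) (half_space k) c J"
    and image: "c ` J = geod_curve Y k x0 \<eta>"
    by (simp_all add: affine_parametrization_def)
  from geodesic_inside_geod_curve[OF kY x0 \<eta>, of c J] max image
  obtain \<rho> b where c: "\<And>t. t \<in> J \<Longrightarrow> \<rho> * t + b \<in> geod_dom ?B \<and> c t = geod Y k x0 \<eta> (\<rho> * t + b)"
    by (auto simp: maximal_geodesic_def)
  have "\<rho> \<noteq> 0"
  proof
    assume "\<rho> = 0"
    have const: "geod Y k x0 \<eta> t = geod Y k x0 \<eta> b" if "t \<in> geod_dom ?B" for t
    proof -
      have "geod Y k x0 \<eta> t \<in> c ` J" unfolding image geod_image[symmetric] using that by blast
      then show ?thesis using c \<open>\<rho> = 0\<close> by auto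
    qed
    have dom: "\<bar>?B\<bar> \<in> geod_dom ?B" by (rule geod_dom_nonempty)
    have "open (geod_dom ?B)"
      using geod_geodesic_on[OF kY x0 \<eta>, of 1 0] by (simp add: geodesic_on_def)
    have "((\<lambda>t. geod Y k x0 \<eta> b) has_vector_derivative geod_vel Y k \<eta> \<bar>?B\<bar>) (at \<bar>?B\<bar>)"
      by (rule has_vector_derivative_transform_within_open[OF geod_has_vector_derivative[OF dom] \<open>open _\<close> dom])
        (rule const)
    from vector_derivative_unique_at[OF this has_vector_derivative_const]
    have "geod_vel Y k \<eta> \<bar>?B\<bar> = 0" .
    then have "1 / (recip_height ?B \<bar>?B\<bar>)\<^sup>2 = 0"
      using flat_form_geod_vel[OF kY \<eta> dom] by (simp add: flat_form_def)
    then show False using dom by (simp add: geod_dom_def)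
  qed
  from that[OF this maximal_geodesic_geod_dom[OF kY x0 \<eta> this max c]] c show thesis by blast
qed

lemma complete_geodesic_geod_curve:
  assumes "k \<notin> Y" and "x0 $ k = 0" and "\<eta> $ k = 0" and "0 \<le> flat_form Y \<eta> \<eta>"
  shows "complete_geodesic (half_space_metric Y k) (half_space k) (geod_curve Y k x0 \<eta>)"
proof -
  have "J = UNIV" if "affine_parametrization (half_space_metric Y k) (half_space k) (geod_curve Y k x0 \<eta>) c J" for c J
    using affine_parametrization_geod_curveE[OF assms(1-3) that] by (auto simp: geod_dom_nonneg[OF assms(4)])
  then show ?thesis
    using affine_parametrization_geod[OF assms(1-3), of 1 0] unfolding complete_geodesic_def by auto
qed

section \<open>Curves in a vertical plane\<close>

text \<open>Affine coordinates in the vertical plane over the line through \<open>a\<close> directed by \<open>d\<close>. The length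
of \<open>d\<close> is arbitrary, so \<open>t\<close> is scaled by \<open>\<parallel>d\<parallel>\<close> in metric statements.\<close>

definition plane_point :: "'n::finite \<Rightarrow> real^'n \<Rightarrow> real^'n \<Rightarrow> real \<Rightarrow> real \<Rightarrow> real^'n" where
  "plane_point k a d t z = a + t *\<^sub>R d + z *\<^sub>R axis k 1"

definition arc_over :: "'n::finite \<Rightarrow> real^'n \<Rightarrow> real^'n \<Rightarrow> (real \<Rightarrow> real \<Rightarrow> bool) \<Rightarrow> (real^'n) set" where
  "arc_over k a d P = {plane_point k a d t z | t z. 0 < z \<and> P t z}"

lemma arc_over_cong:
  "(\<And>t z. 0 < z \<Longrightarrow> P t z \<longleftrightarrow> Q t z) \<Longrightarrow> arc_over k a d P = arc_over k a d Q"
  unfolding arc_over_def by blast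

lemma arc_over_shift: "arc_over k (a + c *\<^sub>R d) d P = arc_over k a d (\<lambda>t z. P (t - c) z)"
proof -
  have "plane_point k (a + c *\<^sub>R d) d t z = plane_point k a d (t + c) z" for t z
    by (simp add: plane_point_def scaleR_add_left)
  then show ?thesis unfolding arc_over_def by (force intro: exI[where x = "_ - c"])
qed

text \<open>The conic of \<open>s d\<close> in terms of the coordinate \<open>t = s X\<close> along \<open>d\<close>. The scalar \<open>s\<close>, which may be
negative, controls the size and the side of the conic in a vertical plane of fixed direction \<open>d\<close>.\<close>

lemma geod_curve_arc_over:
  assumes "s \<noteq> 0"
  shows "geod_curve Y k x0 (s *\<^sub>R d)
    = arc_over k x0 d (\<lambda>t z. 0 < t / s \<and> z\<^sup>2 = t / s - flat_form Y d d * t\<^sup>2)"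
proof -
  have q: "flat_form Y (s *\<^sub>R d) (s *\<^sub>R d) * X\<^sup>2 = flat_form Y d d * (X * s)\<^sup>2" for X
    by (simp add: flat_form_scaleR power_mult_distrib mult_ac)
  have p: "x0 + X *\<^sub>R s *\<^sub>R d + z *\<^sub>R axis k 1 = plane_point k x0 d (X * s) z" for X z
    by (simp add: plane_point_def)
  show ?thesis
  proof (intro equalityI subsetI)
    fix x assume "x \<in> geod_curve Y k x0 (s *\<^sub>R d)"
    then obtain X z where X: "0 < X" "0 < z" "z\<^sup>2 = X - flat_form Y d d * (X * s)\<^sup>2"
      and x: "x = plane_point k x0 d (X * s) z"
      unfolding geod_curve_def q p by blast
    have "0 < X * s / s \<and> z\<^sup>2 = X * s / s - flat_form Y d d * (X * s)\<^sup>2" using X assms by simp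
    with X(2) x show "x \<in> arc_over k x0 d (\<lambda>t z. 0 < t / s \<and> z\<^sup>2 = t / s - flat_form Y d d * t\<^sup>2)"
      unfolding arc_over_def by blast
  next
    fix x assume "x \<in> arc_over k x0 d (\<lambda>t z. 0 < t / s \<and> z\<^sup>2 = t / s - flat_form Y d d * t\<^sup>2)"
    then obtain t z where t: "0 < z" "0 < t / s" "z\<^sup>2 = t / s - flat_form Y d d * t\<^sup>2"
      and x: "x = plane_point k x0 d t z"
      unfolding arc_over_def by blast
    have "t / s * s = t" using assms by simp
    with t x show "x \<in> geod_curve Y k x0 (s *\<^sub>R d)"
      unfolding geod_curve_def q p by (intro CollectI exI[of _ "t / s"] exI[of _ z]) simp
  qed
qed

lemma horizontal_lineE:
  assumes "horizontal_line k d L"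
  obtains a where "a $ k = 0" and "d $ k = 0" and "d \<noteq> 0" and "L = range (\<lambda>t. a + t *\<^sub>R d)"
  using assms by (auto simp: horizontal_line_def half_space_boundary_def)

lemma horizontal_lineI: "a $ k = 0 \<Longrightarrow> d $ k = 0 \<Longrightarrow> d \<noteq> 0 \<Longrightarrow> horizontal_line k d (range (\<lambda>t. a + t *\<^sub>R d))"
  by (auto simp: horizontal_line_def half_space_boundary_def)

lemma plane_point_nth_k: "a $ k = 0 \<Longrightarrow> d $ k = 0 \<Longrightarrow> plane_point k a d t z $ k = z"
  by (simp add: plane_point_def axis_def)

lemma plane_over_line:
  assumes "a $ k = 0" and "d $ k = 0"
  shows "plane_over k (range (\<lambda>t. a + t *\<^sub>R d)) = {plane_point k a d t z | t z. True}"
proof (intro equalityI subsetI)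
  fix x assume "x \<in> plane_over k (range (\<lambda>t. a + t *\<^sub>R d))"
  then obtain t where "horizontal k x = a + t *\<^sub>R d" by (auto simp: plane_over_def)
  then have "x = plane_point k a d t (x $ k)"
    using horizontal_decomposition[of k x] by (simp add: plane_point_def)
  then show "x \<in> {plane_point k a d t z | t z. True}" by blast
next
  fix x assume "x \<in> {plane_point k a d t z | t z. True}"
  then obtain t z where "x = plane_point k a d t z" by blast
  then have "horizontal k x = a + t *\<^sub>R d"
    using assms by (simp add: vec_eq_iff horizontal_def plane_point_def axis_def)
  then show "x \<in> plane_over k (range (\<lambda>t. a + t *\<^sub>R d))" unfolding plane_over_def by blast
qed

lemma plane_over_line_boundary:
  assumes "a $ k = 0" and "d $ k = 0" and "F \<in> plane_over k (range (\<lambda>t. a + t *\<^sub>R d))" and "F $ k = 0"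
  obtains f where "F = plane_point k a d f 0"
  using assms plane_point_nth_k[OF assms(1,2)] by (auto simp: plane_over_line)

lemma section_vertical_plane:
  assumes "a $ k = 0" and "d $ k = 0"
  shows "{x \<in> plane_over k (range (\<lambda>t. a + t *\<^sub>R d)). P x} \<inter> vertical_plane k (range (\<lambda>t. a + t *\<^sub>R d))
    = arc_over k a d (\<lambda>t z. P (plane_point k a d t z))"
  unfolding vertical_plane_def half_space_def plane_over_line[OF assms] arc_over_def
  using plane_point_nth_k[OF assms] by force

lemma dist_plane_point:
  assumes "d $ k = 0"
  shows "dist (plane_point k a d t z) (plane_point k a d t' z')
    = sqrt ((norm d * (t - t'))\<^sup>2 + (z - z')\<^sup>2)"
proof -
  have "plane_point k a d t z - plane_point k a d t' z' = (t - t') *\<^sub>R d + (z - z') *\<^sub>R axis k 1"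
    by (simp add: plane_point_def algebra_simps)
  moreover have "d \<bullet> axis k 1 = 0" using assms by (simp add: inner_axis)
  moreover have "axis k 1 \<bullet> (axis k 1 :: real^'a) = 1" by (simp add: inner_axis)
  ultimately have "(dist (plane_point k a d t z) (plane_point k a d t' z'))\<^sup>2
      = (norm d * (t - t'))\<^sup>2 + (z - z')\<^sup>2"
    by (simp add: dist_norm power2_norm_eq_inner inner_add inner_commute power_mult_distrib)
      (simp add: power2_eq_square)
  then show ?thesis by (simp add: real_sqrt_unique)
qed

section \<open>Equations of conics with foci on an axis\<close>

text \<open>If the distances \<open>r\<^sub>1\<close> and \<open>r\<^sub>2\<close> to the foci \<open>(- f, 0)\<close> and \<open>(f, 0)\<close> have sum \<open>2 \<alpha>\<close>, then
\<open>r\<^sub>1\<^sup>2 - r\<^sub>2\<^sup>2 = 4 X f\<close> forces \<open>r\<^sub>1 = \<alpha> + X f / \<alpha>\<close>. Conversely the equation says that the squares of the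
distances are those of \<open>\<alpha> \<plusminus> X f / \<alpha>\<close>, which are nonnegative numbers on the ellipse.\<close>

lemma ellipse_equation:
  fixes X f \<alpha> z :: real
  assumes "\<bar>f\<bar> < \<alpha>"
  shows "sqrt ((X + f)\<^sup>2 + z\<^sup>2) + sqrt ((X - f)\<^sup>2 + z\<^sup>2) = 2 * \<alpha>
    \<longleftrightarrow> (\<alpha>\<^sup>2 - f\<^sup>2) * X\<^sup>2 + \<alpha>\<^sup>2 * z\<^sup>2 = \<alpha>\<^sup>2 * (\<alpha>\<^sup>2 - f\<^sup>2)"
proof -
  define r1 where "r1 = sqrt ((X + f)\<^sup>2 + z\<^sup>2)"
  define r2 where "r2 = sqrt ((X - f)\<^sup>2 + z\<^sup>2)"
  have r: "r1\<^sup>2 = (X + f)\<^sup>2 + z\<^sup>2" "r2\<^sup>2 = (X - f)\<^sup>2 + z\<^sup>2" by (simp_all add: r1_def r2_def)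
  have "0 < \<alpha>" using assms by linarith
  show ?thesis
    unfolding r1_def[symmetric] r2_def[symmetric]
  proof
    assume "r1 + r2 = 2 * \<alpha>"
    then have r2: "r2 = 2 * \<alpha> - r1" by simp
    have "r1\<^sup>2 - (2 * \<alpha> - r1)\<^sup>2 = 4 * X * f"
      unfolding r2[symmetric] r by (simp add: power2_eq_square algebra_simps)
    then have "\<alpha> * r1 = \<alpha>\<^sup>2 + X * f" by (simp add: power2_eq_square algebra_simps)
    then have "\<alpha>\<^sup>2 * ((X + f)\<^sup>2 + z\<^sup>2) = (\<alpha>\<^sup>2 + X * f)\<^sup>2"
      by (metis power_mult_distrib r(1))
    then show "(\<alpha>\<^sup>2 - f\<^sup>2) * X\<^sup>2 + \<alpha>\<^sup>2 * z\<^sup>2 = \<alpha>\<^sup>2 * (\<alpha>\<^sup>2 - f\<^sup>2)"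
      by (simp add: power2_eq_square algebra_simps)
  next
    assume eq: "(\<alpha>\<^sup>2 - f\<^sup>2) * X\<^sup>2 + \<alpha>\<^sup>2 * z\<^sup>2 = \<alpha>\<^sup>2 * (\<alpha>\<^sup>2 - f\<^sup>2)"
    have "\<bar>f\<bar> < \<bar>\<alpha>\<bar>" using assms \<open>0 < \<alpha>\<close> by simp
    then have "f\<^sup>2 < \<alpha>\<^sup>2" using abs_le_square_iff[of \<alpha> f] by linarith
    have "(\<alpha>\<^sup>2 - f\<^sup>2) * X\<^sup>2 \<le> (\<alpha>\<^sup>2 - f\<^sup>2) * \<alpha>\<^sup>2"
    proof -
      have "0 \<le> \<alpha>\<^sup>2 * z\<^sup>2" by simp
      with eq show ?thesis using mult.commute[of "\<alpha>\<^sup>2" "\<alpha>\<^sup>2 - f\<^sup>2"] by linarith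
    qed
    then have "X\<^sup>2 \<le> \<alpha>\<^sup>2" using \<open>f\<^sup>2 < \<alpha>\<^sup>2\<close> by simp
    then have "\<bar>X\<bar> \<le> \<alpha>" using \<open>0 < \<alpha>\<close> abs_le_square_iff[of X \<alpha>] by simp
    then have "\<bar>X\<bar> * \<bar>f\<bar> \<le> \<alpha> * \<alpha>" using assms by (intro mult_mono) auto
    then have Xf: "\<bar>X * f\<bar> \<le> \<alpha> * \<alpha>" by (simp add: abs_mult)
    have "(X + f)\<^sup>2 + z\<^sup>2 = ((\<alpha> * \<alpha> + X * f) / \<alpha>)\<^sup>2" and "(X - f)\<^sup>2 + z\<^sup>2 = ((\<alpha> * \<alpha> - X * f) / \<alpha>)\<^sup>2"
      using eq \<open>0 < \<alpha>\<close> by (simp_all add: power_divide eq_divide_eq) (simp_all add: power2_eq_square algebra_simps)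
    moreover have "0 \<le> (\<alpha> * \<alpha> + X * f) / \<alpha>" "0 \<le> (\<alpha> * \<alpha> - X * f) / \<alpha>"
      using Xf \<open>0 < \<alpha>\<close> by (auto intro!: divide_nonneg_pos)
    ultimately have "r1 = (\<alpha> * \<alpha> + X * f) / \<alpha>" "r2 = (\<alpha> * \<alpha> - X * f) / \<alpha>"
      by (simp_all only: r1_def r2_def real_sqrt_abs abs_of_nonneg)
    then show "r1 + r2 = 2 * \<alpha>" using \<open>0 < \<alpha>\<close> by (simp add: add_divide_distrib[symmetric])
  qed
qed

text \<open>The same computation with \<open>r\<^sub>1 = X f / \<alpha> + \<alpha>\<close> and \<open>r\<^sub>2 = X f / \<alpha> - \<alpha>\<close>. As \<open>f\<close> may be negative, the
branch around \<open>(f, 0)\<close> is singled out by the sign of \<open>X f\<close>.\<close>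

lemma hyperbola_equation:
  fixes X f \<alpha> z :: real
  assumes "0 < \<alpha>" and "\<alpha> < \<bar>f\<bar>"
  shows "sqrt ((X + f)\<^sup>2 + z\<^sup>2) - sqrt ((X - f)\<^sup>2 + z\<^sup>2) = 2 * \<alpha>
    \<longleftrightarrow> 0 < X * f \<and> (f\<^sup>2 - \<alpha>\<^sup>2) * X\<^sup>2 - \<alpha>\<^sup>2 * z\<^sup>2 = \<alpha>\<^sup>2 * (f\<^sup>2 - \<alpha>\<^sup>2)"
proof -
  define r1 where "r1 = sqrt ((X + f)\<^sup>2 + z\<^sup>2)"
  define r2 where "r2 = sqrt ((X - f)\<^sup>2 + z\<^sup>2)"
  have r: "r1\<^sup>2 = (X + f)\<^sup>2 + z\<^sup>2" "r2\<^sup>2 = (X - f)\<^sup>2 + z\<^sup>2" by (simp_all add: r1_def r2_def)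
  show ?thesis
    unfolding r1_def[symmetric] r2_def[symmetric]
  proof
    assume "r1 - r2 = 2 * \<alpha>"
    then have r2: "r1 = 2 * \<alpha> + r2" by simp
    have "(2 * \<alpha> + r2)\<^sup>2 - r2\<^sup>2 = 4 * X * f"
      unfolding r2[symmetric] r by (simp add: power2_eq_square algebra_simps)
    then have r2': "\<alpha> * r2 = X * f - \<alpha>\<^sup>2" by (simp add: power2_eq_square algebra_simps)
    have "0 \<le> \<alpha> * r2" using \<open>0 < \<alpha>\<close> by (simp add: r2_def)
    then have "\<alpha>\<^sup>2 \<le> X * f" using r2' by simp
    moreover have "0 < \<alpha>\<^sup>2" using \<open>0 < \<alpha>\<close> by simp
    ultimately have "0 < X * f" by linarith
    moreover have "\<alpha>\<^sup>2 * ((X - f)\<^sup>2 + z\<^sup>2) = (X * f - \<alpha>\<^sup>2)\<^sup>2"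
      by (metis power_mult_distrib r(2) r2')
    then have "(f\<^sup>2 - \<alpha>\<^sup>2) * X\<^sup>2 - \<alpha>\<^sup>2 * z\<^sup>2 = \<alpha>\<^sup>2 * (f\<^sup>2 - \<alpha>\<^sup>2)"
      by (simp add: power2_eq_square algebra_simps)
    ultimately show "0 < X * f \<and> (f\<^sup>2 - \<alpha>\<^sup>2) * X\<^sup>2 - \<alpha>\<^sup>2 * z\<^sup>2 = \<alpha>\<^sup>2 * (f\<^sup>2 - \<alpha>\<^sup>2)" ..
  next
    assume asm: "0 < X * f \<and> (f\<^sup>2 - \<alpha>\<^sup>2) * X\<^sup>2 - \<alpha>\<^sup>2 * z\<^sup>2 = \<alpha>\<^sup>2 * (f\<^sup>2 - \<alpha>\<^sup>2)"
    then have eq: "(f\<^sup>2 - \<alpha>\<^sup>2) * X\<^sup>2 - \<alpha>\<^sup>2 * z\<^sup>2 = \<alpha>\<^sup>2 * (f\<^sup>2 - \<alpha>\<^sup>2)" ..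
    have "\<bar>\<alpha>\<bar> < \<bar>f\<bar>" using assms by simp
    then have "\<alpha>\<^sup>2 < f\<^sup>2" using abs_le_square_iff[of f \<alpha>] by linarith
    have "(f\<^sup>2 - \<alpha>\<^sup>2) * \<alpha>\<^sup>2 \<le> (f\<^sup>2 - \<alpha>\<^sup>2) * X\<^sup>2"
    proof -
      have "0 \<le> \<alpha>\<^sup>2 * z\<^sup>2" by simp
      with eq show ?thesis using mult.commute[of "\<alpha>\<^sup>2" "f\<^sup>2 - \<alpha>\<^sup>2"] by linarith
    qed
    then have "\<alpha>\<^sup>2 \<le> X\<^sup>2" using \<open>\<alpha>\<^sup>2 < f\<^sup>2\<close> by simp
    then have "\<alpha> \<le> \<bar>X\<bar>" using \<open>0 < \<alpha>\<close> abs_le_square_iff[of \<alpha> X] by simp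
    then have "\<alpha> * \<alpha> \<le> \<bar>X\<bar> * \<bar>f\<bar>" using assms by (intro mult_mono) auto
    then have Xf: "\<alpha> * \<alpha> \<le> X * f" using asm by (simp add: abs_mult[symmetric])
    have "(X + f)\<^sup>2 + z\<^sup>2 = ((X * f + \<alpha> * \<alpha>) / \<alpha>)\<^sup>2" and "(X - f)\<^sup>2 + z\<^sup>2 = ((X * f - \<alpha> * \<alpha>) / \<alpha>)\<^sup>2"
      using eq \<open>0 < \<alpha>\<close> by (simp_all add: power_divide eq_divide_eq) (simp_all add: power2_eq_square algebra_simps)
    moreover have "0 \<le> (X * f + \<alpha> * \<alpha>) / \<alpha>" "0 \<le> (X * f - \<alpha> * \<alpha>) / \<alpha>"
      using Xf asm \<open>0 < \<alpha>\<close> by (auto intro!: divide_nonneg_pos add_nonneg_nonneg)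
    ultimately have "r1 = (X * f + \<alpha> * \<alpha>) / \<alpha>" "r2 = (X * f - \<alpha> * \<alpha>) / \<alpha>"
      by (simp_all only: r1_def r2_def real_sqrt_abs abs_of_nonneg)
    then show "r1 - r2 = 2 * \<alpha>" using \<open>0 < \<alpha>\<close> by (simp add: diff_divide_distrib[symmetric])
  qed
qed

section \<open>Eccentricity and the flat form\<close>

text \<open>Only the horizontal part \<open>(u, v)\<close> of \<open>w\<close> enters the type of a curve, and only through
\<open>\<parallel>u\<parallel>\<^sup>2 - \<parallel>v\<parallel>\<^sup>2\<close> and \<open>\<parallel>u\<parallel>\<^sup>2 + \<parallel>v\<parallel>\<^sup>2\<close>.\<close>

lemma norm_x_norm_y:
  assumes "k \<notin> Y"
  shows "(norm_x Y k w)\<^sup>2 - (norm_y Y w)\<^sup>2 = flat_form Y (horizontal k w) (horizontal k w)"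
    and "(norm_x Y k w)\<^sup>2 + (norm_y Y w)\<^sup>2 = (norm (horizontal k w))\<^sup>2"
proof -
  have split: "(\<Sum>i\<in>UNIV. g i) = (\<Sum>i\<in>- insert k Y. g i) + (\<Sum>i\<in>Y. g i)" if "g k = 0" for g :: "'a \<Rightarrow> real"
  proof -
    have "(\<Sum>i\<in>UNIV. g i) = (\<Sum>i\<in>insert k (- insert k Y \<union> Y). g i)" by (rule sum.cong) auto
    also have "\<dots> = (\<Sum>i\<in>- insert k Y \<union> Y. g i)" using assms that by (subst sum.insert) auto
    also have "\<dots> = (\<Sum>i\<in>- insert k Y. g i) + (\<Sum>i\<in>Y. g i)" by (rule sum.union_disjoint) auto
    finally show ?thesis .
  qed
  have x: "(norm_x Y k w)\<^sup>2 = (\<Sum>i\<in>- insert k Y. (w $ i)\<^sup>2)"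
    and y: "(norm_y Y w)\<^sup>2 = (\<Sum>i\<in>Y. (w $ i)\<^sup>2)"
    by (simp_all add: norm_x_def norm_y_def L2_set_def sum_nonneg)
  have "flat_form Y (horizontal k w) (horizontal k w)
      = (\<Sum>i\<in>- insert k Y. (w $ i)\<^sup>2) + (\<Sum>i\<in>Y. - (w $ i)\<^sup>2)"
    unfolding flat_form_def
  proof (subst split)
    show "(\<Sum>i\<in>- insert k Y. (if i \<in> Y then - 1 else 1) * horizontal k w $ i * horizontal k w $ i)
        + (\<Sum>i\<in>Y. (if i \<in> Y then - 1 else 1) * horizontal k w $ i * horizontal k w $ i)
        = (\<Sum>i\<in>- insert k Y. (w $ i)\<^sup>2) + (\<Sum>i\<in>Y. - (w $ i)\<^sup>2)"
      using assms by (intro arg_cong2[where f = "(+)"] sum.cong) (auto simp: horizontal_def power2_eq_square)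
  qed (simp add: horizontal_nth)
  then show "(norm_x Y k w)\<^sup>2 - (norm_y Y w)\<^sup>2 = flat_form Y (horizontal k w) (horizontal k w)"
    by (simp add: x y sum_negf)
  have "(norm (horizontal k w))\<^sup>2 = (\<Sum>i\<in>UNIV. (horizontal k w $ i)\<^sup>2)"
    by (simp add: norm_vec_def L2_set_def sum_nonneg)
  also have "\<dots> = (\<Sum>i\<in>- insert k Y. (horizontal k w $ i)\<^sup>2) + (\<Sum>i\<in>Y. (horizontal k w $ i)\<^sup>2)"
    by (rule split) (simp add: horizontal_nth)
  also have "\<dots> = (\<Sum>i\<in>- insert k Y. (w $ i)\<^sup>2) + (\<Sum>i\<in>Y. (w $ i)\<^sup>2)"
    using assms by (intro arg_cong2[where f = "(+)"] sum.cong) (auto simp: horizontal_def)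
  finally show "(norm_x Y k w)\<^sup>2 + (norm_y Y w)\<^sup>2 = (norm (horizontal k w))\<^sup>2" by (simp add: x y)
qed

lemma norm_x_norm_y_compare:
  assumes "k \<notin> Y"
  shows "norm_y Y w < norm_x Y k w \<longleftrightarrow> 0 < flat_form Y (horizontal k w) (horizontal k w)"
    and "norm_x Y k w = norm_y Y w \<longleftrightarrow> flat_form Y (horizontal k w) (horizontal k w) = 0"
    and "norm_x Y k w < norm_y Y w \<longleftrightarrow> flat_form Y (horizontal k w) (horizontal k w) < 0"
proof -
  have "0 \<le> norm_x Y k w" "0 \<le> norm_y Y w" by (simp_all add: norm_x_def norm_y_def L2_set_nonneg)
  then show "norm_y Y w < norm_x Y k w \<longleftrightarrow> 0 < flat_form Y (horizontal k w) (horizontal k w)"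
    and "norm_x Y k w = norm_y Y w \<longleftrightarrow> flat_form Y (horizontal k w) (horizontal k w) = 0"
    and "norm_x Y k w < norm_y Y w \<longleftrightarrow> flat_form Y (horizontal k w) (horizontal k w) < 0"
    unfolding norm_x_norm_y(1)[OF assms, symmetric]
    using power_strict_mono[of "norm_y Y w" "norm_x Y k w" 2] power_strict_mono[of "norm_x Y k w" "norm_y Y w" 2]
    by (smt (verit) power2_eq_iff_nonneg zero_less_numeral)+
qed

lemma flat_form_le_norm: "flat_form Y d d \<le> (norm d)\<^sup>2"
proof -
  have n: "(norm d)\<^sup>2 = (\<Sum>i\<in>UNIV. (d $ i)\<^sup>2)" by (simp add: norm_vec_def L2_set_def sum_nonneg)
  show ?thesis
    unfolding n flat_form_def by (rule sum_mono) (simp add: power2_eq_square)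
qed

lemma ecc_S_eq:
  assumes "k \<notin> Y" and "horizontal k w \<noteq> 0"
  shows "ecc_S Y k w = sqrt (1 - flat_form Y (horizontal k w) (horizontal k w) / (norm (horizontal k w))\<^sup>2)"
proof -
  have "(norm_y Y w)\<^sup>2 - (norm_x Y k w)\<^sup>2 = - flat_form Y (horizontal k w) (horizontal k w)"
    using norm_x_norm_y(1)[OF assms(1), of w] by simp
  then show ?thesis unfolding ecc_S_def norm_x_norm_y(2)[OF assms(1)] by simp
qed

section \<open>Half ellipses and half hyperbola branches\<close>

text \<open>The focal distance in terms of the prescribed eccentricity: \<open>f\<^sup>2 = \<alpha>\<^sup>2 e\<^sub>S\<^sup>2\<close>.\<close>

lemma semi_axis_sq:
  assumes "d \<noteq> 0" and "\<bar>f1 - f2\<bar> * norm d / (2 * \<alpha>) = sqrt (1 - flat_form Y d d / (norm d)\<^sup>2)" and "0 < \<alpha>"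
  shows "(norm d * ((f2 - f1) / 2))\<^sup>2 = \<alpha>\<^sup>2 * (1 - flat_form Y d d / (norm d)\<^sup>2)"
proof -
  have "0 \<le> 1 - flat_form Y d d / (norm d)\<^sup>2"
    using flat_form_le_norm[of Y d] assms(1) by (simp add: divide_le_eq)
  then have "(\<bar>f1 - f2\<bar> * norm d / (2 * \<alpha>))\<^sup>2 = 1 - flat_form Y d d / (norm d)\<^sup>2"
    unfolding assms(2) by simp
  moreover have "(\<bar>f1 - f2\<bar> * norm d / (2 * \<alpha>))\<^sup>2 * \<alpha>\<^sup>2 = (norm d * ((f2 - f1) / 2))\<^sup>2"
    using assms(3) by (simp add: power_mult_distrib power_divide power2_commute[of f1])
  ultimately show ?thesis by (simp add: mult.commute)
qed

text \<open>Since \<open>1 - e\<^sub>S\<^sup>2 = q(d) / \<parallel>d\<parallel>\<^sup>2\<close>, the squared semi-axis in the direction of \<open>z\<close> is \<open>\<alpha>\<^sup>2 q(d) / \<parallel>d\<parallel>\<^sup>2\<close>, and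
the factors \<open>\<parallel>d\<parallel>\<close> cancel in the coordinate \<open>t\<close>. The number \<open>b\<close> is the semi-major axis in this
coordinate; either sign is allowed, which amounts to a choice of one of the two vertices.\<close>

lemma ellipse_arc_over:
  assumes "d $ k = 0" and "d \<noteq> 0" and "\<bar>f1 - f2\<bar> * norm d < 2 * \<alpha>"
    and ecc: "\<bar>f1 - f2\<bar> * norm d / (2 * \<alpha>) = sqrt (1 - flat_form Y d d / (norm d)\<^sup>2)"
    and b: "(norm d)\<^sup>2 * b\<^sup>2 = \<alpha>\<^sup>2"
  shows "arc_over k a d (\<lambda>t z. dist (plane_point k a d t z) (plane_point k a d f1 0)
      + dist (plane_point k a d t z) (plane_point k a d f2 0) = 2 * \<alpha>)
    = arc_over k a d (\<lambda>t z. z\<^sup>2 = flat_form Y d d * (b\<^sup>2 - (t - (f1 + f2) / 2)\<^sup>2))"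
proof (rule arc_over_cong)
  fix t z :: real
  define q where "q = flat_form Y d d"
  define D where "D = norm d"
  define m where "m = (f1 + f2) / 2"
  define f where "f = D * ((f2 - f1) / 2)"
  define X where "X = D * (t - m)"
  have "0 < D" using assms(2) by (simp add: D_def)
  have "0 < 2 * \<alpha>" using assms(3) by (smt (verit) abs_ge_zero mult_nonneg_nonneg norm_ge_zero)
  then have "0 < \<alpha>" by simp
  have "\<bar>f\<bar> < \<alpha>" using assms(3) \<open>0 < D\<close> by (simp add: f_def abs_mult D_def abs_minus_commute mult.commute)
  have f2: "f\<^sup>2 = \<alpha>\<^sup>2 * (1 - q / D\<^sup>2)"
    unfolding f_def D_def q_def by (rule semi_axis_sq[OF assms(2) ecc \<open>0 < \<alpha>\<close>])
  have b2: "\<alpha>\<^sup>2 = D\<^sup>2 * b\<^sup>2" using b by (simp add: D_def)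
  have "D * (t - f1) = X + f" "D * (t - f2) = X - f"
    by (simp_all add: X_def f_def m_def algebra_simps) (simp_all add: field_simps)
  then have "(dist (plane_point k a d t z) (plane_point k a d f1 0)
      + dist (plane_point k a d t z) (plane_point k a d f2 0) = 2 * \<alpha>)
    \<longleftrightarrow> sqrt ((X + f)\<^sup>2 + z\<^sup>2) + sqrt ((X - f)\<^sup>2 + z\<^sup>2) = 2 * \<alpha>"
    unfolding dist_plane_point[OF assms(1)] D_def[symmetric] by simp
  also have "\<dots> \<longleftrightarrow> (\<alpha>\<^sup>2 - f\<^sup>2) * X\<^sup>2 + \<alpha>\<^sup>2 * z\<^sup>2 = \<alpha>\<^sup>2 * (\<alpha>\<^sup>2 - f\<^sup>2)"
    by (rule ellipse_equation[OF \<open>\<bar>f\<bar> < \<alpha>\<close>])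
  also have "\<alpha>\<^sup>2 - f\<^sup>2 = \<alpha>\<^sup>2 * (q / D\<^sup>2)" unfolding f2 by (simp add: algebra_simps)
  also have "(\<alpha>\<^sup>2 * (q / D\<^sup>2) * X\<^sup>2 + \<alpha>\<^sup>2 * z\<^sup>2 = \<alpha>\<^sup>2 * (\<alpha>\<^sup>2 * (q / D\<^sup>2)))
      \<longleftrightarrow> q / D\<^sup>2 * X\<^sup>2 + z\<^sup>2 = \<alpha>\<^sup>2 * (q / D\<^sup>2)"
  proof -
    have "\<alpha>\<^sup>2 * (q / D\<^sup>2) * X\<^sup>2 + \<alpha>\<^sup>2 * z\<^sup>2 = \<alpha>\<^sup>2 * (q / D\<^sup>2 * X\<^sup>2 + z\<^sup>2)" by (simp add: algebra_simps)
    moreover have "\<alpha>\<^sup>2 \<noteq> 0" using \<open>0 < \<alpha>\<close> by simp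
    ultimately show ?thesis by (simp only: mult_cancel_left simp_thms)
  qed
  also have "q / D\<^sup>2 * X\<^sup>2 = q * (t - m)\<^sup>2" using \<open>0 < D\<close> by (simp add: X_def power_mult_distrib)
  also have "\<alpha>\<^sup>2 * (q / D\<^sup>2) = q * b\<^sup>2" using \<open>0 < D\<close> by (simp add: b2)
  also have "(q * (t - m)\<^sup>2 + z\<^sup>2 = q * b\<^sup>2) \<longleftrightarrow> z\<^sup>2 = q * (b\<^sup>2 - (t - m)\<^sup>2)" by (auto simp: algebra_simps)
  finally show "(dist (plane_point k a d t z) (plane_point k a d f1 0)
      + dist (plane_point k a d t z) (plane_point k a d f2 0) = 2 * \<alpha>)
    \<longleftrightarrow> z\<^sup>2 = flat_form Y d d * (b\<^sup>2 - (t - (f1 + f2) / 2)\<^sup>2)" by (simp only: q_def m_def)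
qed

text \<open>The equation is that of the ellipse, now with \<open>q(d) < 0\<close>.\<close>

lemma hyperbola_arc_over:
  assumes "d $ k = 0" and "d \<noteq> 0" and "0 < \<alpha>" and "2 * \<alpha> < \<bar>f1 - f2\<bar> * norm d"
    and ecc: "\<bar>f1 - f2\<bar> * norm d / (2 * \<alpha>) = sqrt (1 - flat_form Y d d / (norm d)\<^sup>2)"
    and b: "(norm d)\<^sup>2 * b\<^sup>2 = \<alpha>\<^sup>2"
  shows "arc_over k a d (\<lambda>t z. dist (plane_point k a d t z) (plane_point k a d f1 0)
      - dist (plane_point k a d t z) (plane_point k a d f2 0) = 2 * \<alpha>)
    = arc_over k a d (\<lambda>t z. 0 < (t - (f1 + f2) / 2) * (f2 - f1)
        \<and> z\<^sup>2 = flat_form Y d d * (b\<^sup>2 - (t - (f1 + f2) / 2)\<^sup>2))"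
proof (rule arc_over_cong)
  fix t z :: real
  define q where "q = flat_form Y d d"
  define D where "D = norm d"
  define m where "m = (f1 + f2) / 2"
  define f where "f = D * ((f2 - f1) / 2)"
  define X where "X = D * (t - m)"
  have "0 < D" using assms(2) by (simp add: D_def)
  have "\<alpha> < \<bar>f\<bar>" using assms(4) \<open>0 < D\<close> by (simp add: f_def abs_mult D_def abs_minus_commute mult.commute)
  have f2: "f\<^sup>2 = \<alpha>\<^sup>2 * (1 - q / D\<^sup>2)"
    unfolding f_def D_def q_def by (rule semi_axis_sq[OF assms(2) ecc \<open>0 < \<alpha>\<close>])
  have b2: "\<alpha>\<^sup>2 = D\<^sup>2 * b\<^sup>2" using b by (simp add: D_def)
  have "D * (t - f1) = X + f" "D * (t - f2) = X - f"
    by (simp_all add: X_def f_def m_def algebra_simps) (simp_all add: field_simps)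
  then have "(dist (plane_point k a d t z) (plane_point k a d f1 0)
      - dist (plane_point k a d t z) (plane_point k a d f2 0) = 2 * \<alpha>)
    \<longleftrightarrow> sqrt ((X + f)\<^sup>2 + z\<^sup>2) - sqrt ((X - f)\<^sup>2 + z\<^sup>2) = 2 * \<alpha>"
    unfolding dist_plane_point[OF assms(1)] D_def[symmetric] by simp
  also have "\<dots> \<longleftrightarrow> 0 < X * f \<and> (f\<^sup>2 - \<alpha>\<^sup>2) * X\<^sup>2 - \<alpha>\<^sup>2 * z\<^sup>2 = \<alpha>\<^sup>2 * (f\<^sup>2 - \<alpha>\<^sup>2)"
    by (rule hyperbola_equation[OF \<open>0 < \<alpha>\<close> \<open>\<alpha> < \<bar>f\<bar>\<close>])
  also have "f\<^sup>2 - \<alpha>\<^sup>2 = \<alpha>\<^sup>2 * (- q / D\<^sup>2)" unfolding f2 by (simp add: algebra_simps)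
  also have "(\<alpha>\<^sup>2 * (- q / D\<^sup>2) * X\<^sup>2 - \<alpha>\<^sup>2 * z\<^sup>2 = \<alpha>\<^sup>2 * (\<alpha>\<^sup>2 * (- q / D\<^sup>2)))
      \<longleftrightarrow> - q / D\<^sup>2 * X\<^sup>2 - z\<^sup>2 = \<alpha>\<^sup>2 * (- q / D\<^sup>2)"
  proof -
    have "\<alpha>\<^sup>2 * (- q / D\<^sup>2) * X\<^sup>2 - \<alpha>\<^sup>2 * z\<^sup>2 = \<alpha>\<^sup>2 * (- q / D\<^sup>2 * X\<^sup>2 - z\<^sup>2)" by (simp add: algebra_simps)
    moreover have "\<alpha>\<^sup>2 \<noteq> 0" using \<open>0 < \<alpha>\<close> by simp
    ultimately show ?thesis by (simp only: mult_cancel_left simp_thms)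
  qed
  also have "- q / D\<^sup>2 * X\<^sup>2 = - q * (t - m)\<^sup>2" using \<open>0 < D\<close> by (simp add: X_def power_mult_distrib)
  also have "\<alpha>\<^sup>2 * (- q / D\<^sup>2) = - q * b\<^sup>2" using \<open>0 < D\<close> by (simp add: b2)
  also have "(- q * (t - m)\<^sup>2 - z\<^sup>2 = - q * b\<^sup>2) \<longleftrightarrow> z\<^sup>2 = q * (b\<^sup>2 - (t - m)\<^sup>2)" by (auto simp: algebra_simps)
  also have "0 < X * f \<longleftrightarrow> 0 < (t - m) * (f2 - f1)"
  proof -
    have "X * f = D\<^sup>2 / 2 * ((t - m) * (f2 - f1))" by (simp add: X_def f_def power2_eq_square)
    moreover have "0 < D\<^sup>2 / 2" using \<open>0 < D\<close> by simp
    ultimately show ?thesis by (metis mult_pos_pos zero_less_mult_pos)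
  qed
  finally show "(dist (plane_point k a d t z) (plane_point k a d f1 0)
      - dist (plane_point k a d t z) (plane_point k a d f2 0) = 2 * \<alpha>)
    \<longleftrightarrow> 0 < (t - (f1 + f2) / 2) * (f2 - f1)
        \<and> z\<^sup>2 = flat_form Y d d * (b\<^sup>2 - (t - (f1 + f2) / 2)\<^sup>2)" by (simp only: q_def m_def)
qed

text \<open>Completing the square. The vertex \<open>m - b\<close> of a conic centered at \<open>m\<close> is moved to the origin.\<close>

lemma central_conic_equation:
  fixes q b m t :: real
  assumes "q \<noteq> 0" and "b \<noteq> 0"
  shows "(t - (m - b)) / (1 / (2 * q * b)) - q * (t - (m - b))\<^sup>2 = q * (b\<^sup>2 - (t - m)\<^sup>2)"
  using assms by (simp add: power2_eq_square algebra_simps)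

text \<open>On the ellipse, \<open>0 < z\<^sup>2 = X - q X\<^sup>2\<close> with \<open>q > 0\<close> already implies \<open>X > 0\<close>.\<close>

lemma ellipse_arc_eq_geod_curve:
  assumes q: "0 < flat_form Y d d" and "b \<noteq> 0"
  shows "arc_over k a d (\<lambda>t z. z\<^sup>2 = flat_form Y d d * (b\<^sup>2 - (t - m)\<^sup>2))
    = geod_curve Y k (a + (m - b) *\<^sub>R d) ((1 / (2 * flat_form Y d d * b)) *\<^sub>R d)"
proof -
  let ?q = "flat_form Y d d"
  have nz: "?q \<noteq> 0" using q by simp
  then have "1 / (2 * ?q * b) \<noteq> 0" using assms(2) by simp
  note geod_curve_arc_over[OF this, of Y k "a + (m - b) *\<^sub>R d" d]
  also have "arc_over k (a + (m - b) *\<^sub>R d) d (\<lambda>t z. 0 < t / (1 / (2 * ?q * b)) \<and> z\<^sup>2 = t / (1 / (2 * ?q * b)) - ?q * t\<^sup>2)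
      = arc_over k a d (\<lambda>t z. z\<^sup>2 = ?q * (b\<^sup>2 - (t - m)\<^sup>2))"
    unfolding arc_over_shift central_conic_equation[OF nz assms(2)]
  proof (rule arc_over_cong)
    fix t z :: real assume "0 < z"
    have "0 < (t - (m - b)) / (1 / (2 * ?q * b))" if "z\<^sup>2 = ?q * (b\<^sup>2 - (t - m)\<^sup>2)"
    proof -
      have "0 < ?q * (b\<^sup>2 - (t - m)\<^sup>2)" using \<open>0 < z\<close> that by (metis zero_less_power)
      moreover have "0 \<le> ?q * (t - (m - b))\<^sup>2" using q by simp
      ultimately show ?thesis using central_conic_equation[OF nz assms(2), of t m] by linarith
    qed
    then show "(0 < (t - (m - b)) / (1 / (2 * ?q * b)) \<and> z\<^sup>2 = ?q * (b\<^sup>2 - (t - m)\<^sup>2))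
        \<longleftrightarrow> z\<^sup>2 = ?q * (b\<^sup>2 - (t - m)\<^sup>2)" by blast
  qed
  finally show ?thesis by simp
qed

text \<open>The condition \<open>X > 0\<close> selects the branch through the vertex \<open>m - b\<close>, which lies on the side of \<open>\<phi>\<close>
if \<open>b\<close> and \<open>\<phi>\<close> have opposite signs.\<close>

lemma hyperbola_arc_eq_geod_curve:
  assumes q: "flat_form Y d d < 0" and "b * \<phi> < 0"
  shows "arc_over k a d (\<lambda>t z. 0 < (t - m) * \<phi> \<and> z\<^sup>2 = flat_form Y d d * (b\<^sup>2 - (t - m)\<^sup>2))
    = geod_curve Y k (a + (m - b) *\<^sub>R d) ((1 / (2 * flat_form Y d d * b)) *\<^sub>R d)"
proof -
  let ?q = "flat_form Y d d"
  have nz: "?q \<noteq> 0" and "b \<noteq> 0" using assms by auto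
  then have "1 / (2 * ?q * b) \<noteq> 0" by simp
  note geod_curve_arc_over[OF this, of Y k "a + (m - b) *\<^sub>R d" d]
  also have "arc_over k (a + (m - b) *\<^sub>R d) d (\<lambda>t z. 0 < t / (1 / (2 * ?q * b)) \<and> z\<^sup>2 = t / (1 / (2 * ?q * b)) - ?q * t\<^sup>2)
      = arc_over k a d (\<lambda>t z. 0 < (t - m) * \<phi> \<and> z\<^sup>2 = ?q * (b\<^sup>2 - (t - m)\<^sup>2))"
    unfolding arc_over_shift central_conic_equation[OF nz \<open>b \<noteq> 0\<close>]
  proof (rule arc_over_cong)
    fix t z :: real assume "0 < z"
    have "0 < (t - (m - b)) / (1 / (2 * ?q * b)) \<longleftrightarrow> 0 < (t - m) * \<phi>"
      if "z\<^sup>2 = ?q * (b\<^sup>2 - (t - m)\<^sup>2)"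
    proof -
      define u where "u = t - m"
      have "0 < ?q * (b\<^sup>2 - u\<^sup>2)" using \<open>0 < z\<close> that by (metis u_def zero_less_power)
      then have "b\<^sup>2 < u\<^sup>2" using q by (simp add: zero_less_mult_iff)
      then have "\<bar>b\<bar> < \<bar>u\<bar>" using abs_le_square_iff[of u b] by linarith
      have "(t - (m - b)) / (1 / (2 * ?q * b)) = 2 * ?q * (b * (u + b))" by (simp add: u_def)
      moreover have "0 < 2 * ?q * y \<longleftrightarrow> y < 0" for y
        using q by (simp add: zero_less_mult_iff)
      ultimately have "0 < (t - (m - b)) / (1 / (2 * ?q * b)) \<longleftrightarrow> b * (u + b) < 0"
        by (simp only:)
      also have "\<dots> \<longleftrightarrow> 0 < u * \<phi>"
        using \<open>b * \<phi> < 0\<close> \<open>\<bar>b\<bar> < \<bar>u\<bar>\<close> by (auto simp: mult_less_0_iff zero_less_mult_iff)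
      finally show ?thesis by (simp add: u_def)
    qed
    then show "(0 < (t - (m - b)) / (1 / (2 * ?q * b)) \<and> z\<^sup>2 = ?q * (b\<^sup>2 - (t - m)\<^sup>2))
        \<longleftrightarrow> 0 < (t - m) * \<phi> \<and> z\<^sup>2 = ?q * (b\<^sup>2 - (t - m)\<^sup>2)" by blast
  qed
  finally show ?thesis by simp
qed

lemma dist_foci: "d $ k = 0 \<Longrightarrow> dist (plane_point k a d f1 0) (plane_point k a d f2 0) = \<bar>f1 - f2\<bar> * norm d"
  by (simp add: dist_plane_point abs_mult mult.commute)

text \<open>From left to right, the vertex \<open>m - b\<close> serves as \<open>x\<^sub>0\<close>. From right to left, the foci are placed at
\<open>b \<plusminus> b e\<^sub>S\<close> with \<open>b = 1 / (2 q(d) s)\<close>, which puts the center at \<open>b\<close> and one vertex at \<open>x\<^sub>0\<close>.\<close>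

lemma half_ellipse_type_iff:
  assumes kY: "k \<notin> Y"
  shows "half_ellipse_type Y k \<gamma> w \<longleftrightarrow>
    0 < flat_form Y (horizontal k w) (horizontal k w) \<and>
    (\<exists>x0 s. x0 $ k = 0 \<and> s \<noteq> 0 \<and> \<gamma> = geod_curve Y k x0 (s *\<^sub>R horizontal k w))"
proof -
  define d where "d = horizontal k w"
  define q where "q = flat_form Y d d"
  define D where "D = norm d"
  have dk: "d $ k = 0" by (simp add: d_def horizontal_nth)
  show ?thesis
    unfolding d_def[symmetric] q_def[symmetric]
  proof (rule iffI)
    assume type: "half_ellipse_type Y k \<gamma> w"
    then have q: "0 < q"
      by (simp add: half_ellipse_type_def norm_x_norm_y_compare[OF kY] q_def d_def)
    from type obtain L C F1 F2 where L: "horizontal_line k d L"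
      and F: "F1 $ k = 0" "F2 $ k = 0" and ell: "is_ellipse (plane_over k L) F1 F2 (ecc_S Y k w) C"
      and \<gamma>: "\<gamma> = C \<inter> vertical_plane k L"
      unfolding half_ellipse_type_def half_space_boundary_def d_def by blast
    from L obtain a where a: "a $ k = 0" and "d \<noteq> 0" and L: "L = range (\<lambda>t. a + t *\<^sub>R d)"
      by (rule horizontal_lineE)
    have "0 < D" using \<open>d \<noteq> 0\<close> by (simp add: D_def)
    from ell obtain \<alpha> where P: "F1 \<in> plane_over k L" "F2 \<in> plane_over k L"
      and \<alpha>: "dist F1 F2 < 2 * \<alpha>" and e: "ecc_S Y k w = dist F1 F2 / (2 * \<alpha>)"
      and C: "C = {x \<in> plane_over k L. dist x F1 + dist x F2 = 2 * \<alpha>}"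
      unfolding is_ellipse_def by blast
    from P(1)[unfolded L] F(1) obtain f1 where f1: "F1 = plane_point k a d f1 0"
      by (rule plane_over_line_boundary[OF a dk])
    from P(2)[unfolded L] F(2) obtain f2 where f2: "F2 = plane_point k a d f2 0"
      by (rule plane_over_line_boundary[OF a dk])
    have "0 < \<alpha>" using \<alpha> zero_le_dist[of F1 F2] by linarith
    define b where "b = \<alpha> / D"
    have "b \<noteq> 0" using \<open>0 < \<alpha>\<close> \<open>0 < D\<close> by (simp add: b_def)
    have b2: "(norm d)\<^sup>2 * b\<^sup>2 = \<alpha>\<^sup>2" using \<open>0 < D\<close> by (simp add: b_def D_def power_divide)
    have lt: "\<bar>f1 - f2\<bar> * norm d < 2 * \<alpha>" using \<alpha> unfolding f1 f2 dist_foci[OF dk] .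
    have "\<bar>f1 - f2\<bar> * norm d / (2 * \<alpha>) = sqrt (1 - flat_form Y d d / (norm d)\<^sup>2)"
      using e \<open>d \<noteq> 0\<close> unfolding f1 f2 dist_foci[OF dk] by (simp add: ecc_S_eq[OF kY] d_def)
    note arc = ellipse_arc_over[OF dk \<open>d \<noteq> 0\<close> lt this b2]
    have "\<gamma> = arc_over k a d (\<lambda>t z. dist (plane_point k a d t z) (plane_point k a d f1 0)
        + dist (plane_point k a d t z) (plane_point k a d f2 0) = 2 * \<alpha>)"
      unfolding \<gamma> C L section_vertical_plane[OF a dk] f1 f2 ..
    then have "\<gamma> = geod_curve Y k (a + ((f1 + f2) / 2 - b) *\<^sub>R d) ((1 / (2 * q * b)) *\<^sub>R d)"
      unfolding arc ellipse_arc_eq_geod_curve[OF q[unfolded q_def] \<open>b \<noteq> 0\<close>] by (simp add: q_def)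
    moreover have "(a + ((f1 + f2) / 2 - b) *\<^sub>R d) $ k = 0" using a dk by simp
    moreover have "1 / (2 * q * b) \<noteq> 0" using q \<open>b \<noteq> 0\<close> by simp
    ultimately show "0 < q \<and> (\<exists>x0 s. x0 $ k = 0 \<and> s \<noteq> 0 \<and> \<gamma> = geod_curve Y k x0 (s *\<^sub>R d))"
      using q by blast
  next
    assume "0 < q \<and> (\<exists>x0 s. x0 $ k = 0 \<and> s \<noteq> 0 \<and> \<gamma> = geod_curve Y k x0 (s *\<^sub>R d))"
    then obtain x0 s where q: "0 < q" and x0: "x0 $ k = 0" and s: "s \<noteq> 0"
      and \<gamma>: "\<gamma> = geod_curve Y k x0 (s *\<^sub>R d)" by blast
    have "d \<noteq> 0" using q by (auto simp: q_def flat_form_def)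
    then have "0 < D" by (simp add: D_def)
    define L where "L = range (\<lambda>t. x0 + t *\<^sub>R d)"
    define b where "b = 1 / (2 * q * s)"
    define \<alpha> where "\<alpha> = \<bar>b\<bar> * D"
    define r where "r = sqrt (1 - q / D\<^sup>2)"
    define F1 where "F1 = plane_point k x0 d (b + b * r) 0"
    define F2 where "F2 = plane_point k x0 d (b - b * r) 0"
    have "b \<noteq> 0" using q s by (simp add: b_def)
    then have "0 < \<alpha>" using \<open>0 < D\<close> by (simp add: \<alpha>_def)
    have "0 < q / D\<^sup>2" "q / D\<^sup>2 \<le> 1"
      using q \<open>0 < D\<close> flat_form_le_norm[of Y d] by (simp_all add: q_def D_def divide_le_eq)
    then have r: "0 \<le> r" "r < 1" by (simp_all add: r_def)
    have foc: "\<bar>(b + b * r) - (b - b * r)\<bar> * norm d = 2 * \<alpha> * r"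
      using r by (simp add: \<alpha>_def D_def abs_mult)
    have lt: "\<bar>(b + b * r) - (b - b * r)\<bar> * norm d < 2 * \<alpha>"
      unfolding foc using r \<open>0 < \<alpha>\<close> by simp
    have e: "\<bar>(b + b * r) - (b - b * r)\<bar> * norm d / (2 * \<alpha>) = sqrt (1 - flat_form Y d d / (norm d)\<^sup>2)"
      unfolding foc using \<open>0 < \<alpha>\<close> by (simp add: r_def q_def D_def)
    have b2: "(norm d)\<^sup>2 * b\<^sup>2 = \<alpha>\<^sup>2" by (simp add: \<alpha>_def D_def power_mult_distrib)
    have m: "(b + b * r + (b - b * r)) / 2 = b" by simp
    have sb: "1 / (2 * q * b) = s" using q s by (simp add: b_def)
    have "\<gamma> = arc_over k x0 d (\<lambda>t z. dist (plane_point k x0 d t z) F1 + dist (plane_point k x0 d t z) F2 = 2 * \<alpha>)"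
      unfolding F1_def F2_def ellipse_arc_over[OF dk \<open>d \<noteq> 0\<close> lt e b2] m
        ellipse_arc_eq_geod_curve[OF q[unfolded q_def] \<open>b \<noteq> 0\<close>]
      by (simp add: q_def[symmetric] sb \<gamma>)
    then have \<gamma>': "\<gamma> = {x \<in> plane_over k L. dist x F1 + dist x F2 = 2 * \<alpha>} \<inter> vertical_plane k L"
      unfolding L_def section_vertical_plane[OF x0 dk] .
    have Fk: "F1 \<in> half_space_boundary k" "F2 \<in> half_space_boundary k"
      by (simp_all add: F1_def F2_def half_space_boundary_def plane_point_nth_k[OF x0 dk])
    have "F1 \<in> plane_over k L" "F2 \<in> plane_over k L"
      unfolding L_def F1_def F2_def plane_over_line[OF x0 dk] by blast+
    moreover have "dist F1 F2 < 2 * \<alpha>" "ecc_S Y k w = dist F1 F2 / (2 * \<alpha>)"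
      using lt e \<open>d \<noteq> 0\<close> unfolding F1_def F2_def dist_foci[OF dk] by (simp_all add: ecc_S_eq[OF kY] d_def)
    ultimately have ell: "is_ellipse (plane_over k L) F1 F2 (ecc_S Y k w) {x \<in> plane_over k L. dist x F1 + dist x F2 = 2 * \<alpha>}"
      unfolding is_ellipse_def by blast
    have "horizontal_line k (horizontal k w) L"
      unfolding L_def d_def[symmetric] by (rule horizontal_lineI[OF x0 dk \<open>d \<noteq> 0\<close>])
    moreover have "norm_y Y w < norm_x Y k w" using q by (simp add: norm_x_norm_y_compare[OF kY] q_def d_def)
    ultimately show "half_ellipse_type Y k \<gamma> w"
      unfolding half_ellipse_type_def using ell \<gamma>' Fk by blast
  qed
qed

text \<open>The foci are placed as for the ellipse. Now \<open>e\<^sub>S > 1\<close>, so that \<open>b - b e\<^sub>S\<close> is the focus that the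
branch through \<open>x\<^sub>0\<close> encloses. The vertex \<open>x\<^sub>0\<close> is a point of this branch on the boundary.\<close>

lemma half_hyperbola_branch_type_iff:
  assumes kY: "k \<notin> Y"
  shows "half_hyperbola_branch_type Y k \<gamma> w \<longleftrightarrow>
    flat_form Y (horizontal k w) (horizontal k w) < 0 \<and>
    (\<exists>x0 s. x0 $ k = 0 \<and> s \<noteq> 0 \<and> \<gamma> = geod_curve Y k x0 (s *\<^sub>R horizontal k w))"
proof -
  define d where "d = horizontal k w"
  define q where "q = flat_form Y d d"
  define D where "D = norm d"
  have dk: "d $ k = 0" by (simp add: d_def horizontal_nth)
  show ?thesis
    unfolding d_def[symmetric] q_def[symmetric]
  proof (rule iffI)
    assume type: "half_hyperbola_branch_type Y k \<gamma> w"
    then have q: "q < 0"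
      by (simp add: half_hyperbola_branch_type_def norm_x_norm_y_compare[OF kY] q_def d_def)
    from type obtain L C F1 F2 where L: "horizontal_line k d L"
      and F: "F1 $ k = 0" "F2 $ k = 0" and hyp: "is_hyperbola_branch (plane_over k L) F1 F2 (ecc_S Y k w) C"
      and \<gamma>: "\<gamma> = C \<inter> vertical_plane k L"
      unfolding half_hyperbola_branch_type_def half_space_boundary_def d_def by blast
    from L obtain a where a: "a $ k = 0" and "d \<noteq> 0" and L: "L = range (\<lambda>t. a + t *\<^sub>R d)"
      by (rule horizontal_lineE)
    have "0 < D" using \<open>d \<noteq> 0\<close> by (simp add: D_def)
    from hyp obtain \<alpha> where P: "F1 \<in> plane_over k L" "F2 \<in> plane_over k L"
      and \<alpha>: "0 < 2 * \<alpha>" "2 * \<alpha> < dist F1 F2" and e: "ecc_S Y k w = dist F1 F2 / (2 * \<alpha>)"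
      and C: "C = {x \<in> plane_over k L. dist x F1 - dist x F2 = 2 * \<alpha>}"
      unfolding is_hyperbola_branch_def by blast
    from P(1)[unfolded L] F(1) obtain f1 where f1: "F1 = plane_point k a d f1 0"
      by (rule plane_over_line_boundary[OF a dk])
    from P(2)[unfolded L] F(2) obtain f2 where f2: "F2 = plane_point k a d f2 0"
      by (rule plane_over_line_boundary[OF a dk])
    have "0 < \<alpha>" using \<alpha> by simp
    have lt: "2 * \<alpha> < \<bar>f1 - f2\<bar> * norm d" using \<alpha>(2) unfolding f1 f2 dist_foci[OF dk] .
    \<comment> \<open>the vertex \<open>m - b\<close> of the branch lies between the center and the second focus\<close>
    define b where "b = sgn (f1 - f2) * \<alpha> / D"
    have "f1 \<noteq> f2" using lt \<open>0 < \<alpha>\<close> by auto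
    then have b: "b * (f2 - f1) < 0" using \<open>0 < \<alpha>\<close> \<open>0 < D\<close>
      by (auto simp: b_def sgn_if divide_less_0_iff mult_less_0_iff)
    have b2: "(norm d)\<^sup>2 * b\<^sup>2 = \<alpha>\<^sup>2" using \<open>0 < D\<close> \<open>f1 \<noteq> f2\<close>
      by (simp add: b_def D_def power_divide sgn_if)
    have "\<bar>f1 - f2\<bar> * norm d / (2 * \<alpha>) = sqrt (1 - flat_form Y d d / (norm d)\<^sup>2)"
      using e \<open>d \<noteq> 0\<close> unfolding f1 f2 dist_foci[OF dk] by (simp add: ecc_S_eq[OF kY] d_def)
    note arc = hyperbola_arc_over[OF dk \<open>d \<noteq> 0\<close> \<open>0 < \<alpha>\<close> lt this b2]
    have "\<gamma> = arc_over k a d (\<lambda>t z. dist (plane_point k a d t z) (plane_point k a d f1 0)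
        - dist (plane_point k a d t z) (plane_point k a d f2 0) = 2 * \<alpha>)"
      unfolding \<gamma> C L section_vertical_plane[OF a dk] f1 f2 ..
    then have "\<gamma> = geod_curve Y k (a + ((f1 + f2) / 2 - b) *\<^sub>R d) ((1 / (2 * q * b)) *\<^sub>R d)"
      unfolding arc hyperbola_arc_eq_geod_curve[OF q[unfolded q_def] b] by (simp add: q_def)
    moreover have "(a + ((f1 + f2) / 2 - b) *\<^sub>R d) $ k = 0" using a dk by simp
    moreover have "1 / (2 * q * b) \<noteq> 0" using q b by auto
    ultimately show "q < 0 \<and> (\<exists>x0 s. x0 $ k = 0 \<and> s \<noteq> 0 \<and> \<gamma> = geod_curve Y k x0 (s *\<^sub>R d))"
      using q by blast
  next
    assume "q < 0 \<and> (\<exists>x0 s. x0 $ k = 0 \<and> s \<noteq> 0 \<and> \<gamma> = geod_curve Y k x0 (s *\<^sub>R d))"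
    then obtain x0 s where q: "q < 0" and x0: "x0 $ k = 0" and s: "s \<noteq> 0"
      and \<gamma>: "\<gamma> = geod_curve Y k x0 (s *\<^sub>R d)" by blast
    have "d \<noteq> 0" using q by (auto simp: q_def flat_form_def)
    then have "0 < D" by (simp add: D_def)
    define L where "L = range (\<lambda>t. x0 + t *\<^sub>R d)"
    define b where "b = 1 / (2 * q * s)"
    define \<alpha> where "\<alpha> = \<bar>b\<bar> * D"
    define r where "r = sqrt (1 - q / D\<^sup>2)"
    define F1 where "F1 = plane_point k x0 d (b + b * r) 0"
    define F2 where "F2 = plane_point k x0 d (b - b * r) 0"
    have "b \<noteq> 0" using q s by (simp add: b_def)
    then have "0 < \<alpha>" using \<open>0 < D\<close> by (simp add: \<alpha>_def)
    have "q / D\<^sup>2 < 0" using q \<open>0 < D\<close> by (simp add: divide_neg_pos)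
    then have r: "1 < r" by (simp add: r_def)
    have foc: "\<bar>(b + b * r) - (b - b * r)\<bar> * norm d = 2 * \<alpha> * r"
      using r by (simp add: \<alpha>_def D_def abs_mult)
    have lt: "2 * \<alpha> < \<bar>(b + b * r) - (b - b * r)\<bar> * norm d"
      unfolding foc using r \<open>0 < \<alpha>\<close> by simp
    have e: "\<bar>(b + b * r) - (b - b * r)\<bar> * norm d / (2 * \<alpha>) = sqrt (1 - flat_form Y d d / (norm d)\<^sup>2)"
      unfolding foc using \<open>0 < \<alpha>\<close> by (simp add: r_def q_def D_def)
    have b2: "(norm d)\<^sup>2 * b\<^sup>2 = \<alpha>\<^sup>2" by (simp add: \<alpha>_def D_def power_mult_distrib)
    have m: "(b + b * r + (b - b * r)) / 2 = b" by simp
    have sb: "1 / (2 * q * b) = s" using q s by (simp add: b_def)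
    have side: "b * ((b - b * r) - (b + b * r)) < 0"
    proof -
      have "b * ((b - b * r) - (b + b * r)) = - (2 * r * b\<^sup>2)" by (simp add: power2_eq_square algebra_simps)
      moreover have "0 < 2 * r * b\<^sup>2" using r \<open>b \<noteq> 0\<close> by simp
      ultimately show ?thesis by linarith
    qed
    have "\<gamma> = arc_over k x0 d (\<lambda>t z. dist (plane_point k x0 d t z) F1 - dist (plane_point k x0 d t z) F2 = 2 * \<alpha>)"
      unfolding F1_def F2_def hyperbola_arc_over[OF dk \<open>d \<noteq> 0\<close> \<open>0 < \<alpha>\<close> lt e b2] m
        hyperbola_arc_eq_geod_curve[OF q[unfolded q_def] side]
      by (simp add: q_def[symmetric] sb \<gamma>)
    then have \<gamma>': "\<gamma> = {x \<in> plane_over k L. dist x F1 - dist x F2 = 2 * \<alpha>} \<inter> vertical_plane k L"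
      unfolding L_def section_vertical_plane[OF x0 dk] .
    have Fk: "F1 \<in> half_space_boundary k" "F2 \<in> half_space_boundary k"
      by (simp_all add: F1_def F2_def half_space_boundary_def plane_point_nth_k[OF x0 dk])
    have "F1 \<in> plane_over k L" "F2 \<in> plane_over k L"
      unfolding L_def F1_def F2_def plane_over_line[OF x0 dk] by blast+
    moreover have "2 * \<alpha> < dist F1 F2" "ecc_S Y k w = dist F1 F2 / (2 * \<alpha>)" "0 < 2 * \<alpha>"
      using lt e \<open>d \<noteq> 0\<close> \<open>0 < \<alpha>\<close> unfolding F1_def F2_def dist_foci[OF dk] by (simp_all add: ecc_S_eq[OF kY] d_def)
    ultimately have hyp: "is_hyperbola_branch (plane_over k L) F1 F2 (ecc_S Y k w)
        {x \<in> plane_over k L. dist x F1 - dist x F2 = 2 * \<alpha>}"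
      unfolding is_hyperbola_branch_def by blast
    have vertex: "plane_point k x0 d 0 0
        \<in> {x \<in> plane_over k L. dist x F1 - dist x F2 = 2 * \<alpha>} \<inter> half_space_boundary k"
    proof -
      have "\<bar>b + b * r\<bar> = \<bar>b\<bar> * (1 + r)" "\<bar>b - b * r\<bar> = \<bar>b\<bar> * (r - 1)"
        using r abs_mult[of b "1 + r"] abs_mult[of b "1 - r"] by (simp_all add: algebra_simps)
      then have "D * \<bar>b + b * r\<bar> - D * \<bar>b - b * r\<bar> = D * (\<bar>b\<bar> * (1 + r)) - D * (\<bar>b\<bar> * (r - 1))"
        by (simp only:)
      also have "\<dots> = 2 * \<alpha>" by (simp add: \<alpha>_def algebra_simps)
      finally have "D * \<bar>b + b * r\<bar> - D * \<bar>b - b * r\<bar> = 2 * \<alpha>" .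
      moreover have "\<bar>- b - b * r\<bar> = \<bar>b + b * r\<bar>" "\<bar>b * r - b\<bar> = \<bar>b - b * r\<bar>" by linarith+
      ultimately have "dist (plane_point k x0 d 0 0) F1 - dist (plane_point k x0 d 0 0) F2 = 2 * \<alpha>"
        unfolding F1_def F2_def dist_plane_point[OF dk] using \<open>0 < D\<close> by (simp add: abs_mult D_def[symmetric])
      moreover have "plane_point k x0 d 0 0 \<in> plane_over k L"
        unfolding L_def plane_over_line[OF x0 dk] by blast
      ultimately show ?thesis
        by (simp add: half_space_boundary_def plane_point_nth_k[OF x0 dk])
    qed
    have "horizontal_line k (horizontal k w) L"
      unfolding L_def d_def[symmetric] by (rule horizontal_lineI[OF x0 dk \<open>d \<noteq> 0\<close>])
    moreover have "norm_x Y k w < norm_y Y w" using q by (simp add: norm_x_norm_y_compare[OF kY] q_def d_def)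
    ultimately show "half_hyperbola_branch_type Y k \<gamma> w"
      unfolding half_hyperbola_branch_type_def using hyp \<gamma>' Fk vertex by blast
  qed
qed

section \<open>Half parabolas and vertical lines\<close>

lemma vertical_line_affine:
  assumes "d $ k = 0"
  shows "affine (range (plane_point k a d g))" and "aff_dim (range (plane_point k a d g)) = 1"
proof -
  have eq: "range (plane_point k a d g) = affine hull {plane_point k a d g 0, plane_point k a d g 1}"
  proof (intro equalityI subsetI)
    fix x assume "x \<in> range (plane_point k a d g)"
    then obtain z where x: "x = plane_point k a d g z" by blast
    have "x = (1 - z) *\<^sub>R plane_point k a d g 0 + z *\<^sub>R plane_point k a d g 1"
      by (simp add: x plane_point_def algebra_simps)
    then show "x \<in> affine hull {plane_point k a d g 0, plane_point k a d g 1}"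
      unfolding affine_hull_2 by (intro CollectI exI[of _ "1 - z"] exI[of _ z]) simp
  next
    fix x assume "x \<in> affine hull {plane_point k a d g 0, plane_point k a d g 1}"
    then obtain u z where u: "u + z = 1" and x: "x = u *\<^sub>R plane_point k a d g 0 + z *\<^sub>R plane_point k a d g 1"
      unfolding affine_hull_2 by blast
    have "x = (u + z) *\<^sub>R plane_point k a d g 0 + z *\<^sub>R axis k 1"
      by (simp add: x plane_point_def algebra_simps)
    then have "x = plane_point k a d g z" unfolding u by (simp add: plane_point_def)
    then show "x \<in> range (plane_point k a d g)" by blast
  qed
  have "plane_point k a d g 0 \<noteq> plane_point k a d g 1"
    by (simp add: plane_point_def axis_eq_0_iff)
  then show "affine (range (plane_point k a d g))" "aff_dim (range (plane_point k a d g)) = 1"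
    unfolding eq by simp_all
qed

lemma infdist_vertical_line:
  assumes "d $ k = 0"
  shows "infdist (plane_point k a d t z) (range (plane_point k a d g)) = norm d * \<bar>t - g\<bar>"
proof (rule antisym)
  have "plane_point k a d g z \<in> range (plane_point k a d g)" by blast
  from infdist_le[OF this, of "plane_point k a d t z"]
  show "infdist (plane_point k a d t z) (range (plane_point k a d g)) \<le> norm d * \<bar>t - g\<bar>"
    by (simp add: dist_plane_point[OF assms] abs_mult)
  have "norm d * \<bar>t - g\<bar> \<le> dist (plane_point k a d t z) (plane_point k a d g z')" for z'
  proof -
    have "norm d * \<bar>t - g\<bar> = sqrt ((norm d * (t - g))\<^sup>2)" by (simp add: abs_mult)
    also have "\<dots> \<le> sqrt ((norm d * (t - g))\<^sup>2 + (z - z')\<^sup>2)" by simp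
    finally show ?thesis by (simp add: dist_plane_point[OF assms])
  qed
  then show "norm d * \<bar>t - g\<bar> \<le> infdist (plane_point k a d t z) (range (plane_point k a d g))"
    unfolding infdist_def by (auto intro!: cINF_greatest)
qed

lemma closest_point_vertical_line:
  assumes "d $ k = 0"
  shows "closest_point (range (plane_point k a d g)) (plane_point k a d f 0) = plane_point k a d g 0"
proof (rule closest_point_unique[symmetric])
  show "convex (range (plane_point k a d g))" "closed (range (plane_point k a d g))"
    using vertical_line_affine(1)[OF assms] by (simp_all add: affine_imp_convex affine_closed)
  show "\<forall>y\<in>range (plane_point k a d g). dist (plane_point k a d f 0) (plane_point k a d g 0) \<le> dist (plane_point k a d f 0) y"
    by (auto simp: dist_plane_point[OF assms])
qed auto

text \<open>The line \<open>D\<close> lies in the plane and is orthogonal to the segment from its closest point to the focus.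
That segment is horizontal because the focus and its midpoint with the closest point, the vertex, are on
the boundary. Orthogonality is obtained by applying the obtuse angle criterion for closest points to
\<open>y\<close> and to its reflection, which both belong to the affine set \<open>D\<close>.\<close>

lemma directrix_vertical:
  assumes a: "a $ k = 0" and dk: "d $ k = 0" and "d \<noteq> 0"
    and D: "affine D" "aff_dim D = 1" "D \<subseteq> plane_over k (range (\<lambda>t. a + t *\<^sub>R d))"
    and F: "plane_point k a d f 0 \<notin> D"
    and V: "midpoint (plane_point k a d f 0) (closest_point D (plane_point k a d f 0)) $ k = 0"
  obtains g where "g \<noteq> f" and "D = range (plane_point k a d g)"
proof -
  let ?F = "plane_point k a d f 0"
  let ?c = "closest_point D ?F"
  have "D \<noteq> {}" using D(2) by auto
  have conv: "convex D" "closed D" using D(1) by (simp_all add: affine_imp_convex affine_closed)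
  have c: "?c \<in> D" using conv(2) \<open>D \<noteq> {}\<close> by (rule closest_point_in_set)
  have "?c $ k = 0"
    using V plane_point_nth_k[OF a dk, of f 0] by (simp add: midpoint_def)
  with c D(3) obtain g where g: "?c = plane_point k a d g 0"
    using plane_over_line_boundary[OF a dk] by blast
  have "g \<noteq> f" using F c g by auto
  have "D \<subseteq> range (plane_point k a d g)"
  proof
    fix y assume "y \<in> D"
    then obtain t z where y: "y = plane_point k a d t z" using D(3) unfolding plane_over_line[OF a dk] by blast
    have "2 *\<^sub>R ?c - y \<in> D"
      using mem_affine[OF D(1) c \<open>y \<in> D\<close>, of 2 "- 1"] by simp
    from closest_point_dot[OF conv this, of ?F] closest_point_dot[OF conv \<open>y \<in> D\<close>, of ?F]
    have "(?F - ?c) \<bullet> (y - ?c) = 0"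
      by (simp add: inner_diff_right scaleR_2 inner_add_right)
    moreover have "?F - ?c = (f - g) *\<^sub>R d" "y - ?c = (t - g) *\<^sub>R d + z *\<^sub>R axis k 1"
      unfolding g y by (simp_all add: plane_point_def algebra_simps)
    moreover have "d \<bullet> axis k 1 = 0" using dk by (simp add: inner_axis)
    ultimately have "t = g" using \<open>g \<noteq> f\<close> \<open>d \<noteq> 0\<close> by (simp add: inner_add_right)
    then show "y \<in> range (plane_point k a d g)" by (simp add: y)
  qed
  then have "D = range (plane_point k a d g)"
    using D(1,2) vertical_line_affine[OF dk, of a g] \<open>D \<noteq> {}\<close> by (intro affine_dim_equal) auto
  with \<open>g \<noteq> f\<close> that show thesis by blast
qed

text \<open>The square \<open>t\<^sup>2\<close> cancels between the squared distances to the focus and to the directrix.\<close>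

lemma parabola_arc_eq_geod_curve:
  assumes dk: "d $ k = 0" and "d \<noteq> 0" and "g \<noteq> f" and q: "flat_form Y d d = 0"
  shows "arc_over k a d (\<lambda>t z. dist (plane_point k a d t z) (plane_point k a d f 0)
      = infdist (plane_point k a d t z) (range (plane_point k a d g)))
    = geod_curve Y k (a + ((f + g) / 2) *\<^sub>R d) ((1 / (2 * (norm d)\<^sup>2 * (f - g))) *\<^sub>R d)"
proof -
  let ?s = "1 / (2 * (norm d)\<^sup>2 * (f - g))"
  have "?s \<noteq> 0" using assms by simp
  have "arc_over k a d (\<lambda>t z. dist (plane_point k a d t z) (plane_point k a d f 0)
      = infdist (plane_point k a d t z) (range (plane_point k a d g)))
    = arc_over k a d (\<lambda>t z. 0 < (t - (f + g) / 2) / ?s \<and> z\<^sup>2 = (t - (f + g) / 2) / ?s - 0 * (t - (f + g) / 2)\<^sup>2)"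
  proof (rule arc_over_cong)
    fix t z :: real assume "0 < z"
    have "dist (plane_point k a d t z) (plane_point k a d f 0)
        = infdist (plane_point k a d t z) (range (plane_point k a d g))
      \<longleftrightarrow> sqrt ((norm d * (t - f))\<^sup>2 + z\<^sup>2) = sqrt ((norm d * (t - g))\<^sup>2)"
      by (simp add: dist_plane_point[OF dk] infdist_vertical_line[OF dk] abs_mult)
    also have "\<dots> \<longleftrightarrow> (norm d * (t - f))\<^sup>2 + z\<^sup>2 = (norm d * (t - g))\<^sup>2" by (rule real_sqrt_eq_iff)
    also have "\<dots> \<longleftrightarrow> z\<^sup>2 = (t - (f + g) / 2) / ?s"
      by (auto simp: power2_eq_square field_simps)
    also have "\<dots> \<longleftrightarrow> 0 < (t - (f + g) / 2) / ?s \<and> z\<^sup>2 = (t - (f + g) / 2) / ?s - 0 * (t - (f + g) / 2)\<^sup>2"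
    proof -
      have "z\<^sup>2 = B \<longleftrightarrow> 0 < B \<and> z\<^sup>2 = B - 0 * C" for B C :: real
        using zero_less_power[OF \<open>0 < z\<close>, of 2] by auto
      then show ?thesis .
    qed
    finally show "dist (plane_point k a d t z) (plane_point k a d f 0)
        = infdist (plane_point k a d t z) (range (plane_point k a d g))
      \<longleftrightarrow> 0 < (t - (f + g) / 2) / ?s \<and> z\<^sup>2 = (t - (f + g) / 2) / ?s - 0 * (t - (f + g) / 2)\<^sup>2" .
  qed
  then show ?thesis
    unfolding geod_curve_arc_over[OF \<open>?s \<noteq> 0\<close>] arc_over_shift q .
qed

text \<open>With vertex \<open>x\<^sub>0\<close>, focus at \<open>f\<close> and directrix at \<open>- f\<close>, the equation of the parabola is
\<open>z\<^sup>2 = 4 \<parallel>d\<parallel>\<^sup>2 f t\<close>; comparison with \<open>z\<^sup>2 = t / s\<close> gives \<open>f\<close>.\<close>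

lemma half_parabola_type_iff:
  assumes kY: "k \<notin> Y"
  shows "half_parabola_type Y k \<gamma> w \<longleftrightarrow>
    horizontal k w \<noteq> 0 \<and> flat_form Y (horizontal k w) (horizontal k w) = 0 \<and>
    (\<exists>x0 s. x0 $ k = 0 \<and> s \<noteq> 0 \<and> \<gamma> = geod_curve Y k x0 (s *\<^sub>R horizontal k w))"
proof -
  define d where "d = horizontal k w"
  have dk: "d $ k = 0" by (simp add: d_def horizontal_nth)
  show ?thesis
    unfolding d_def[symmetric]
  proof (rule iffI)
    assume type: "half_parabola_type Y k \<gamma> w"
    then have q: "flat_form Y d d = 0"
      by (simp add: half_parabola_type_def norm_x_norm_y_compare[OF kY] d_def)
    from type obtain L C F V where L: "horizontal_line k d L"
      and FV: "F $ k = 0" "V $ k = 0" and par: "is_parabola (plane_over k L) F V C"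
      and \<gamma>: "\<gamma> = C \<inter> vertical_plane k L"
      unfolding half_parabola_type_def half_space_boundary_def d_def by blast
    from L obtain a where a: "a $ k = 0" and "d \<noteq> 0" and L: "L = range (\<lambda>t. a + t *\<^sub>R d)"
      by (rule horizontal_lineE)
    from par obtain D where P: "F \<in> plane_over k L" and D: "affine D" "aff_dim D = 1" "D \<subseteq> plane_over k L" "F \<notin> D"
      and V: "V = midpoint F (closest_point D F)" and C: "C = {x \<in> plane_over k L. dist x F = infdist x D}"
      unfolding is_parabola_def by blast
    from P[unfolded L] FV(1) obtain f where f: "F = plane_point k a d f 0"
      by (rule plane_over_line_boundary[OF a dk])
    from directrix_vertical[OF a dk \<open>d \<noteq> 0\<close> D(1,2) D(3)[unfolded L] D(4)[unfolded f] FV(2)[unfolded V f]]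
    obtain g where g: "g \<noteq> f" "D = range (plane_point k a d g)" .
    have "\<gamma> = geod_curve Y k (a + ((f + g) / 2) *\<^sub>R d) ((1 / (2 * (norm d)\<^sup>2 * (f - g))) *\<^sub>R d)"
      unfolding \<gamma> C L section_vertical_plane[OF a dk] f g(2)
      by (rule parabola_arc_eq_geod_curve[OF dk \<open>d \<noteq> 0\<close> g(1) q])
    moreover have "(a + ((f + g) / 2) *\<^sub>R d) $ k = 0" using a dk by simp
    moreover have "1 / (2 * (norm d)\<^sup>2 * (f - g)) \<noteq> 0" using g \<open>d \<noteq> 0\<close> by simp
    ultimately show "d \<noteq> 0 \<and> flat_form Y d d = 0 \<and>
        (\<exists>x0 s. x0 $ k = 0 \<and> s \<noteq> 0 \<and> \<gamma> = geod_curve Y k x0 (s *\<^sub>R d))"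
      using q \<open>d \<noteq> 0\<close> by blast
  next
    assume "d \<noteq> 0 \<and> flat_form Y d d = 0 \<and>
        (\<exists>x0 s. x0 $ k = 0 \<and> s \<noteq> 0 \<and> \<gamma> = geod_curve Y k x0 (s *\<^sub>R d))"
    then obtain x0 s where "d \<noteq> 0" and q: "flat_form Y d d = 0" and x0: "x0 $ k = 0" and s: "s \<noteq> 0"
      and \<gamma>: "\<gamma> = geod_curve Y k x0 (s *\<^sub>R d)" by blast
    define L where "L = range (\<lambda>t. x0 + t *\<^sub>R d)"
    define f where "f = 1 / (4 * (norm d)\<^sup>2 * s)"
    define F where "F = plane_point k x0 d f 0"
    define D where "D = range (plane_point k x0 d (- f))"
    have "f \<noteq> 0" using s \<open>d \<noteq> 0\<close> by (simp add: f_def)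
    then have "- f \<noteq> f" by simp
    have fs: "1 / (2 * (norm d)\<^sup>2 * (f - - f)) = s" using s \<open>d \<noteq> 0\<close> by (simp add: f_def)
    have "\<gamma> = arc_over k x0 d (\<lambda>t z. dist (plane_point k x0 d t z) F = infdist (plane_point k x0 d t z) D)"
      unfolding F_def D_def parabola_arc_eq_geod_curve[OF dk \<open>d \<noteq> 0\<close> \<open>- f \<noteq> f\<close> q] fs by (simp add: \<gamma>)
    then have \<gamma>': "\<gamma> = {x \<in> plane_over k L. dist x F = infdist x D} \<inter> vertical_plane k L"
      unfolding L_def section_vertical_plane[OF x0 dk] .
    have "midpoint F (closest_point D F) = x0"
      unfolding F_def D_def closest_point_vertical_line[OF dk]
      by (simp add: plane_point_def midpoint_def scaleR_2[symmetric])
    moreover have "F \<in> plane_over k L" "D \<subseteq> plane_over k L"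
      unfolding L_def F_def D_def plane_over_line[OF x0 dk] by blast+
    moreover have "F \<notin> D"
    proof
      assume "F \<in> D"
      then have "infdist F D = 0" by simp
      then show False
        using \<open>f \<noteq> 0\<close> \<open>d \<noteq> 0\<close> unfolding F_def D_def infdist_vertical_line[OF dk] by simp
    qed
    ultimately have par: "is_parabola (plane_over k L) F x0 {x \<in> plane_over k L. dist x F = infdist x D}"
      unfolding is_parabola_def using vertical_line_affine[OF dk, of x0 "- f"]
      by (intro conjI exI[of _ D]) (simp_all add: D_def)
    have "F \<in> half_space_boundary k" "x0 \<in> half_space_boundary k"
      using x0 by (simp_all add: F_def half_space_boundary_def plane_point_nth_k[OF x0 dk])
    moreover have "horizontal_line k (horizontal k w) L"
      unfolding L_def d_def[symmetric] by (rule horizontal_lineI[OF x0 dk \<open>d \<noteq> 0\<close>])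
    moreover have "norm_x Y k w = norm_y Y w" using q by (simp add: norm_x_norm_y_compare[OF kY] d_def)
    ultimately show "half_parabola_type Y k \<gamma> w"
      unfolding half_parabola_type_def using par \<gamma>' by blast
  qed
qed

lemma vertical_half_line_iff:
  "vertical_half_line k \<gamma> \<longleftrightarrow> (\<exists>x0. x0 $ k = 0 \<and> \<gamma> = geod_curve Y k x0 0)"
proof -
  have "geod_curve Y k x0 0 = (\<lambda>z. x0 + z *\<^sub>R axis k 1) ` {0<..}" for x0
  proof (intro equalityI subsetI)
    fix x assume "x \<in> (\<lambda>z. x0 + z *\<^sub>R axis k 1) ` {0<..}"
    then obtain z where "0 < z" "x = x0 + z *\<^sub>R axis k 1" by auto
    then show "x \<in> geod_curve Y k x0 0"
      unfolding geod_curve_def by (intro CollectI exI[of _ "z\<^sup>2"] exI[of _ z]) (simp add: flat_form_def)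
  qed (auto simp: geod_curve_def)
  then show ?thesis by (auto simp: vertical_half_line_def half_space_boundary_def)
qed

section \<open>Tangent vectors and the types\<close>

lemma tangent_vector_geod_curve_horizontal:
  assumes x0: "x0 $ k = 0" and \<eta>: "\<eta> $ k = 0" and "tangent_vector (geod_curve Y k x0 \<eta>) w"
  obtains s where "s \<noteq> 0" and "horizontal k w = s *\<^sub>R \<eta>"
proof -
  from assms(3) obtain c e where "w \<noteq> 0" "0 < e" and c: "\<And>t. \<bar>t\<bar> < e \<Longrightarrow> c t \<in> geod_curve Y k x0 \<eta>"
    and w: "(c has_vector_derivative w) (at (0::real))"
    unfolding tangent_vector_def by blast
  let ?J = "{- e<..<e}"
  have J: "open ?J" "0 \<in> ?J" "c ` ?J \<subseteq> geod_curve Y k x0 \<eta>" using \<open>0 < e\<close> c by (auto simp: abs_less_iff)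
  have "c 0 \<in> geod_curve Y k x0 \<eta>" using c \<open>0 < e\<close> by simp
  then obtain \<tau>0 where \<tau>0: "\<tau>0 \<in> geod_dom (flat_form Y \<eta> \<eta>)" "c 0 = geod Y k x0 \<eta> \<tau>0"
    unfolding geod_image[symmetric] by blast
  from tangent_of_geod_curve[OF x0 \<eta> \<tau>0(1) J(1,2,3) \<tau>0(2) w]
  obtain \<rho> where \<rho>: "w = \<rho> *\<^sub>R geod_vel Y k \<eta> \<tau>0" ..
  then have "\<rho> \<noteq> 0" using \<open>w \<noteq> 0\<close> by auto
  let ?S = "recip_height (flat_form Y \<eta> \<eta>) \<tau>0"
  have "?S \<noteq> 0" using \<tau>0(1) by (simp add: geod_dom_def)
  have "horizontal k w = (\<rho> * (- 2 / ?S\<^sup>2)) *\<^sub>R \<eta>"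
    using \<eta> by (simp add: \<rho> geod_vel_def vec_eq_iff horizontal_def axis_def)
  moreover have "\<rho> * (- 2 / ?S\<^sup>2) \<noteq> 0" using \<open>\<rho> \<noteq> 0\<close> \<open>?S \<noteq> 0\<close> by simp
  ultimately show thesis using that by blast
qed

lemma geod_curve_tangent_vector_exists:
  assumes kY: "k \<notin> Y" and x0: "x0 $ k = 0" and \<eta>: "\<eta> $ k = 0"
  shows "\<exists>w. tangent_vector (geod_curve Y k x0 \<eta>) w"
proof -
  let ?B = "flat_form Y \<eta> \<eta>"
  let ?\<tau> = "\<bar>?B\<bar>"
  let ?J = "{t. 1 * t + ?\<tau> \<in> geod_dom ?B}"
  have dom: "?\<tau> \<in> geod_dom ?B" by (rule geod_dom_nonempty)
  have "open ?J" using geod_geodesic_on[OF kY x0 \<eta>, of 1 ?\<tau>] by (simp add: geodesic_on_def)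
  moreover have "0 \<in> ?J" using dom by simp
  ultimately obtain e where "0 < e" and e: "ball 0 e \<subseteq> ?J" by (rule openE)
  have "geod_vel Y k \<eta> ?\<tau> \<noteq> 0"
  proof
    assume "geod_vel Y k \<eta> ?\<tau> = 0"
    then have "1 / (recip_height ?B ?\<tau>)\<^sup>2 = 0"
      using flat_form_geod_vel[OF kY \<eta> dom] by (simp add: flat_form_def)
    then show False using dom by (simp add: geod_dom_def)
  qed
  moreover have "geod Y k x0 \<eta> (t + ?\<tau>) \<in> geod_curve Y k x0 \<eta>" if "\<bar>t\<bar> < e" for t
  proof -
    have "t \<in> ?J" using e that by (auto simp: subset_iff)
    then show ?thesis unfolding geod_image[symmetric] by simp
  qed
  moreover have "((\<lambda>t. geod Y k x0 \<eta> (t + ?\<tau>)) has_vector_derivative geod_vel Y k \<eta> ?\<tau>) (at 0)"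
  proof -
    have shift: "((\<lambda>t. t + ?\<tau>) has_vector_derivative 1) (at 0)"
      by (auto intro!: derivative_eq_intros)
    show ?thesis
      using vector_diff_chain_at[OF shift, of "geod Y k x0 \<eta>"] geod_has_vector_derivative[OF dom]
      by (simp add: o_def)
  qed
  ultimately have "tangent_vector (geod_curve Y k x0 \<eta>) (geod_vel Y k \<eta> ?\<tau>)"
    unfolding tangent_vector_def using \<open>0 < e\<close>
    by (intro conjI exI[of _ "\<lambda>t. geod Y k x0 \<eta> (t + ?\<tau>)"] exI[of _ e]) simp_all
  then show ?thesis ..
qed

text \<open>The horizontal part of \<open>w\<close> is a nonzero multiple of \<open>\<eta>\<close>, so \<open>w\<close> may replace \<open>\<eta>\<close> as the direction of
the vertical plane, and the sign of \<open>q\<close> decides between the three conics.\<close>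

lemma geod_curve_of_listed_type:
  assumes kY: "k \<notin> Y" and x0: "x0 $ k = 0" and \<eta>: "\<eta> $ k = 0"
    and w: "tangent_vector (geod_curve Y k x0 \<eta>) w"
  shows "of_listed_type Y k (geod_curve Y k x0 \<eta>) w"
proof (cases "\<eta> = 0")
  case True
  then show ?thesis using x0 by (auto simp: of_listed_type_def vertical_half_line_iff[where Y = Y])
next
  case False
  from w obtain s where "s \<noteq> 0" and hw: "horizontal k w = s *\<^sub>R \<eta>"
    by (rule tangent_vector_geod_curve_horizontal[OF x0 \<eta>])
  then have "\<eta> = (1 / s) *\<^sub>R horizontal k w" and "1 / s \<noteq> 0" by simp_all
  then have "\<exists>x0' s. x0' $ k = 0 \<and> s \<noteq> 0 \<and> geod_curve Y k x0 \<eta> = geod_curve Y k x0' (s *\<^sub>R horizontal k w)"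
    using x0 by metis
  moreover have "horizontal k w \<noteq> 0" using hw \<open>s \<noteq> 0\<close> False by simp
  ultimately show ?thesis
    unfolding of_listed_type_def half_ellipse_type_iff[OF kY] half_parabola_type_iff[OF kY]
      half_hyperbola_branch_type_iff[OF kY]
    using linorder_less_linear[of 0 "flat_form Y (horizontal k w) (horizontal k w)"] by metis
qed

lemma nonhyperbolic_type_geod_curve:
  assumes kY: "k \<notin> Y" and "vertical_half_line k \<gamma> \<or> half_ellipse_type Y k \<gamma> w \<or> half_parabola_type Y k \<gamma> w"
  obtains x0 \<eta> where "x0 $ k = 0" and "\<eta> $ k = 0" and "0 \<le> flat_form Y \<eta> \<eta>" and "\<gamma> = geod_curve Y k x0 \<eta>"
  using assms(2)
proof (elim disjE)
  assume "vertical_half_line k \<gamma>"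
  then show thesis using that[of _ 0] by (auto simp: vertical_half_line_iff[where Y = Y] flat_form_def)
next
  assume "half_ellipse_type Y k \<gamma> w"
  then obtain x0 s where "0 < flat_form Y (horizontal k w) (horizontal k w)" "x0 $ k = 0"
    "\<gamma> = geod_curve Y k x0 (s *\<^sub>R horizontal k w)"
    unfolding half_ellipse_type_iff[OF kY] by blast
  then show thesis using that[of x0 "s *\<^sub>R horizontal k w"]
    by (simp add: horizontal_nth flat_form_scaleR)
next
  assume "half_parabola_type Y k \<gamma> w"
  then obtain x0 s where "flat_form Y (horizontal k w) (horizontal k w) = 0" "x0 $ k = 0"
    "\<gamma> = geod_curve Y k x0 (s *\<^sub>R horizontal k w)"
    unfolding half_parabola_type_iff[OF kY] by blast
  then show thesis using that[of x0 "s *\<^sub>R horizontal k w"]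
    by (simp add: horizontal_nth flat_form_linear)
qed

lemma hyperbolic_type_geod_curve:
  assumes kY: "k \<notin> Y" and "half_hyperbola_branch_type Y k \<gamma> w"
  obtains x0 \<eta> where "x0 $ k = 0" and "\<eta> $ k = 0" and "flat_form Y \<eta> \<eta> < 0" and "\<gamma> = geod_curve Y k x0 \<eta>"
proof -
  from assms(2) obtain x0 s where "flat_form Y (horizontal k w) (horizontal k w) < 0" "x0 $ k = 0" "s \<noteq> 0"
    "\<gamma> = geod_curve Y k x0 (s *\<^sub>R horizontal k w)"
    unfolding half_hyperbola_branch_type_iff[OF kY] by blast
  then show thesis using that[of x0 "s *\<^sub>R horizontal k w"]
    by (simp add: horizontal_nth flat_form_scaleR mult_pos_neg)
qed

section \<open>Ends of geodesics\<close>

text \<open>The end \<open>t \<rightarrow> \<infinity>\<close> of the normal form, at which it approaches the boundary point \<open>x\<^sub>0\<close>.\<close>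

definition lower_end :: "'n::finite set \<Rightarrow> 'n \<Rightarrow> real^'n \<Rightarrow> real^'n \<Rightarrow> (real^'n) filter" where
  "lower_end Y k x0 \<eta> = (INF \<sigma>\<in>geod_dom (flat_form Y \<eta> \<eta>).
     principal (geod Y k x0 \<eta> ` (geod_dom (flat_form Y \<eta> \<eta>) \<inter> {\<sigma>..})))"

text \<open>The end at which the time of the normal form decreases.\<close>

definition upper_end :: "'n::finite set \<Rightarrow> 'n \<Rightarrow> real^'n \<Rightarrow> real^'n \<Rightarrow> (real^'n) filter" where
  "upper_end Y k x0 \<eta> = (INF \<sigma>\<in>geod_dom (flat_form Y \<eta> \<eta>).
     principal (geod Y k x0 \<eta> ` (geod_dom (flat_form Y \<eta> \<eta>) \<inter> {..\<sigma>})))"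

text \<open>An affine substitution maps the tails of \<open>J\<close> onto tails of the domain, with the opposite
direction if \<open>\<rho>\<close> is negative.\<close>

lemma end_filter_affine_reparam:
  assumes "\<rho> \<noteq> 0" and J: "J = {t. \<rho> * t + b \<in> geod_dom (flat_form Y \<eta> \<eta>)}"
    and c: "\<And>t. t \<in> J \<Longrightarrow> c t = geod Y k x0 \<eta> (\<rho> * t + b)"
  shows "end_filter c J = (if 0 < \<rho> then lower_end Y k x0 \<eta> else upper_end Y k x0 \<eta>)"
proof -
  let ?dom = "geod_dom (flat_form Y \<eta> \<eta>)"
  let ?h = "\<lambda>t. \<rho> * t + b"
  define tail where "tail \<sigma> = (if 0 < \<rho> then {\<sigma>..} else {..\<sigma>})" for \<sigma> :: real
  have surj: "\<exists>t. \<tau> = ?h t" for \<tau>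
    using assms(1) by (intro exI[of _ "(\<tau> - b) / \<rho>"]) simp
  have hJ: "?h ` J = ?dom"
  proof (intro equalityI subsetI)
    fix \<tau> assume "\<tau> \<in> ?dom"
    moreover obtain t where "\<tau> = ?h t" using surj by blast
    ultimately show "\<tau> \<in> ?h ` J" unfolding J by blast
  qed (auto simp: J)
  have mono: "s \<le> t \<longleftrightarrow> ?h t \<in> tail (?h s)" for s t
    using assms(1) by (auto simp: tail_def)
  have tails: "c ` (J \<inter> {s..}) = geod Y k x0 \<eta> ` (?dom \<inter> tail (?h s))" for s
  proof -
    have "?h ` (J \<inter> {s..}) = ?dom \<inter> tail (?h s)"
      unfolding hJ[symmetric] using mono by auto
    moreover have "c ` (J \<inter> {s..}) = geod Y k x0 \<eta> ` ?h ` (J \<inter> {s..})"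
      unfolding image_image by (rule image_cong) (use c in auto)
    ultimately show ?thesis by simp
  qed
  have "end_filter c J = (INF \<sigma>\<in>?h ` J. principal (geod Y k x0 \<eta> ` (?dom \<inter> tail \<sigma>)))"
    unfolding end_filter_def tails image_image ..
  then show ?thesis by (simp add: hJ lower_end_def upper_end_def tail_def)
qed

lemma geodesic_ends_geod_curve:
  assumes kY: "k \<notin> Y" and x0: "x0 $ k = 0" and \<eta>: "\<eta> $ k = 0"
  shows "geodesic_ends (half_space_metric Y k) (half_space k) (geod_curve Y k x0 \<eta>)
    = {lower_end Y k x0 \<eta>, upper_end Y k x0 \<eta>}"
proof (intro equalityI subsetI)
  fix E assume "E \<in> geodesic_ends (half_space_metric Y k) (half_space k) (geod_curve Y k x0 \<eta>)"
  then obtain c J where E: "E = end_filter c J"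
    and param: "affine_parametrization (half_space_metric Y k) (half_space k) (geod_curve Y k x0 \<eta>) c J"
    unfolding geodesic_ends_def by blast
  from param obtain \<rho> b where "\<rho> \<noteq> 0" "J = {t. \<rho> * t + b \<in> geod_dom (flat_form Y \<eta> \<eta>)}"
    "\<And>t. t \<in> J \<Longrightarrow> c t = geod Y k x0 \<eta> (\<rho> * t + b)"
    by (rule affine_parametrization_geod_curveE[OF kY x0 \<eta>]) blast
  from end_filter_affine_reparam[OF this] show "E \<in> {lower_end Y k x0 \<eta>, upper_end Y k x0 \<eta>}"
    by (simp add: E)
next
  fix E assume E: "E \<in> {lower_end Y k x0 \<eta>, upper_end Y k x0 \<eta>}"
  define \<rho> :: real where "\<rho> = (if E = lower_end Y k x0 \<eta> then 1 else - 1)"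
  have "\<rho> \<noteq> 0" by (simp add: \<rho>_def)
  from end_filter_affine_reparam[of \<rho> _ 0 Y \<eta> _ k x0, OF this refl refl]
  have "E = end_filter (\<lambda>t. geod Y k x0 \<eta> (\<rho> * t + 0)) {t. \<rho> * t + 0 \<in> geod_dom (flat_form Y \<eta> \<eta>)}"
    using E by (cases "E = lower_end Y k x0 \<eta>") (simp_all add: \<rho>_def)
  then show "E \<in> geodesic_ends (half_space_metric Y k) (half_space k) (geod_curve Y k x0 \<eta>)"
    unfolding geodesic_ends_def using affine_parametrization_geod[OF kY x0 \<eta> \<open>\<rho> \<noteq> 0\<close>, of 0] by blast
qed

lemma recip_height_mono: "B \<le> 0 \<Longrightarrow> s \<le> t \<Longrightarrow> recip_height B s \<le> recip_height B t"
  unfolding recip_height_def by (intro add_mono mult_left_mono_neg) auto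

text \<open>For \<open>q(\<eta>) \<le> 0\<close> the reciprocal height increases, so \<open>X\<close> and \<open>z\<close> both decrease with time and stay in a
rectangle. The rectangle reaches down to the boundary, so it is compact in the closed half-space only.\<close>

lemma geod_lower_tail_compact:
  assumes x0: "x0 $ k = 0" and \<eta>: "\<eta> $ k = 0" and B: "flat_form Y \<eta> \<eta> \<le> 0"
    and \<tau>1: "\<tau>1 \<in> geod_dom (flat_form Y \<eta> \<eta>)"
  obtains K where "compact K" and "K \<subseteq> half_space k \<union> half_space_boundary k"
    and "\<And>\<tau>. \<tau>1 \<le> \<tau> \<Longrightarrow> geod Y k x0 \<eta> \<tau> \<in> K"
proof -
  let ?S = "recip_height (flat_form Y \<eta> \<eta>)"
  define K where "K = (\<lambda>(X, z). x0 + X *\<^sub>R \<eta> + z *\<^sub>R axis k 1) ` ({0..exp (- \<tau>1) / ?S \<tau>1} \<times> {0..1 / ?S \<tau>1})"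
  have "compact K"
    unfolding K_def case_prod_beta
    by (intro compact_continuous_image continuous_intros compact_Times compact_Icc)
  moreover have "K \<subseteq> half_space k \<union> half_space_boundary k"
    using x0 \<eta> by (auto simp: K_def half_space_def half_space_boundary_def axis_def)
  moreover have "geod Y k x0 \<eta> \<tau> \<in> K" if "\<tau>1 \<le> \<tau>" for \<tau>
  proof -
    have "0 < ?S \<tau>1" using \<tau>1 by (simp add: geod_dom_def)
    moreover have "?S \<tau>1 \<le> ?S \<tau>" using B that by (rule recip_height_mono)
    ultimately have "0 < ?S \<tau>" "exp (- \<tau>) / ?S \<tau> \<le> exp (- \<tau>1) / ?S \<tau>1" "1 / ?S \<tau> \<le> 1 / ?S \<tau>1"
      using that by (auto intro!: frac_le)
    then show ?thesis unfolding K_def geod_def by (auto simp: image_iff intro!: bexI)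
  qed
  ultimately show thesis using that by blast
qed

text \<open>Since the reciprocal height takes every small positive value and increases, the height eventually
exceeds any bound valid on \<open>K\<close>.\<close>

lemma upper_end_escapes:
  assumes x0: "x0 $ k = 0" and \<eta>: "\<eta> $ k = 0" and B: "flat_form Y \<eta> \<eta> < 0"
  shows "escapes_compacts X (upper_end Y k x0 \<eta>)"
  unfolding escapes_compacts_def
proof (intro allI impI)
  fix K :: "(real^'a) set" assume "compact K \<and> K \<subseteq> X"
  then obtain M where "0 < M" and M: "\<And>x. x \<in> K \<Longrightarrow> norm x \<le> M"
    using compact_imp_bounded bounded_pos by metis
  let ?B = "flat_form Y \<eta> \<eta>"
  define h where "h = 1 / (M + 1)"
  have "0 < h" using \<open>0 < M\<close> by (simp add: h_def)
  \<comment> \<open>\<open>y\<close> is \<open>exp\<close> of the time at which the height is \<open>1 / h\<close>, the positive root of \<open>y\<^sup>2 - h y + B\<close>\<close>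
  define y where "y = (h + sqrt (h\<^sup>2 - 4 * ?B)) / 2"
  have "0 < h\<^sup>2 - 4 * ?B" using B zero_le_power2[of h] by linarith
  then have "0 < y" and "(sqrt (h\<^sup>2 - 4 * ?B))\<^sup>2 = h\<^sup>2 - 4 * ?B"
    using \<open>0 < h\<close> by (simp_all add: y_def add_pos_pos)
  then have "y * y + ?B = h * y"
    unfolding y_def by (simp add: power2_eq_square field_simps)
  then have "y + ?B * (1 / y) = h" using \<open>0 < y\<close> by (simp add: field_simps)
  then have S: "recip_height ?B (ln y) = h"
    using \<open>0 < y\<close> by (simp add: recip_height_def exp_minus inverse_eq_divide)
  then have dom: "ln y \<in> geod_dom ?B" using \<open>0 < h\<close> by (simp add: geod_dom_def)
  have "geod Y k x0 \<eta> \<tau> \<notin> K" if "\<tau> \<in> geod_dom ?B" "\<tau> \<le> ln y" for \<tau>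
  proof
    assume "geod Y k x0 \<eta> \<tau> \<in> K"
    then have "geod Y k x0 \<eta> \<tau> $ k \<le> M"
      using M component_le_norm_cart[of "geod Y k x0 \<eta> \<tau>" k] by fastforce
    moreover have "0 < recip_height ?B \<tau>" using that(1) by (simp add: geod_dom_def)
    moreover have "recip_height ?B \<tau> \<le> h"
      using recip_height_mono[OF _ that(2), of ?B] B S by simp
    then have "1 / h \<le> 1 / recip_height ?B \<tau>"
      using calculation(2) by (intro frac_le) auto
    ultimately show False using x0 \<eta> by (simp add: geod_nth_k h_def)
  qed
  then show "eventually (\<lambda>x. x \<notin> K) (upper_end Y k x0 \<eta>)"
    unfolding upper_end_def by (intro eventually_INF1[OF dom]) (auto simp: eventually_principal)
qed

lemma lower_end_not_escapes:
  assumes x0: "x0 $ k = 0" and \<eta>: "\<eta> $ k = 0" and B: "flat_form Y \<eta> \<eta> \<le> 0"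
  shows "\<not> escapes_compacts (half_space k \<union> half_space_boundary k) (lower_end Y k x0 \<eta>)"
proof
  let ?dom = "geod_dom (flat_form Y \<eta> \<eta>)"
  let ?\<tau> = "\<bar>flat_form Y \<eta> \<eta>\<bar>"
  assume escapes: "escapes_compacts (half_space k \<union> half_space_boundary k) (lower_end Y k x0 \<eta>)"
  have \<tau>: "?\<tau> \<in> ?dom" by (rule geod_dom_nonempty)
  obtain K where "compact K" "K \<subseteq> half_space k \<union> half_space_boundary k"
    and K: "\<And>\<tau>. ?\<tau> \<le> \<tau> \<Longrightarrow> geod Y k x0 \<eta> \<tau> \<in> K"
    by (rule geod_lower_tail_compact[OF x0 \<eta> B \<tau>]) blast
  with escapes have "eventually (\<lambda>x. x \<notin> K) (lower_end Y k x0 \<eta>)"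
    unfolding escapes_compacts_def by blast
  then have "\<exists>\<sigma>\<in>?dom. eventually (\<lambda>x. x \<notin> K) (principal (geod Y k x0 \<eta> ` (?dom \<inter> {\<sigma>..})))"
    unfolding lower_end_def
  proof (subst (asm) eventually_INF_base)
    show "?dom \<noteq> {}" using \<tau> by blast
    show "\<exists>\<tau>\<in>?dom. principal (geod Y k x0 \<eta> ` (?dom \<inter> {\<tau>..}))
        \<le> inf (principal (geod Y k x0 \<eta> ` (?dom \<inter> {\<sigma>..}))) (principal (geod Y k x0 \<eta> ` (?dom \<inter> {\<sigma>'..})))"
      if "\<sigma> \<in> ?dom" "\<sigma>' \<in> ?dom" for \<sigma> \<sigma>'
      using that by (intro bexI[of _ "max \<sigma> \<sigma>'"]) (auto simp: max_def)
  qed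
  then obtain \<sigma> where \<sigma>: "\<sigma> \<in> ?dom" "\<And>\<tau>. \<tau> \<in> ?dom \<Longrightarrow> \<sigma> \<le> \<tau> \<Longrightarrow> geod Y k x0 \<eta> \<tau> \<notin> K"
    by (auto simp: eventually_principal)
  have "max \<sigma> ?\<tau> \<in> ?dom" using \<tau> by (rule geod_dom_upward_closed) simp
  then show False using \<sigma>(2)[of "max \<sigma> ?\<tau>"] K[of "max \<sigma> ?\<tau>"] by simp
qed

text \<open>A geodesic inside the curve that exists up to time \<open>\<infinity>\<close> is a normal form in a time \<open>\<rho> t + b\<close> with
\<open>\<rho> \<ge> 0\<close>, because the domain is bounded below. So it remains in the compact set that contains the tail of the
normal form, and cannot converge to an escaping end.\<close>

lemma escaping_end_incomplete:
  assumes kY: "k \<notin> Y" and x0: "x0 $ k = 0" and \<eta>: "\<eta> $ k = 0" and B: "flat_form Y \<eta> \<eta> < 0"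
    and escapes: "escapes_compacts (half_space k \<union> half_space_boundary k) E"
  shows "incomplete_at_end (half_space_metric Y k) (half_space k) (geod_curve Y k x0 \<eta>) E"
  unfolding incomplete_at_end_def
proof
  let ?B = "flat_form Y \<eta> \<eta>"
  assume "\<exists>c J s. geodesic_on (half_space_metric Y k) (half_space k) c J \<and> {s..} \<subseteq> J
    \<and> c ` J \<subseteq> geod_curve Y k x0 \<eta> \<and> filterlim c E at_top"
  then obtain c J s where geodesic: "geodesic_on (half_space_metric Y k) (half_space k) c J"
    and s: "{s..} \<subseteq> J" and sub: "c ` J \<subseteq> geod_curve Y k x0 \<eta>" and lim: "filterlim c E at_top" by blast
  from geodesic_inside_geod_curve[OF kY x0 \<eta> geodesic sub] s obtain \<rho> b where
    c: "\<And>t. s \<le> t \<Longrightarrow> \<rho> * t + b \<in> geod_dom ?B \<and> c t = geod Y k x0 \<eta> (\<rho> * t + b)"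
    by (auto simp: subset_iff)
  \<comment> \<open>time cannot run towards the end of the domain, which lies at a finite parameter value\<close>
  have "0 \<le> \<rho>"
  proof (rule ccontr)
    assume "\<not> 0 \<le> \<rho>"
    define t where "t = max s ((ln (- ?B) / 2 - b) / \<rho>)"
    have "\<rho> * t \<le> \<rho> * ((ln (- ?B) / 2 - b) / \<rho>)"
      using \<open>\<not> 0 \<le> \<rho>\<close> by (intro mult_left_mono_neg) (auto simp: t_def)
    then have "2 * (\<rho> * t + b) \<le> ln (- ?B)" using \<open>\<not> 0 \<le> \<rho>\<close> by simp
    then have "exp (2 * (\<rho> * t + b)) \<le> - ?B"
      using B by (metis exp_le_cancel_iff exp_ln neg_0_less_iff_less)
    moreover have "\<rho> * t + b \<in> geod_dom ?B" using c[of t] by (simp add: t_def)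
    ultimately show False unfolding mem_geod_dom_iff by linarith
  qed
  have "\<rho> * s + b \<in> geod_dom ?B" using c[of s] by simp
  from geod_lower_tail_compact[OF x0 \<eta> less_imp_le[OF B] this]
  obtain K where K: "compact K" "K \<subseteq> half_space k \<union> half_space_boundary k"
    and tail: "\<And>\<tau>. \<rho> * s + b \<le> \<tau> \<Longrightarrow> geod Y k x0 \<eta> \<tau> \<in> K" by blast
  have "eventually (\<lambda>x. x \<notin> K) E" using escapes K unfolding escapes_compacts_def by blast
  with lim have "eventually (\<lambda>t. c t \<notin> K) at_top" unfolding filterlim_iff by blast
  moreover have "eventually (\<lambda>t. c t \<in> K) at_top"
    using eventually_ge_at_top[of s]
    by eventually_elim (use c tail \<open>0 \<le> \<rho>\<close> in \<open>simp add: mult_left_mono\<close>)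
  ultimately have "eventually (\<lambda>t::real. False) at_top" by eventually_elim simp
  then show False by simp
qed

theorem proposition4p6:
  fixes p q :: nat and Y :: "'n::finite set" and k :: 'n
  assumes "p \<ge> 1" and "CARD('n) = p + q" and "card Y = q" and "k \<notin> Y"
  shows
    "(\<forall>\<gamma>. spacelike_geodesic (half_space_metric Y k) (half_space k) \<gamma> \<longleftrightarrow>
         (\<exists>w. tangent_vector \<gamma> w \<and> of_listed_type Y k \<gamma> w)) \<and>
     (\<forall>\<gamma> w. spacelike_geodesic (half_space_metric Y k) (half_space k) \<gamma> \<and> tangent_vector \<gamma> w \<longrightarrow>
         of_listed_type Y k \<gamma> w) \<and>
     (\<forall>\<gamma> w. tangent_vector \<gamma> w \<and>
         (vertical_half_line k \<gamma> \<or> half_ellipse_type Y k \<gamma> w \<or> half_parabola_type Y k \<gamma> w) \<longrightarrow>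
         complete_geodesic (half_space_metric Y k) (half_space k) \<gamma>) \<and>
     (\<forall>\<gamma> w. tangent_vector \<gamma> w \<and> half_hyperbola_branch_type Y k \<gamma> w \<longrightarrow>
         (\<exists>!E. E \<in> geodesic_ends (half_space_metric Y k) (half_space k) \<gamma> \<and>
               escapes_compacts (half_space k \<union> half_space_boundary k) E) \<and>
         (\<forall>E \<in> geodesic_ends (half_space_metric Y k) (half_space k) \<gamma>.
            escapes_compacts (half_space k \<union> half_space_boundary k) E \<longrightarrow>
            incomplete_at_end (half_space_metric Y k) (half_space k) \<gamma> E))"
proof -
  note kY = \<open>k \<notin> Y\<close>
  let ?g = "half_space_metric Y k" and ?H = "half_space k"
  have listed: "of_listed_type Y k \<gamma> w" if "spacelike_geodesic ?g ?H \<gamma>" "tangent_vector \<gamma> w" for \<gamma> w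
    using that geod_curve_of_listed_type[OF kY] unfolding spacelike_geodesic_iff_geod_curve[OF kY] by blast
  have spacelike: "spacelike_geodesic ?g ?H \<gamma>" if "of_listed_type Y k \<gamma> w" for \<gamma> w
    using that nonhyperbolic_type_geod_curve[OF kY] hyperbolic_type_geod_curve[OF kY]
    unfolding of_listed_type_def spacelike_geodesic_iff_geod_curve[OF kY] by metis
  have tangent: "\<exists>w. tangent_vector \<gamma> w" if "spacelike_geodesic ?g ?H \<gamma>" for \<gamma>
    using that geod_curve_tangent_vector_exists[OF kY] unfolding spacelike_geodesic_iff_geod_curve[OF kY] by blast
  have complete: "complete_geodesic ?g ?H \<gamma>"
    if "vertical_half_line k \<gamma> \<or> half_ellipse_type Y k \<gamma> w \<or> half_parabola_type Y k \<gamma> w" for \<gamma> w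
    using nonhyperbolic_type_geod_curve[OF kY that] complete_geodesic_geod_curve[OF kY] by metis
  have ends: "(\<exists>!E. E \<in> geodesic_ends ?g ?H \<gamma> \<and> escapes_compacts (?H \<union> half_space_boundary k) E) \<and>
      (\<forall>E \<in> geodesic_ends ?g ?H \<gamma>. escapes_compacts (?H \<union> half_space_boundary k) E \<longrightarrow>
         incomplete_at_end ?g ?H \<gamma> E)"
    if "half_hyperbola_branch_type Y k \<gamma> w" for \<gamma> w
  proof -
    from that obtain x0 \<eta> where x0: "x0 $ k = 0" and \<eta>: "\<eta> $ k = 0" and B: "flat_form Y \<eta> \<eta> < 0"
      and \<gamma>: "\<gamma> = geod_curve Y k x0 \<eta>"
      by (rule hyperbolic_type_geod_curve[OF kY])
    show ?thesis
      using upper_end_escapes[OF x0 \<eta> B] lower_end_not_escapes[OF x0 \<eta> less_imp_le[OF B]]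
        escaping_end_incomplete[OF kY x0 \<eta> B]
      unfolding \<gamma> geodesic_ends_geod_curve[OF kY x0 \<eta>] by blast
  qed
  show ?thesis
    using listed spacelike tangent complete ends by blast
qed

end
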